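(* Let $k$ be a field of characteristic $\mathrm{char}(k)\neq 2$ containing a primitive fourth root of unity, and let $C\subset\mathbb{P}^2$ be the irreducible curve defined by the equation $$X^{4}-4ZYX^{2}-ZY^{3}+2Z^{2}Y^{2}-YZ^{3}=0.$$ Then the point $P=[1:0:0]$ is an outer Galois point of $C$, and the extension induced by the projection $\pi_P:C\dashrightarrow\mathbb{P}^1$ is Galois of degree $4$. The group $G_P$ extends to $\mathrm{Bir}(\mathbb{P}^2)$ but not to $\mathrm{Jonq}_P$.
   Context: Let $\pi_P:\mathbb{P}^2\dashrightarrow\mathbb{P}^1$, $[X:Y:Z]\mapsto[Y:Z]$, be the projection from $P=[1:0:0]$, and put $K_P=\pi_P^*(k(\mathbb{P}^1))\subseteq k(C)$; the extension induced by $\pi_P$ is $k(C)/K_P$. The point $P$ is a Galois point for $C$ if $k(C)/K_P$ is Galois, and then $G_P=\mathrm{Gal}(k(C)/K_P)$. A Galois point is inner if $P\in C$ and outer if $P\notin C$. Elements of $G_P$ are identified with birational maps $g:C\dashrightarrow C$ satisfying $\pi_P|_C\circ g=\pi_P|_C$. $\mathrm{Bir}(\mathbb{P}^2)$ is the group of birational self-maps of $\mathbb{P}^2$, and $\mathrm{Jonq}_P=\{\varphi\in\mathrm{Bir}(\mathbb{P}^2)\mid \exists\,\alpha\in\mathrm{Aut}(\mathbb{P}^1):\ \pi_P\circ\varphi=\alpha\circ\pi_P\}$. An element $\varphi\in\mathrm{Bir}(\mathbb{P}^2)$ preserves $C$ if it restricts to a birational transformation of $C$. An element $g\in G_P$ extends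 to $\varphi$ if $\varphi$ preserves $C$ and $\varphi|_C=g$. The group $G_P$ extends to a group $\Gamma\subseteq\mathrm{Bir}(\mathbb{P}^2)$ if there is a subgroup $H\subseteq\Gamma$ all of whose elements preserve $C$ and such that restriction to $C$ induces an isomorphism $H\to G_P$. *)

theory Defs
  imports
    "HOL-Algebra.Finite_Extensions"
    "HOL-Algebra.Bij"
    "HOL-Computational_Algebra.Computational_Algebra"
begin

section \<open>Ternary and binary forms\<close>

text \<open>
  The ring \<open>k[X,Y,Z]\<close> is \<open>k[Z][Y][X]\<close>: the outermost variable is \<open>X\<close>.
  Likewise \<open>k[Y,Z]\<close> is \<open>k[Z][Y]\<close>, which embeds into \<open>k[X,Y,Z]\<close> by \<open>A \<mapsto> [:A:]\<close>.
\<close>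

type_synonym 'k form2 = "'k poly poly"
type_synonym 'k form3 = "'k poly poly poly"
type_synonym 'k triple = "'k form3 \<times> 'k form3 \<times> 'k form3"

definition varX :: "'k::comm_ring_1 form3" where "varX = [:0, 1:]"
definition varY :: "'k::comm_ring_1 form3" where "varY = [:[:0, 1:]:]"
definition varZ :: "'k::comm_ring_1 form3" where "varZ = [:[:[:0, 1:]:]:]"

text \<open>The zero polynomial is homogeneous of every degree.\<close>

definition homog :: "nat \<Rightarrow> 'k::comm_ring_1 form3 \<Rightarrow> bool" where
  "homog d F \<longleftrightarrow> (\<forall>i j l.
     Polynomial.coeff (Polynomial.coeff (Polynomial.coeff F i) j) l \<noteq> 0 \<longrightarrow> i + j + l = d)"

text \<open>Evaluation at a pair or triple, with \<open>h\<close> applied to the coefficients.\<close>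

definition eval2 :: "('k::comm_ring_1 \<Rightarrow> 'r::comm_ring_1) \<Rightarrow> 'k form2 \<Rightarrow> 'r \<times> 'r \<Rightarrow> 'r" where
  "eval2 h A = (\<lambda>(b, c). poly (map_poly (\<lambda>B. poly (map_poly h B) c) A) b)"

definition eval3 :: "('k::comm_ring_1 \<Rightarrow> 'r::comm_ring_1) \<Rightarrow> 'k form3 \<Rightarrow> 'r \<times> 'r \<times> 'r \<Rightarrow> 'r" where
  "eval3 h F = (\<lambda>(a, b, c). poly (map_poly (\<lambda>A. eval2 h A (b, c)) F) a)"

definition subst2 :: "'k::comm_ring_1 form2 \<Rightarrow> 'k form2 \<times> 'k form2 \<Rightarrow> 'k form2" where
  "subst2 = eval2 (\<lambda>a. [:[:a:]:])"

definition subst3 :: "'k::comm_ring_1 form3 \<Rightarrow> 'k triple \<Rightarrow> 'k form3" where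
  "subst3 = eval3 (\<lambda>a. [:[:[:a:]:]:])"


section \<open>Rational maps and birational self-maps\<close>

text \<open>
  Throughout, \<open>p\<close> is a homogeneous polynomial which is either irreducible, in which case
  \<open>V(p)\<close> is a plane curve, or \<open>0\<close>, in which case \<open>V(p)\<close> is the plane itself; a polynomial
  vanishes on \<open>V(p)\<close> iff \<open>p\<close> divides it, and \<open>0 dvd F\<close> means \<open>F = 0\<close>.  A rational map from
  \<open>V(p)\<close> to the plane is given by three forms of the same degree, not all vanishing on
  \<open>V(p)\<close>; two triples give the same map iff they are proportional over the function field.
\<close>

definition rat_triples :: "'k::comm_ring_1 form3 \<Rightarrow> 'k triple set" where
  "rat_triples p = {(A, B, C). (\<exists>d. homog d A \<and> homog d B \<and> homog d C) \<and>
                               \<not> (p dvd A \<and> p dvd B \<and> p dvd C)}"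

definition rat_rel :: "'k::comm_ring_1 form3 \<Rightarrow> 'k triple rel" where
  "rat_rel p = {((A, B, C), (A', B', C')).
     (A, B, C) \<in> rat_triples p \<and> (A', B', C') \<in> rat_triples p \<and>
     p dvd A * B' - A' * B \<and> p dvd A * C' - A' * C \<and> p dvd B * C' - B' * C}"

text \<open>\<open>F \<circ> G\<close>, that is, first \<open>G\<close>:\<close>

definition comp3 :: "'k::comm_ring_1 triple \<Rightarrow> 'k triple \<Rightarrow> 'k triple" where
  "comp3 = (\<lambda>(A, B, C) G. (subst3 A G, subst3 B G, subst3 C G))"

definition self_triples :: "'k::comm_ring_1 form3 \<Rightarrow> 'k triple set" where
  "self_triples p = {F \<in> rat_triples p. p dvd subst3 p F}"

definition bir_triples :: "'k::comm_ring_1 form3 \<Rightarrow> 'k triple set" where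
  "bir_triples p = {F \<in> self_triples p. \<exists>G \<in> self_triples p.
     (comp3 F G, (varX, varY, varZ)) \<in> rat_rel p \<and> (comp3 G F, (varX, varY, varZ)) \<in> rat_rel p}"

text \<open>The group of birational self-maps of \<open>V(p)\<close>, under composition.\<close>

definition Bir :: "'k::comm_ring_1 form3 \<Rightarrow> 'k triple set monoid" where
  "Bir p = \<lparr>carrier = bir_triples p // rat_rel p,
            mult = (\<lambda>\<phi> \<psi>. rat_rel p `` {comp3 F G | F G. F \<in> \<phi> \<and> G \<in> \<psi>}),
            one = rat_rel p `` {(varX, varY, varZ)}\<rparr>"

abbreviation Bir_plane :: "'k::comm_ring_1 triple set monoid" where
  "Bir_plane \<equiv> Bir 0"

text \<open>
  The restriction to the curve \<open>V(f)\<close> of a rational self-map of the plane, computed from those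
  representatives that do not vanish identically on the curve.  All of these agree on the curve
  up to \<open>rat_rel f\<close>; the result is empty if there are none.
\<close>

definition restr :: "'k::comm_ring_1 form3 \<Rightarrow> 'k triple set \<Rightarrow> 'k triple set" where
  "restr f \<phi> = rat_rel f `` \<phi>"

definition preserves :: "'k::comm_ring_1 form3 \<Rightarrow> 'k triple set \<Rightarrow> bool" where
  "preserves f \<phi> \<longleftrightarrow> restr f \<phi> \<in> carrier (Bir f)"


section \<open>The function field\<close>

text \<open>Rational functions on \<open>V(p)\<close>: fractions of forms of equal degree, modulo \<open>p\<close>.\<close>

definition fractions :: "'k::comm_ring_1 form3 \<Rightarrow> ('k form3 \<times> 'k form3) set" where
  "fractions p = {(A, B). (\<exists>d. homog d A \<and> homog d B) \<and> \<not> p dvd B}"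

definition frac_rel :: "'k::comm_ring_1 form3 \<Rightarrow> ('k form3 \<times> 'k form3) rel" where
  "frac_rel p = {((A, B), (A', B')). (A, B) \<in> fractions p \<and> (A', B') \<in> fractions p \<and>
                                     p dvd A * B' - A' * B}"

definition function_field :: "'k::comm_ring_1 form3 \<Rightarrow> ('k form3 \<times> 'k form3) set ring" where
  "function_field p =
     \<lparr>carrier = fractions p // frac_rel p,
      mult = (\<lambda>u v. frac_rel p `` {(A * A', B * B') | A B A' B'. (A, B) \<in> u \<and> (A', B') \<in> v}),
      one = frac_rel p `` {(1, 1)},
      zero = frac_rel p `` {(0, 1)},
      add = (\<lambda>u v. frac_rel p `` {(A * B' + A' * B, B * B') | A B A' B'. (A, B) \<in> u \<and> (A', B') \<in> v})\<rparr>"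

text \<open>The pullback \<open>u \<circ> \<gamma>\<close> of a rational function \<open>u\<close> on \<open>V(p)\<close> along \<open>\<gamma> \<in> Bir(V(p))\<close>.\<close>

definition pullback ::
  "'k::comm_ring_1 form3 \<Rightarrow> 'k triple set \<Rightarrow> ('k form3 \<times> 'k form3) set \<Rightarrow> ('k form3 \<times> 'k form3) set" where
  "pullback p \<gamma> u = frac_rel p `` {(subst3 A G, subst3 B G) | A B G. (A, B) \<in> u \<and> G \<in> \<gamma>}"


section \<open>Galois extensions\<close>

definition gal_group :: "('a, 'b) ring_scheme \<Rightarrow> 'a set \<Rightarrow> ('a \<Rightarrow> 'a) monoid" where
  "gal_group L K = BijGroup (carrier L)
     \<lparr>carrier := {\<sigma> \<in> Bij (carrier L). \<sigma> \<in> ring_hom L L \<and> (\<forall>x \<in> K. \<sigma> x = x)}\<rparr>"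

definition galois_extension :: "('a, 'b) ring_scheme \<Rightarrow> 'a set \<Rightarrow> bool" where
  "galois_extension L K \<longleftrightarrow> Ring.field L \<and> subfield K L \<and>
     (\<forall>x \<in> carrier L. (ring.algebraic L over K) x) \<and>
     {x \<in> carrier L. \<forall>\<sigma> \<in> carrier (gal_group L K). \<sigma> x = x} = K"


section \<open>Projection from the point \<open>P = [1:0:0]\<close>\<close>

text \<open>
  The projection is \<open>[X:Y:Z] \<mapsto> [Y:Z]\<close>, so a rational function \<open>A/B\<close> on the projective line,
  with \<open>A\<close>, \<open>B\<close> forms in \<open>Y\<close>, \<open>Z\<close>, is pulled back to the curve \<open>V(f)\<close> as the class of
  \<open>[:A:]/[:B:]\<close>.
\<close>

definition K_P :: "'k::comm_ring_1 form3 \<Rightarrow> ('k form3 \<times> 'k form3) set set" where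
  "K_P f = {frac_rel f `` {([:A:], [:B:])} | A B d. homog d [:A:] \<and> homog d [:B:] \<and> B \<noteq> 0}"

definition galois_point_P :: "'k::comm_ring_1 form3 \<Rightarrow> bool" where
  "galois_point_P f \<longleftrightarrow> galois_extension (function_field f) (K_P f)"

definition outer_galois_point_P :: "'k::comm_ring_1 form3 \<Rightarrow> bool" where
  "outer_galois_point_P f \<longleftrightarrow> galois_point_P f \<and> eval3 id f (1, 0, 0) \<noteq> 0"

definition G_P :: "'k::comm_ring_1 form3 \<Rightarrow> (('k form3 \<times> 'k form3) set \<Rightarrow> ('k form3 \<times> 'k form3) set) monoid" where
  "G_P f = gal_group (function_field f) (K_P f)"

text \<open>
  Automorphisms of the projective line: a morphism is given by two coprime forms of the same
  degree, and an automorphism is a morphism with a two-sided inverse.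
\<close>

definition P1_morphisms :: "('k::field form2 \<times> 'k form2) set" where
  "P1_morphisms = {(A, B). (\<exists>d. homog d [:A:] \<and> homog d [:B:]) \<and> coprime A B}"

definition P1_inverse :: "'k::field form2 \<times> 'k form2 \<Rightarrow> 'k form2 \<times> 'k form2 \<Rightarrow> bool" where
  "P1_inverse \<alpha> \<beta> \<longleftrightarrow> (case \<alpha> of (A, B) \<Rightarrow>
     (subst2 A \<beta>, subst2 B \<beta>) \<noteq> (0, 0) \<and> subst2 A \<beta> * [:[:0, 1:]:] = subst2 B \<beta> * [:0, 1:])"

definition Aut_P1 :: "('k::field form2 \<times> 'k form2) set" where
  "Aut_P1 = {\<alpha> \<in> P1_morphisms. \<exists>\<beta> \<in> P1_morphisms. P1_inverse \<alpha> \<beta> \<and> P1_inverse \<beta> \<alpha>}"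

text \<open>
  For \<open>\<phi> = [F\<^sub>0:F\<^sub>1:F\<^sub>2]\<close> and \<open>\<alpha> = [A:B]\<close>, the two composites with the projection are
  \<open>[F\<^sub>1:F\<^sub>2]\<close> and \<open>[A(Y,Z):B(Y,Z)]\<close>.
\<close>

definition Jonq_P :: "'k::field triple set set" where
  "Jonq_P = {\<phi> \<in> carrier Bir_plane. \<exists>(A, B) \<in> Aut_P1. \<exists>(F0, F1, F2) \<in> \<phi>.
               (F1, F2) \<noteq> (0, 0) \<and> F1 * [:B:] = F2 * [:A:]}"

text \<open>
  A birational self-map \<open>\<gamma>\<close> of the curve acts on its function field by \<open>u \<mapsto> u \<circ> \<gamma>\<inverse>\<close>; the
  inverse turns the contravariant pullback into a group homomorphism.  This action identifies
  the \<open>\<gamma>\<close> commuting with the projection with the elements of \<open>G_P\<close>.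
\<close>

definition bir_act ::
  "'k::comm_ring_1 form3 \<Rightarrow> 'k triple set \<Rightarrow> ('k form3 \<times> 'k form3) set \<Rightarrow> ('k form3 \<times> 'k form3) set" where
  "bir_act f \<gamma> = (\<lambda>u \<in> carrier (function_field f). pullback f (inv\<^bsub>Bir f\<^esub> \<gamma>) u)"

definition G_P_extends_to :: "'k::comm_ring_1 form3 \<Rightarrow> 'k triple set set \<Rightarrow> bool" where
  "G_P_extends_to f \<Gamma> \<longleftrightarrow> (\<exists>H. subgroup H Bir_plane \<and> H \<subseteq> \<Gamma> \<and> (\<forall>\<phi> \<in> H. preserves f \<phi>) \<and>
     (\<lambda>\<phi>. bir_act f (restr f \<phi>)) \<in> iso (Bir_plane\<lparr>carrier := H\<rparr>) (G_P f))"

end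

theory Submission
  imports Defs
begin

text \<open>
  Rewriting the equation as \<open>(X\<^sup>2 - 2YZ)\<^sup>2 = YZ(Y + Z)\<^sup>2\<close> shows that the curve is rational,
  parametrised by \<open>w \<mapsto> [w\<^sup>3 + w : w\<^sup>4 : 1]\<close>; so \<open>k(C) = k(w)\<close>, \<open>K\<^sub>P = k(w\<^sup>4)\<close>, and \<open>G\<^sub>P\<close>
  consists of the maps \<open>w \<mapsto> cw\<close> with \<open>c\<^sup>4 = 1\<close>.  The curve has three nodes, and the quadratic
  involution \<open>q = [X(Y + Z) : X\<^sup>2 + Z\<^sup>2 - YZ : X\<^sup>2 + Y\<^sup>2 - YZ]\<close> based there maps it to the conic
  \<open>X\<^sup>2 = YZ\<close>, parametrised by \<open>[w : 1 : w\<^sup>2]\<close>.  Hence \<open>w \<mapsto> cw\<close> extends to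
  \<open>q \<circ> diag(c, 1, c\<^sup>2) \<circ> q\<close>, which depends multiplicatively on \<open>c\<close>.  On the other hand an
  extension in \<open>Jonq\<^sub>P\<close> must induce the identity on the base line and therefore acts on the
  generic fibre by a Moebius transformation over \<open>k(w\<^sup>4)\<close>; comparing exponents of \<open>w\<close> modulo \<open>4\<close>,
  no such transformation maps \<open>w\<^sup>3 + w\<close> to \<open>c(w - w\<^sup>3)\<close> when \<open>c\<^sup>2 = -1\<close>.
\<close>

section \<open>Ring maps and homogeneity\<close>

text \<open>With Z = 1 and Y = w^4 the squared form of the equation allows X^2 - 2 w^4 = w^2 (w^4 +
  1), that is X = w (1 + w^2); this is where the parametrisation comes from. The nodes are [0:1:1]
  and [r:1:-1] with r^2 = -2. Two of them need not be rational, but the conics through all three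
  have a basis over k, so the quadratic involution is defined over k. The map w -> -w extends by X
  -> -X, which lies in Jonq_P, so the obstruction must come from an element of order 4. An extension
  of such an element in Jonq_P has no bound on its degree known in advance. The bound comes from its
  inverse: with f/e the fibre coordinate of the extension, the inverse gives a homogeneous relation
  between f and e whose coefficients are linear in x. A divisibility argument then leaves a reduced
  numerator and denominator of degree at most 1 in x. This is done over k[y] and not over k(y), at
  the price of carrying nonzero constants through pseudo-division and a Bezout identity.\<close>

definition ring_map :: "('a::comm_ring_1 \<Rightarrow> 'b::comm_ring_1) \<Rightarrow> bool" where
  "ring_map g \<longleftrightarrow> g 0 = 0 \<and> g 1 = 1 \<and> (\<forall>x y. g (x + y) = g x + g y) \<and> (\<forall>x y. g (x * y) = g x * g y)"

lemma ring_mapD: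
  assumes "ring_map g"
  shows "g 0 = 0" "g 1 = 1" "g (x + y) = g x + g y" "g (x * y) = g x * g y"
  using assms by (auto simp: ring_map_def)

lemma ring_map_uminus:
  assumes "ring_map g" shows "g (- x) = - g x"
proof -
  have "g (- x) + g x = 0" using ring_mapD[OF assms] by (metis add.left_inverse)
  then show ?thesis by (simp add: eq_neg_iff_add_eq_0)
qed

lemma ring_map_diff:
  assumes "ring_map g" shows "g (x - y) = g x - g y"
  using ring_mapD(3)[OF assms, of x "- y"] ring_map_uminus[OF assms] by simp

lemma ring_map_power:
  assumes "ring_map g" shows "g (x ^ n) = g x ^ n"
  by (induction n) (simp_all add: ring_mapD[OF assms])

lemma ring_map_of_nat:
  assumes "ring_map g" shows "g (of_nat n) = of_nat n"
  by (induction n) (simp_all add: ring_mapD[OF assms])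

lemma ring_map_numeral:
  assumes "ring_map g" shows "g (numeral n) = numeral n"
  using ring_map_of_nat[OF assms, of "numeral n"] by simp

lemma ring_map_sum:
  assumes "ring_map g" shows "g (sum f A) = (\<Sum>i\<in>A. g (f i))"
  by (induction A rule: infinite_finite_induct) (simp_all add: ring_mapD[OF assms])

lemmas ring_map_simps =
  ring_mapD ring_map_uminus ring_map_diff ring_map_power ring_map_numeral ring_map_sum

lemma ring_map_comp: "ring_map g \<Longrightarrow> ring_map h \<Longrightarrow> ring_map (\<lambda>x. g (h x))"
  by (simp add: ring_map_def)

lemma ring_map_id: "ring_map (\<lambda>x. x)"
  by (simp add: ring_map_def)

lemma ring_map_const: "ring_map (\<lambda>a. [:a:])"
  by (simp add: ring_map_def)

lemma ring_map_poly: "ring_map (\<lambda>p. poly p x)"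
  by (simp add: ring_map_def)

lemma ring_map_pcompose: "ring_map (\<lambda>p::'a::comm_ring_1 poly. pcompose p q)"
  by (simp add: ring_map_def pcompose_add pcompose_mult pcompose_1)

lemma ring_map_map_poly:
  assumes g: "ring_map g" shows "ring_map (map_poly g)"
proof -
  note gs = ring_mapD[OF g]
  have add: "map_poly g (p + q) = map_poly g p + map_poly g q" for p q
    by (rule poly_eqI) (simp add: coeff_map_poly gs)
  have smult: "map_poly g (smult a p) = smult (g a) (map_poly g p)" for a p
    by (rule poly_eqI) (simp add: coeff_map_poly gs)
  have mult: "map_poly g (p * q) = map_poly g p * map_poly g q" for p q
  proof (induction p)
    case 0 then show ?case by simp
  next
    case (pCons a p)
    then show ?case by (simp add: add smult map_poly_pCons gs)
  qed
  show ?thesis unfolding ring_map_def using add mult gs by simp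
qed

lemma ring_map_eval1:
  assumes "ring_map g" shows "ring_map (\<lambda>p. poly (map_poly g p) x)"
  using ring_map_comp[OF ring_map_poly ring_map_map_poly[OF assms]] .

lemma ring_map_eval2:
  assumes "ring_map h" shows "ring_map (\<lambda>A. eval2 h A v)"
  using ring_map_eval1[OF ring_map_eval1[OF assms]] by (cases v) (simp add: eval2_def)

lemma ring_map_eval3:
  assumes "ring_map h" shows "ring_map (\<lambda>F. eval3 h F v)"
  using ring_map_eval1[OF ring_map_eval2[OF assms]] by (cases v) (simp add: eval3_def)

lemma ring_map_const2: "ring_map (\<lambda>a. [:[:a:]:])"
  and ring_map_const3: "ring_map (\<lambda>a. [:[:[:a:]:]:])"
  by (simp_all add: ring_map_def one_pCons)

section \<open>Evaluation maps and the universal property of k[X,Y,Z]\<close>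

lemma eval2_gens:
  assumes "ring_map h"
  shows "eval2 h [:[:a:]:] (y, z) = h a" "eval2 h [:0, 1:] (y, z) = y" "eval2 h [:[:0, 1:]:] (y, z) = z"
  by (simp_all add: eval2_def map_poly_pCons ring_mapD[OF assms])

lemma eval3_form2: "eval3 h [:A:] (x, y, z) = eval2 h A (y, z)" if "ring_map h"
  by (simp add: eval3_def map_poly_pCons ring_mapD[OF ring_map_eval2[OF that]])

lemma eval3_gens:
  assumes "ring_map h"
  shows "eval3 h varX (x, y, z) = x" "eval3 h varY (x, y, z) = y" "eval3 h varZ (x, y, z) = z"
  by (simp_all add: eval3_def eval2_def varX_def varY_def varZ_def map_poly_pCons ring_mapD[OF assms])

lemma eval3_const:
  assumes "ring_map h" shows "eval3 h [:[:[:a:]:]:] v = h a"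
  using assms by (cases v) (simp add: eval3_form2 eval2_gens)

lemma form3_induct [case_names const X Y Z add mult]:
  assumes const: "\<And>a. P [:[:[:a:]:]:]" and X: "P varX" and Y: "P varY" and Z: "P varZ"
    and add: "\<And>F G. P F \<Longrightarrow> P G \<Longrightarrow> P (F + G)" and mult: "\<And>F G. P F \<Longrightarrow> P G \<Longrightarrow> P (F * G)"
  shows "P (F :: 'k::comm_ring_1 form3)"
proof -
  have 1: "P [:[:B:]:]" for B
  proof (induction B)
    case 0 show ?case using const[of 0] by simp
  next
    case (pCons a B)
    have "[:[:pCons a B:]:] = [:[:[:a:]:]:] + varZ * [:[:B:]:]" by (simp add: varZ_def)
    then show ?case using add mult const Z pCons by metis
  qed
  have 2: "P [:A:]" for A
  proof (induction A)
    case 0 show ?case using const[of 0] by simp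
  next
    case (pCons B A)
    have "[:pCons B A:] = [:[:B:]:] + varY * [:A:]" by (simp add: varY_def)
    then show ?case using add mult 1 Y pCons by metis
  qed
  show ?thesis
  proof (induction F)
    case 0 show ?case using const[of 0] by simp
  next
    case (pCons A F)
    have "pCons A F = [:A:] + varX * F" by (simp add: varX_def)
    then show ?case using add mult 2 X pCons by metis
  qed
qed

text \<open>Universal property of k[X,Y,Z]. Evaluations, substitutions, parametrisations and their
  composites are all ring maps, so identities between them need checking on constants and variables
  only.\<close>

lemma ring_map_form3_eqI:
  fixes g g' :: "'k::comm_ring_1 form3 \<Rightarrow> 'r::comm_ring_1"
  assumes g: "ring_map g" and g': "ring_map g'"
    and "\<And>a. g [:[:[:a:]:]:] = g' [:[:[:a:]:]:]" "g varX = g' varX" "g varY = g' varY" "g varZ = g' varZ"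
  shows "g F = g' F"
  using assms(3-)
  by (induction F rule: form3_induct) (auto simp: ring_mapD[OF g] ring_mapD[OF g'])

lemma ring_map_comp_eval3:
  assumes g: "ring_map g" and h: "ring_map h"
  shows "g (eval3 h F (x, y, z)) = eval3 (\<lambda>a. g (h a)) F (g x, g y, g z)"
proof -
  have gh: "ring_map (\<lambda>a. g (h a))" using ring_map_comp[OF g h] .
  show ?thesis
    by (rule ring_map_form3_eqI[OF ring_map_comp[OF g ring_map_eval3[OF h]] ring_map_eval3[OF gh]])
       (simp_all add: eval3_gens[OF h] eval3_gens[OF gh] eval3_const[OF h] eval3_const[OF gh])
qed

text \<open>Substitution descends to residues modulo p. Together with homogeneity, this compares the
  values of a form on two proportional representatives of a rational map.\<close>

lemma eval3_cong:
  fixes p :: "'r::comm_ring_1"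
  assumes h: "ring_map h" and d: "p dvd x - x'" "p dvd y - y'" "p dvd z - z'"
  shows "p dvd eval3 h F (x, y, z) - eval3 h F (x', y', z')"
proof (induction F rule: form3_induct)
  case (add F G)
  then show ?case using dvd_add[OF add] by (simp add: ring_mapD[OF ring_map_eval3[OF h]] algebra_simps)
next
  case (mult F G)
  have "a * b - a' * b' = (a - a') * b + a' * (b - b')" for a b a' b' :: 'r by (simp add: algebra_simps)
  then show ?case using mult by (simp add: ring_mapD[OF ring_map_eval3[OF h]])
qed (use d in \<open>simp_all add: eval3_gens[OF h] eval3_const[OF h]\<close>)

section \<open>Substitution and composition of triples\<close>

lemma ring_map_subst3: "ring_map (\<lambda>F. subst3 F v)"
  unfolding subst3_def by (rule ring_map_eval3[OF ring_map_const3])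

lemmas subst3_hom = ring_map_simps[OF ring_map_subst3]

lemma subst3_gens:
  "subst3 varX (A, B, C) = A" "subst3 varY (A, B, C) = B" "subst3 varZ (A, B, C) = C"
  "subst3 [:[:[:a:]:]:] v = [:[:[:a:]:]:]"
  unfolding subst3_def
  by (simp_all add: eval3_gens[OF ring_map_const3] eval3_const[OF ring_map_const3])

lemma subst3_id: "subst3 F (varX, varY, varZ) = F"
  by (rule ring_map_form3_eqI[OF ring_map_subst3 ring_map_id]) (simp_all add: subst3_gens)

lemma eval3_subst3:
  assumes h: "ring_map h"
  shows "eval3 h (subst3 F (A, B, C)) v = eval3 h F (eval3 h A v, eval3 h B v, eval3 h C v)"
  unfolding subst3_def
  by (simp add: ring_map_comp_eval3[OF ring_map_eval3[OF h] ring_map_const3] eval3_const[OF h])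

lemma subst3_subst3:
  "subst3 (subst3 F (A, B, C)) v = subst3 F (subst3 A v, subst3 B v, subst3 C v)"
  using eval3_subst3[OF ring_map_const3] by (simp add: subst3_def)

lemma comp3_simp: "comp3 (A, B, C) G = (subst3 A G, subst3 B G, subst3 C G)"
  by (simp add: comp3_def)

lemma comp3_assoc: "comp3 (comp3 F G) H = comp3 F (comp3 G H)"
  by (cases F; cases G) (simp add: comp3_simp subst3_subst3)

lemma comp3_id: "comp3 F (varX, varY, varZ) = F" "comp3 (varX, varY, varZ) F = F"
  by (cases F; simp add: comp3_simp subst3_id subst3_gens)+

text \<open>The substitution \<open>(X, Y, Z) \<mapsto> (TX, TY, TZ)\<close> into \<open>k[X,Y,Z][T]\<close>: homogeneity of degree \<open>d\<close>
  means that it multiplies by \<open>T\<^sup>d\<close>, which makes homogeneity compatible with ring maps.\<close>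

definition scaling :: "'k::comm_ring_1 form3 \<Rightarrow> 'k form3 poly" where
  "scaling F = eval3 (\<lambda>a. [:[:[:[:a:]:]:]:]) F ([:0, varX:], [:0, varY:], [:0, varZ:])"

lemma ring_map_const4: "ring_map (\<lambda>a. [:[:[:[:a:]:]:]:])"
  by (simp add: ring_map_def one_pCons)

lemma ring_map_scaling: "ring_map scaling"
  unfolding scaling_def[abs_def] by (rule ring_map_eval3[OF ring_map_const4])

lemma scaling_gens:
  "scaling [:[:[:a:]:]:] = [:[:[:[:a:]:]:]:]"
  "scaling varX = [:0, varX:]" "scaling varY = [:0, varY:]" "scaling varZ = [:0, varZ:]"
  by (simp_all add: scaling_def eval3_gens[OF ring_map_const4] eval3_const[OF ring_map_const4])

text \<open>Multiplication by a single variable only shifts one index, so F is built up from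
  constants one variable at a time; general products would bring in convolutions of
  coefficients.\<close>

lemma coeff_scaling:
  "Polynomial.coeff (Polynomial.coeff (Polynomial.coeff (Polynomial.coeff (scaling F) n) i) j) l =
     (if i + j + l = n then Polynomial.coeff (Polynomial.coeff (Polynomial.coeff F i) j) l else 0)"
proof -
  let ?c = "\<lambda>F i j l. Polynomial.coeff (Polynomial.coeff (Polynomial.coeff F i) j) l"
  let ?Q = "\<lambda>F. \<forall>n i j l. ?c (Polynomial.coeff (scaling F) n) i j l = (if i + j + l = n then ?c F i j l else 0)"
  note s = ring_mapD[OF ring_map_scaling] scaling_gens
  have add: "?Q (F + G)" if "?Q F" "?Q G" for F G using that by (simp add: s)
  have X: "?Q (varX * F)" if "?Q F" for F
  proof -
    have "scaling (varX * F) = [:0, varX:] * scaling F" by (simp only: s)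
    then show ?thesis using that by (auto simp: varX_def coeff_pCons split: nat.split)
  qed
  have Y: "?Q (varY * F)" if "?Q F" for F
  proof -
    have "scaling (varY * F) = [:0, varY:] * scaling F" by (simp only: s)
    then show ?thesis using that by (auto simp: varY_def coeff_pCons split: nat.split)
  qed
  have Z: "?Q (varZ * F)" if "?Q F" for F
  proof -
    have "scaling (varZ * F) = [:0, varZ:] * scaling F" by (simp only: s)
    then show ?thesis using that by (auto simp: varZ_def coeff_pCons split: nat.split)
  qed
  have c: "?Q [:[:[:a:]:]:]" for a
    by (auto simp: s coeff_pCons split: nat.split)
  have 1: "?Q [:[:B:]:]" for B
  proof (induction B)
    case 0 show ?case by (simp add: s)
  next
    case (pCons a B)
    have "[:[:pCons a B:]:] = [:[:[:a:]:]:] + varZ * [:[:B:]:]" by (simp add: varZ_def)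
    then show ?case using add[OF c Z[OF pCons(2)]] by metis
  qed
  have 2: "?Q [:A:]" for A
  proof (induction A)
    case 0 show ?case by (simp add: s)
  next
    case (pCons B A)
    have "[:pCons B A:] = [:[:B:]:] + varY * [:A:]" by (simp add: varY_def)
    then show ?case using add[OF 1 Y[OF pCons(2)]] by metis
  qed
  have "?Q F"
  proof (induction F)
    case 0 show ?case by (simp add: s)
  next
    case (pCons A F)
    have "pCons A F = [:A:] + varX * F" by (simp add: varX_def)
    then show ?case using add[OF 2 X[OF pCons(2)]] by metis
  qed
  then show ?thesis by blast
qed

lemma homog_iff_scaling: "homog d F \<longleftrightarrow> scaling F = Polynomial.monom F d"
proof
  assume "homog d F"
  then show "scaling F = Polynomial.monom F d"
    unfolding homog_def by (intro poly_eqI) (auto simp: coeff_scaling coeff_monom)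
next
  assume eq: "scaling F = Polynomial.monom F d"
  show "homog d F" unfolding homog_def
  proof (intro allI impI)
    fix i j l assume nz: "Polynomial.coeff (Polynomial.coeff (Polynomial.coeff F i) j) l \<noteq> 0"
    have "Polynomial.coeff (Polynomial.coeff (Polynomial.coeff (Polynomial.coeff (scaling F) (i + j + l)) i) j) l \<noteq> 0"
      using nz by (simp add: coeff_scaling)
    then show "i + j + l = d" unfolding eq by (auto simp: coeff_monom split: if_splits)
  qed
qed

lemma homog_0 [simp]: "homog d 0"
  by (simp add: homog_def)

lemma homog_mult: "homog d F \<Longrightarrow> homog e G \<Longrightarrow> homog (d + e) (F * G)"
  by (simp add: homog_iff_scaling ring_mapD[OF ring_map_scaling] mult_monom)

lemma homog_add: "homog d F \<Longrightarrow> homog d G \<Longrightarrow> homog d (F + G)"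
  by (simp add: homog_iff_scaling ring_mapD[OF ring_map_scaling] add_monom)

lemma homog_uminus: "homog d F \<Longrightarrow> homog d (- F)"
  by (simp add: homog_iff_scaling ring_map_uminus[OF ring_map_scaling] minus_monom)

lemma homog_diff: "homog d F \<Longrightarrow> homog d G \<Longrightarrow> homog d (F - G)"
  using homog_add[OF _ homog_uminus] by force

lemma homog_power: "homog d F \<Longrightarrow> homog (d * n) (F ^ n)"
  by (simp add: homog_iff_scaling ring_map_power[OF ring_map_scaling] monom_power mult.commute)

lemma homog_sum: "(\<And>i. i \<in> A \<Longrightarrow> homog d (f i)) \<Longrightarrow> homog d (sum f A)"
  by (induction A rule: infinite_finite_induct) (simp_all add: homog_add)

lemma homog_const: "homog 0 [:[:[:a:]:]:]"
  by (simp add: homog_iff_scaling scaling_gens monom_0)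

lemma homog_const_mult: "homog d F \<Longrightarrow> homog d ([:[:[:a:]:]:] * F)"
  using homog_mult[OF homog_const] by fastforce

lemma homog_vars: "homog 1 varX" "homog 1 varY" "homog 1 varZ"
  by (simp_all add: homog_iff_scaling scaling_gens monom_Suc monom_0)

lemma eval3_homog:
  assumes h: "ring_map h" and F: "homog d F"
  shows "eval3 h F (t * x, t * y, t * z) = t ^ d * eval3 h F (x, y, z)"
proof -
  \<comment> \<open>Coefficients are evaluated at (x, y, z) and the scaling parameter at t. The
    definition of \<open>scaling\<close> turns this into the left side of the claim, homogeneity of
    F into the right side.\<close>
  let ?g = "\<lambda>P. poly (map_poly (\<lambda>F. eval3 h F (x, y, z)) P) t"
  note e = ring_map_eval3[OF h, of "(x, y, z)"]
  note g = ring_map_eval1[OF e, of t]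
  have "?g (scaling F) = eval3 (\<lambda>a. ?g [:[:[:[:a:]:]:]:]) F (?g [:0, varX:], ?g [:0, varY:], ?g [:0, varZ:])"
    unfolding scaling_def by (rule ring_map_comp_eval3[OF g ring_map_const4])
  also have "\<dots> = eval3 h F (t * x, t * y, t * z)"
    by (simp add: map_poly_pCons ring_mapD[OF e] eval3_gens[OF h] eval3_const[OF h] mult.commute)
  also have "?g (scaling F) = t ^ d * eval3 h F (x, y, z)"
    using F by (simp add: homog_iff_scaling map_poly_monom ring_mapD[OF e] poly_monom mult.commute)
  finally show ?thesis by simp
qed

lemma subst3_homog:
  assumes "homog d F"
  shows "subst3 F (t * A, t * B, t * C) = t ^ d * subst3 F (A, B, C)"
  using eval3_homog[OF ring_map_const3 assms] by (simp add: subst3_def)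

text \<open>As a ring map, \<open>scaling\<close> passes to the arguments of F and multiplies each
  of them by T^n; homogeneity of F then pulls out T^(n d).\<close>

lemma homog_subst3:
  assumes F: "homog d F" and G: "homog n A" "homog n B" "homog n C"
  shows "homog (n * d) (subst3 F (A, B, C))"
proof -
  have const: "ring_map (\<lambda>G::'a form3. [:G:])" by (rule ring_map_const)
  have T: "scaling A = Polynomial.monom 1 n * [:A:]" "scaling B = Polynomial.monom 1 n * [:B:]"
      "scaling C = Polynomial.monom 1 n * [:C:]"
    using G by (simp_all add: homog_iff_scaling smult_monom)
  have "scaling (subst3 F (A, B, C)) = eval3 (\<lambda>a. [:[:[:[:a:]:]:]:]) F (scaling A, scaling B, scaling C)"
    unfolding subst3_def by (simp add: ring_map_comp_eval3[OF ring_map_scaling ring_map_const3] scaling_gens)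
  also have "\<dots> = Polynomial.monom 1 n ^ d * eval3 (\<lambda>a. [:[:[:[:a:]:]:]:]) F ([:A:], [:B:], [:C:])"
    unfolding T by (rule eval3_homog[OF ring_map_const4 F])
  also have "eval3 (\<lambda>a. [:[:[:[:a:]:]:]:]) F ([:A:], [:B:], [:C:]) = [:subst3 F (A, B, C):]"
    unfolding subst3_def by (simp add: ring_map_comp_eval3[OF const ring_map_const3])
  finally show ?thesis
    by (simp add: homog_iff_scaling monom_power smult_monom)
qed

section \<open>Birational self-maps of an integral form\<close>

lemma dvd_diff_cases:
  fixes p :: "'a::comm_ring_1" assumes "p dvd x - y"
  shows "p dvd x \<longleftrightarrow> p dvd y"
  using dvd_diff[OF _ assms, of x] dvd_add[OF assms, of y] by auto

lemma dvd_swap: "(p :: 'a::comm_ring_1) dvd x - y \<longleftrightarrow> p dvd y - x"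
  by (metis dvd_minus_iff minus_diff_eq)

text \<open>Primality is stated through divisibility because cancellation modulo p is what every
  argument uses. It also admits p = 0, where divisibility means equality with 0, so the plane and
  the curve are instances of the same construction.\<close>

locale integral_form =
  fixes p :: "'k::field form3" and D :: nat
  assumes homog_p: "homog D p"
    and prime_p: "p dvd A * B \<Longrightarrow> p dvd A \<or> p dvd B"
    and nonunit_p: "\<not> p dvd 1"
begin

lemma power_dvdD: "p dvd A ^ n \<Longrightarrow> p dvd A"
proof (induction n)
  case 0 then show ?case using nonunit_p by simp
next
  case (Suc n) then show ?case using prime_p[of A "A ^ n"] by auto
qed

lemma cancel_dvd: "p dvd A * B \<Longrightarrow> \<not> p dvd A \<Longrightarrow> p dvd B"
  using prime_p by blast

lemma rat_relI:
  assumes "(A, B, C) \<in> rat_triples p" "(A', B', C') \<in> rat_triples p" "\<not> p dvd a"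
    and d: "p dvd a * A - b * A'" "p dvd a * B - b * B'" "p dvd a * C - b * C'"
  shows "((A, B, C), (A', B', C')) \<in> rat_rel p"
proof -
  have *: "p dvd x * y' - x' * y" if "p dvd a * x - b * x'" "p dvd a * y - b * y'" for x x' y y'
  proof -
    have "a * (x * y' - x' * y) = (a * x - b * x') * y' - x' * (a * y - b * y')"
      by (simp add: algebra_simps)
    then have "p dvd a * (x * y' - x' * y)" using that by simp
    then show ?thesis using assms(3) cancel_dvd by blast
  qed
  show ?thesis using assms(1,2) *[OF d(1,2)] *[OF d(1,3)] *[OF d(2,3)] by (simp add: rat_rel_def)
qed

text \<open>The multipliers are a coordinate of the second triple that does not vanish on V(p) and
  the matching coordinate of the first. The latter cannot vanish either, since proportionality would
  then kill the whole first triple. Being forms, the multipliers stay nonzero under a dominant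
  substitution.\<close>

lemma rat_relE:
  assumes "((A, B, C), (A', B', C')) \<in> rat_rel p"
  obtains a b m n where "homog m a" "homog n b" "\<not> p dvd a" "\<not> p dvd b"
    "p dvd a * A - b * A'" "p dvd a * B - b * B'" "p dvd a * C - b * C'"
proof -
  note goal = that
  from assms have F: "(A, B, C) \<in> rat_triples p" and F': "(A', B', C') \<in> rat_triples p"
    and d: "p dvd A * B' - A' * B" "p dvd A * C' - A' * C" "p dvd B * C' - B' * C"
    by (auto simp: rat_rel_def)
  from F obtain m where m: "homog m A" "homog m B" "homog m C"
    and nd: "\<not> (p dvd A \<and> p dvd B \<and> p dvd C)" by (auto simp: rat_triples_def)
  from F' obtain n where n: "homog n A'" "homog n B'" "homog n C'"
    and nd': "\<not> (p dvd A' \<and> p dvd B' \<and> p dvd C')" by (auto simp: rat_triples_def)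
  have main: thesis if u: "homog m u" "homog n u'" "\<not> p dvd u'"
    and e: "p dvd u' * A - u * A'" "p dvd u' * B - u * B'" "p dvd u' * C - u * C'" for u u'
  proof -
    have "\<not> p dvd u"
    proof
      assume "p dvd u"
      then have "p dvd u' * A" "p dvd u' * B" "p dvd u' * C"
        using e[THEN dvd_diff_cases] by simp_all
      then show False using nd u(3) cancel_dvd by blast
    qed
    from goal[OF u(2,1,3) this e] show thesis .
  qed
  have d': "p dvd A' * B - A * B'" "p dvd A' * C - A * C'" "p dvd B' * C - B * C'"
    using d dvd_swap by blast+
  consider "\<not> p dvd A'" | "\<not> p dvd B'" | "\<not> p dvd C'" using nd' by blast
  then show thesis
  proof cases
    case 1
    show ?thesis by (rule main[OF m(1) n(1) 1]) (use d' in \<open>simp_all add: mult.commute\<close>)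
  next
    case 2
    show ?thesis by (rule main[OF m(2) n(2) 2]) (use d d' in \<open>simp_all add: mult.commute\<close>)
  next
    case 3
    show ?thesis by (rule main[OF m(3) n(3) 3]) (use d in \<open>simp_all add: mult.commute\<close>)
  qed
qed

lemma rat_rel_triples: "(F, G) \<in> rat_rel p \<Longrightarrow> F \<in> rat_triples p \<and> G \<in> rat_triples p"
  by (auto simp: rat_rel_def)

lemma rat_rel_refl: "F \<in> rat_triples p \<Longrightarrow> (F, F) \<in> rat_rel p"
  by (cases F) (simp add: rat_rel_def mult.commute)

lemma rat_rel_sym: "(F, G) \<in> rat_rel p \<Longrightarrow> (G, F) \<in> rat_rel p"
  using dvd_swap by (cases F; cases G) (auto simp: rat_rel_def)

text \<open>Vanishing minors do not compose directly, since the middle triple may have zero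
  coordinates; the proportionality factors simply multiply.\<close>

lemma rat_rel_trans:
  assumes "(F, G) \<in> rat_rel p" "(G, H) \<in> rat_rel p" shows "(F, H) \<in> rat_rel p"
proof -
  obtain A B C A' B' C' A'' B'' C'' where eq: "F = (A, B, C)" "G = (A', B', C')" "H = (A'', B'', C'')"
    by (cases F; cases G; cases H) blast
  obtain a b where 1: "\<not> p dvd a" "p dvd a * A - b * A'" "p dvd a * B - b * B'" "p dvd a * C - b * C'"
    using rat_relE[OF assms(1)[unfolded eq]] by metis
  obtain c d where 2: "\<not> p dvd c" "p dvd c * A' - d * A''" "p dvd c * B' - d * B''" "p dvd c * C' - d * C''"
    using rat_relE[OF assms(2)[unfolded eq]] by metis
  have *: "p dvd (c * a) * x - (b * d) * z" if "p dvd a * x - b * y" "p dvd c * y - d * z" for x y z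
  proof -
    have "(c * a) * x - (b * d) * z = c * (a * x - b * y) + b * (c * y - d * z)"
      by (simp add: algebra_simps)
    then show ?thesis using that by simp
  qed
  show ?thesis unfolding eq
    by (rule rat_relI[of _ _ _ _ _ _ "c * a" "b * d"])
       (use assms[THEN rat_rel_triples] eq 1 2 * prime_p in blast)+
qed

lemma rat_rel_class_eq: "(F, G) \<in> rat_rel p \<Longrightarrow> rat_rel p `` {F} = rat_rel p `` {G}"
  by (auto intro: rat_rel_trans rat_rel_trans[OF rat_rel_sym])

text \<open>If a G and b G' agree modulo p, then a^d F(G) and b^d F(G') agree for a form F of degree
  d. The outer forms may vanish on the image of a non-dominant G, so one composite is assumed to be
  defined.\<close>

lemma comp3_right:
  assumes GG': "(G, G') \<in> rat_rel p" and F: "\<exists>d. homog d A \<and> homog d B \<and> homog d C"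
    and FG: "comp3 (A, B, C) G \<in> rat_triples p"
  shows "(comp3 (A, B, C) G, comp3 (A, B, C) G') \<in> rat_rel p"
proof -
  obtain G0 G1 G2 H0 H1 H2 where eq: "G = (G0, G1, G2)" "G' = (H0, H1, H2)"
    by (cases G; cases G') blast
  obtain d where d: "homog d A" "homog d B" "homog d C" using F by blast
  obtain n where n: "homog n H0" "homog n H1" "homog n H2"
    using rat_rel_triples[OF GG'] unfolding eq rat_triples_def by auto
  obtain a b where ab: "\<not> p dvd a" "\<not> p dvd b"
    and e: "p dvd a * G0 - b * H0" "p dvd a * G1 - b * H1" "p dvd a * G2 - b * H2"
    using rat_relE[OF GG'[unfolded eq]] by metis
  have *: "p dvd a ^ d * subst3 F G - b ^ d * subst3 F G'" if "homog d F" for F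
    unfolding eq subst3_homog[OF that, symmetric] using eval3_cong[OF ring_map_const3 e]
    by (simp add: subst3_def)
  have "comp3 (A, B, C) G' \<in> rat_triples p"
  proof -
    have "p dvd subst3 F G" if "homog d F" "p dvd subst3 F G'" for F
    proof -
      have "p dvd a ^ d * subst3 F G" using *[OF that(1), THEN dvd_diff_cases] that(2) by simp
      then show ?thesis using ab power_dvdD cancel_dvd by blast
    qed
    moreover have "\<exists>e. homog e (subst3 A G') \<and> homog e (subst3 B G') \<and> homog e (subst3 C G')"
      unfolding eq using homog_subst3 d n by blast
    ultimately show ?thesis using FG d unfolding comp3_simp rat_triples_def by blast
  qed
  then show ?thesis unfolding comp3_simp
    by (intro rat_relI[of _ _ _ _ _ _ "a ^ d" "b ^ d"])
       (use FG ab power_dvdD * d in \<open>auto simp: comp3_simp\<close>)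
qed

lemma subst3_self_dvd: "F \<in> self_triples p \<Longrightarrow> p dvd A \<Longrightarrow> p dvd subst3 A F"
  unfolding self_triples_def dvd_def[of p A] by (auto simp: subst3_hom)

text \<open>A divisor of Y is constant in X. If it also divides X, whose coefficient at X is 1, it
  is a unit.\<close>

lemma id_rat_triples: "(varX, varY, varZ) \<in> rat_triples p"
proof -
  have "\<not> (p dvd varX \<and> p dvd varY \<and> p dvd varZ)"
  proof
    assume a: "p dvd varX \<and> p dvd varY \<and> p dvd varZ"
    then obtain u where u: "varX = p * u" by blast
    from a obtain v where v: "varY = p * v" by blast
    have nz: "p \<noteq> 0" "u \<noteq> 0" "v \<noteq> 0" using u v by (auto simp: varX_def varY_def)
    have "degree p + degree v = 0"
      using arg_cong[OF v, of degree] nz by (simp add: degree_mult_eq varY_def)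
    then obtain P where P: "p = [:P:]" by (metis add_is_0 degree_eq_zeroE)
    have "Polynomial.coeff varX 1 = P * Polynomial.coeff u 1" unfolding u P by simp
    then have "1 = P * Polynomial.coeff u 1" by (simp add: varX_def)
    then have "p * [:Polynomial.coeff u 1:] = 1" unfolding P by (simp add: one_pCons)
    then show False using nonunit_p by (metis dvd_triv_left)
  qed
  then show ?thesis unfolding rat_triples_def using homog_vars by auto
qed

text \<open>A birational map is dominant: composing with an inverse recovers a multiple of \<open>A\<close>.\<close>

lemma subst3_nonzero:
  assumes G: "G \<in> bir_triples p" and A: "homog d A" and nd: "\<not> p dvd A"
  shows "\<not> p dvd subst3 A G"
proof
  assume dvd: "p dvd subst3 A G"
  from G obtain G' where G': "G' \<in> self_triples p" "(comp3 G G', (varX, varY, varZ)) \<in> rat_rel p"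
    unfolding bir_triples_def by blast
  obtain G0 G1 G2 where eq: "G = (G0, G1, G2)" by (cases G) blast
  obtain a b where ab: "\<not> p dvd b"
    and e: "p dvd a * subst3 G0 G' - b * varX" "p dvd a * subst3 G1 G' - b * varY" "p dvd a * subst3 G2 G' - b * varZ"
    using rat_relE[OF G'(2)[unfolded eq comp3_simp]] by metis
  have "p dvd a ^ d * subst3 (subst3 A G) G'"
    using subst3_self_dvd[OF G'(1) dvd] by simp
  moreover have "p dvd a ^ d * subst3 (subst3 A G) G' - b ^ d * A"
    using eval3_cong[OF ring_map_const3 e, where F = A, folded subst3_def]
    unfolding eq subst3_subst3 subst3_homog[OF A] subst3_id .
  ultimately have "p dvd b ^ d * A" using dvd_diff_cases by blast
  then show False using ab nd power_dvdD cancel_dvd by blast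
qed

text \<open>The multipliers relating F and F' can be pulled back along G because a birational G is
  dominant: by \<open>subst3_nonzero\<close> they do not become zero.\<close>

lemma comp3_left:
  assumes FF': "(F, F') \<in> rat_rel p" and G: "G \<in> bir_triples p"
  shows "(comp3 F G, comp3 F' G) \<in> rat_rel p"
proof -
  obtain A B C A' B' C' where eq: "F = (A, B, C)" "F' = (A', B', C')"
    by (cases F; cases F') blast
  obtain a b m where a: "homog m a" "\<not> p dvd a"
    and e: "p dvd a * A - b * A'" "p dvd a * B - b * B'" "p dvd a * C - b * C'"
    using rat_relE[OF FF'[unfolded eq]] by metis
  have self: "G \<in> self_triples p" using G by (simp add: bir_triples_def)
  obtain n G0 G1 G2 where n: "G = (G0, G1, G2)" "homog n G0" "homog n G1" "homog n G2"
    using self unfolding self_triples_def rat_triples_def by auto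
  have rt: "comp3 E G \<in> rat_triples p" if "E \<in> rat_triples p" for E
  proof -
    obtain E0 E1 E2 d where E: "E = (E0, E1, E2)" "homog d E0" "homog d E1" "homog d E2"
      "\<not> (p dvd E0 \<and> p dvd E1 \<and> p dvd E2)" using \<open>E \<in> _\<close> unfolding rat_triples_def by auto
    have "\<not> (p dvd subst3 E0 G \<and> p dvd subst3 E1 G \<and> p dvd subst3 E2 G)"
      using E subst3_nonzero[OF G] by blast
    moreover have "\<exists>d. homog d (subst3 E0 G) \<and> homog d (subst3 E1 G) \<and> homog d (subst3 E2 G)"
      using homog_subst3 n E by blast
    ultimately show ?thesis by (simp add: E comp3_simp rat_triples_def)
  qed
  have *: "p dvd subst3 a G * subst3 x G - subst3 b G * subst3 y G" if "p dvd a * x - b * y" for x y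
    using subst3_self_dvd[OF self that] by (simp add: subst3_hom)
  show ?thesis unfolding eq comp3_simp
    by (rule rat_relI[of _ _ _ _ _ _ "subst3 a G" "subst3 b G"])
      (use rt rat_rel_triples[OF FF'] * e subst3_nonzero[OF G a] in \<open>auto simp: eq comp3_simp\<close>)
qed

lemma self_triples_cong:
  assumes F: "F \<in> self_triples p" and FF': "(F, F') \<in> rat_rel p"
  shows "F' \<in> self_triples p"
proof -
  obtain A B C A' B' C' where eq: "F = (A, B, C)" "F' = (A', B', C')"
    by (cases F; cases F') blast
  obtain a b where ab: "\<not> p dvd b"
    and e: "p dvd a * A - b * A'" "p dvd a * B - b * B'" "p dvd a * C - b * C'"
    using rat_relE[OF FF'[unfolded eq]] by metis
  have "p dvd a ^ D * subst3 p F - b ^ D * subst3 p F'"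
    unfolding eq subst3_homog[OF homog_p, symmetric]
    using eval3_cong[OF ring_map_const3 e] by (simp add: subst3_def)
  moreover have "p dvd a ^ D * subst3 p F" using F by (simp add: self_triples_def)
  ultimately have "p dvd b ^ D * subst3 p F'" using dvd_diff_cases by blast
  then show ?thesis using ab power_dvdD cancel_dvd rat_rel_triples[OF FF']
    unfolding self_triples_def by blast
qed

lemma self_triples_homog: "(A, B, C) \<in> self_triples p \<Longrightarrow> \<exists>d. homog d A \<and> homog d B \<and> homog d C"
  by (auto simp: self_triples_def rat_triples_def)

lemma comp3_self_right:
  assumes "(G, G') \<in> rat_rel p" "F \<in> self_triples p" "comp3 F G \<in> rat_triples p"
  shows "(comp3 F G, comp3 F G') \<in> rat_rel p"
proof -
  obtain A B C where F: "F = (A, B, C)" by (cases F) blast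
  show ?thesis unfolding F
    by (rule comp3_right[OF assms(1) self_triples_homog]) (use assms F in simp_all)
qed

lemma bir_triples_cong:
  assumes F: "F \<in> bir_triples p" and FF': "(F, F') \<in> rat_rel p"
  shows "F' \<in> bir_triples p"
proof -
  obtain G where G: "G \<in> self_triples p" "(comp3 F G, (varX, varY, varZ)) \<in> rat_rel p"
    "(comp3 G F, (varX, varY, varZ)) \<in> rat_rel p" using F by (auto simp: bir_triples_def)
  have Fs: "F \<in> self_triples p" using F by (simp add: bir_triples_def)
  have "G \<in> bir_triples p" using G Fs by (auto simp: bir_triples_def)
  then have "(comp3 F' G, (varX, varY, varZ)) \<in> rat_rel p"
    using comp3_left[OF FF'] rat_rel_trans rat_rel_sym G by blast
  moreover have "(comp3 G F', (varX, varY, varZ)) \<in> rat_rel p"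
    using comp3_self_right[OF FF' G(1)] rat_rel_triples[OF G(3)] rat_rel_trans rat_rel_sym G by blast
  ultimately show ?thesis using self_triples_cong[OF Fs FF'] G(1) by (auto simp: bir_triples_def)
qed

lemma comp3_bir_triples:
  assumes F: "F \<in> bir_triples p" and G: "G \<in> bir_triples p"
  shows "comp3 F G \<in> bir_triples p"
proof -
  obtain F' where F': "F' \<in> self_triples p" "(comp3 F F', (varX, varY, varZ)) \<in> rat_rel p"
    "(comp3 F' F, (varX, varY, varZ)) \<in> rat_rel p" using F by (auto simp: bir_triples_def)
  obtain G' where G': "G' \<in> self_triples p" "(comp3 G G', (varX, varY, varZ)) \<in> rat_rel p"
    "(comp3 G' G, (varX, varY, varZ)) \<in> rat_rel p" using G by (auto simp: bir_triples_def)
  have s: "F \<in> self_triples p" "G \<in> self_triples p" using F G by (simp_all add: bir_triples_def)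
  have b: "F' \<in> bir_triples p" "G' \<in> bir_triples p" using s F' G' by (auto simp: bir_triples_def)
  have r: "E \<in> rat_triples p" if "E \<in> self_triples p" for E using that by (simp add: self_triples_def)
  have comp_self: "comp3 E K \<in> self_triples p" if E: "E \<in> self_triples p" and K: "K \<in> bir_triples p" for E K
  proof -
    have "comp3 E K \<in> rat_triples p"
      using comp3_left[OF rat_rel_refl[OF r[OF E]] K] rat_rel_triples by blast
    moreover have "subst3 p (comp3 E K) = subst3 (subst3 p E) K"
      by (cases E) (simp add: comp3_simp subst3_subst3)
    moreover have "p dvd subst3 (subst3 p E) K"
      by (rule subst3_self_dvd) (use E K in \<open>simp_all add: self_triples_def bir_triples_def\<close>)
    ultimately show ?thesis by (simp add: self_triples_def)
  qed
  \<comment> \<open>Applied twice: the inverse of F o G is G' o F', and both composites collapse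
    from the inside.\<close>
  have *: "(comp3 (comp3 E K) (comp3 K' E'), (varX, varY, varZ)) \<in> rat_rel p"
    if "E' \<in> bir_triples p" "E \<in> bir_triples p" "(comp3 E E', (varX, varY, varZ)) \<in> rat_rel p"
      "(comp3 K K', (varX, varY, varZ)) \<in> rat_rel p" for E E' K K'
  proof -
    have E's: "E' \<in> rat_triples p" "E \<in> self_triples p" using that r by (auto simp: bir_triples_def)
    have 1: "(comp3 (comp3 K K') E', E') \<in> rat_rel p"
      using comp3_left[OF that(4,1)] by (simp add: comp3_id)
    have "comp3 E E' \<in> rat_triples p" using that(3) rat_rel_triples by blast
    then have "(comp3 E E', comp3 E (comp3 (comp3 K K') E')) \<in> rat_rel p"
      using comp3_self_right[OF rat_rel_sym[OF 1] E's(2)] by blast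
    from rat_rel_trans[OF rat_rel_sym[OF this] that(3)] show ?thesis by (simp add: comp3_assoc)
  qed
  have "comp3 G' F' \<in> self_triples p" using comp_self[OF G'(1) b(1)] .
  then show ?thesis unfolding bir_triples_def
    using comp_self[OF s(1) G] *[OF b(1) F F'(2) G'(2)] *[OF G b(2) G'(3) F'(3)] by auto
qed

section \<open>The group of birational classes\<close>

abbreviation cls :: "'k triple \<Rightarrow> 'k triple set" where "cls F \<equiv> rat_rel p `` {F}"

lemma bir_carrier: "carrier (Bir p) = cls ` bir_triples p"
  by (auto simp: Bir_def quotient_def)

lemma bir_rat: "F \<in> bir_triples p \<Longrightarrow> F \<in> rat_triples p"
  by (simp add: bir_triples_def self_triples_def)

lemma cls_self: "F \<in> rat_triples p \<Longrightarrow> F \<in> cls F"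
  using rat_rel_refl by blast

lemma bir_mult:
  assumes F: "F \<in> bir_triples p" and G: "G \<in> bir_triples p"
  shows "cls F \<otimes>\<^bsub>Bir p\<^esub> cls G = cls (comp3 F G)"
proof -
  have FG: "comp3 F G \<in> bir_triples p" using comp3_bir_triples[OF F G] .
  have "(comp3 F G, comp3 F' G') \<in> rat_rel p" if F': "F' \<in> cls F" and G': "G' \<in> cls G" for F' G'
  proof -
    have 1: "(comp3 F G, comp3 F' G) \<in> rat_rel p" using comp3_left[OF _ G] F' by blast
    have "F' \<in> self_triples p" using bir_triples_cong[OF F] F' by (auto simp: bir_triples_def)
    then have "(comp3 F' G, comp3 F' G') \<in> rat_rel p"
      using comp3_self_right[of G G' F'] G' rat_rel_triples[OF 1] by blast
    with 1 show ?thesis using rat_rel_trans by blast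
  qed
  then have "cls (comp3 F' G') = cls (comp3 F G)" if "F' \<in> cls F" "G' \<in> cls G" for F' G'
    using that rat_rel_class_eq by blast
  moreover have "F \<in> cls F" "G \<in> cls G" using cls_self bir_rat F G by auto
  ultimately have "rat_rel p `` {comp3 F' G' | F' G'. F' \<in> cls F \<and> G' \<in> cls G} = cls (comp3 F G)"
    by blast
  then show ?thesis by (simp add: Bir_def)
qed

lemma id_bir_triples: "(varX, varY, varZ) \<in> bir_triples p"
proof -
  have "(varX, varY, varZ) \<in> self_triples p"
    using id_rat_triples by (simp add: self_triples_def subst3_id)
  then show ?thesis using rat_rel_refl[OF id_rat_triples] by (auto simp: bir_triples_def comp3_id)
qed

lemma bir_one: "\<one>\<^bsub>Bir p\<^esub> = cls (varX, varY, varZ)"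
  by (simp add: Bir_def)

lemma bir_inverse_exists:
  assumes "F \<in> bir_triples p"
  shows "\<exists>G \<in> bir_triples p. cls G \<otimes>\<^bsub>Bir p\<^esub> cls F = \<one>\<^bsub>Bir p\<^esub>"
proof -
  obtain G where G: "G \<in> self_triples p" "(comp3 F G, (varX, varY, varZ)) \<in> rat_rel p"
    "(comp3 G F, (varX, varY, varZ)) \<in> rat_rel p" using assms by (auto simp: bir_triples_def)
  then have "G \<in> bir_triples p" using assms by (auto simp: bir_triples_def)
  then show ?thesis using bir_mult[OF _ assms] rat_rel_class_eq[OF G(3)] by (auto simp: bir_one)
qed

lemma group_Bir: "group (Bir p)"
proof (rule groupI)
  show "\<And>x y. x \<in> carrier (Bir p) \<Longrightarrow> y \<in> carrier (Bir p) \<Longrightarrow> x \<otimes>\<^bsub>Bir p\<^esub> y \<in> carrier (Bir p)"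
    by (auto simp: bir_carrier bir_mult comp3_bir_triples)
  show "\<one>\<^bsub>Bir p\<^esub> \<in> carrier (Bir p)" by (simp add: bir_carrier bir_one id_bir_triples)
  show "\<And>x y z. x \<in> carrier (Bir p) \<Longrightarrow> y \<in> carrier (Bir p) \<Longrightarrow> z \<in> carrier (Bir p) \<Longrightarrow>
      x \<otimes>\<^bsub>Bir p\<^esub> y \<otimes>\<^bsub>Bir p\<^esub> z = x \<otimes>\<^bsub>Bir p\<^esub> (y \<otimes>\<^bsub>Bir p\<^esub> z)"
    by (auto simp: bir_carrier bir_mult comp3_bir_triples comp3_assoc)
  show "\<And>x. x \<in> carrier (Bir p) \<Longrightarrow> \<one>\<^bsub>Bir p\<^esub> \<otimes>\<^bsub>Bir p\<^esub> x = x"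
    by (auto simp: bir_carrier bir_one bir_mult id_bir_triples comp3_id)
  show "\<And>x. x \<in> carrier (Bir p) \<Longrightarrow> \<exists>y\<in>carrier (Bir p). y \<otimes>\<^bsub>Bir p\<^esub> x = \<one>\<^bsub>Bir p\<^esub>"
    using bir_inverse_exists by (fastforce simp: bir_carrier)
qed

end

lemma integral_form_0: "integral_form (0 :: 'k::field form3) 0"
  by standard (auto simp: homog_def)

section \<open>The curve and its parametrisation\<close>

definition quartic :: "'k::comm_ring_1 form3" where
  "quartic = varX ^ 4 - 4 * varZ * varY * varX ^ 2 - varZ * varY ^ 3
             + 2 * varZ ^ 2 * varY ^ 2 - varY * varZ ^ 3"

lemma coeff_pcompose_monom4:
  fixes A :: "'a::comm_ring_1 poly"
  shows "Polynomial.coeff (pcompose A (Polynomial.monom c 4)) n =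
     (if 4 dvd n then Polynomial.coeff A (n div 4) * c ^ (n div 4) else 0)"
proof (induction A arbitrary: n)
  case 0 then show ?case by simp
next
  case (pCons a A)
  show ?case
  proof (cases "n < 4")
    case True
    then have "4 dvd n \<longleftrightarrow> n = 0" using dvd_imp_le by fastforce
    then show ?thesis using True by (auto simp: pcompose_pCons coeff_monom_mult coeff_pCons split: nat.split)
  next
    case False
    then obtain m where n: "n = m + 4" by (metis add.commute le_Suc_ex not_less)
    have "(m + 4) div 4 = Suc (m div 4)" by simp
    then show ?thesis unfolding n
      by (simp add: pcompose_pCons coeff_monom_mult pCons.IH coeff_pCons split: nat.split)
  qed
qed

text \<open>Comparing exponents modulo \<open>4\<close>, the powers \<open>1, w, w\<^sup>2, w\<^sup>3\<close> are independent over \<open>R[cw\<^sup>4]\<close>.\<close>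

lemma mod4_independent:
  fixes A :: "nat \<Rightarrow> 'a::idom poly"
  assumes "c \<noteq> 0" and i: "i < 4"
    and sum: "(\<Sum>i<4. Polynomial.monom 1 i * pcompose (A i) (Polynomial.monom c 4)) = 0"
  shows "A i = 0"
proof (rule poly_eqI)
  fix n
  \<comment> \<open>The exponent 4 n + i occurs in the summand of index j only for j = i, because i
    and j are both below 4.\<close>
  have c: "Polynomial.coeff (Polynomial.monom 1 j * pcompose (A j) (Polynomial.monom c 4)) (4 * n + i)
      = (if j = i then Polynomial.coeff (A i) n * c ^ n else 0)" if "j < 4" for j
  proof (cases "4 * n + i < j")
    case True
    then have "j \<noteq> i" by simp
    then show ?thesis using True by (simp add: coeff_monom_mult)
  next
    case False
    then have "4 dvd (4 * n + i - j) \<longleftrightarrow> j = i" using that i by presburger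
    then show ?thesis using False that i by (auto simp: coeff_monom_mult coeff_pcompose_monom4)
  qed
  have "0 = (\<Sum>j<4. Polynomial.coeff (Polynomial.monom 1 j * pcompose (A j) (Polynomial.monom c 4)) (4 * n + i))"
    using arg_cong[OF sum, of "\<lambda>p. Polynomial.coeff p (4 * n + i)"] by (simp only: coeff_sum coeff_0)
  also have "\<dots> = (\<Sum>j<4. if j = i then Polynomial.coeff (A i) n * c ^ n else 0)"
    using c by (intro sum.cong) auto
  also have "\<dots> = Polynomial.coeff (A i) n * c ^ n" using i by simp
  finally show "Polynomial.coeff (A i) n = Polynomial.coeff 0 n" using \<open>c \<noteq> 0\<close> by simp
qed

lemma sum_lessThan_4: "(\<Sum>i<4. f i) = f 0 + f 1 + f 2 + f (3::nat)"
  by (simp add: eval_nat_numeral)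

lemma mod4_independent':
  fixes A0 A1 A2 A3 :: "'a::idom poly"
  assumes "c \<noteq> 0"
    and sum: "pcompose A0 (Polynomial.monom c 4) + [:0, 1:] * pcompose A1 (Polynomial.monom c 4)
      + [:0, 1:] ^ 2 * pcompose A2 (Polynomial.monom c 4) + [:0, 1:] ^ 3 * pcompose A3 (Polynomial.monom c 4) = 0"
  shows "A0 = 0" "A1 = 0" "A2 = 0" "A3 = 0"
proof -
  let ?A = "\<lambda>i::nat. if i = 0 then A0 else if i = 1 then A1 else if i = 2 then A2 else A3"
  have W: "Polynomial.monom 1 n = [:0, 1:] ^ n" for n by (rule monom_altdef[of 1, simplified])
  have "(\<Sum>i<4. Polynomial.monom 1 i * pcompose (?A i) (Polynomial.monom c 4)) = 0"
    using sum by (simp add: sum_lessThan_4 W)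
  note * = mod4_independent[OF \<open>c \<noteq> 0\<close> _ this]
  show "A0 = 0" "A1 = 0" "A2 = 0" "A3 = 0" using *[of 0] *[of 1] *[of 2] *[of 3] by simp_all
qed

section \<open>The parametrisation and its kernel\<close>

definition param :: "'k::comm_ring_1 form3 \<Rightarrow> 'k poly" where
  "param F = eval3 (\<lambda>a. [:a:]) F ([:0, 1, 0, 1:], Polynomial.monom 1 4, 1)"

text \<open>The parametrisation \<open>param\<close> of the affine cone, in \<open>k[s][w]\<close>; unlike \<open>param\<close> it has kernel
  generated by the quartic on all of \<open>k[X,Y,Z]\<close>, not only on forms.\<close>

definition cone :: "'k::comm_ring_1 form3 \<Rightarrow> 'k poly poly" where
  "cone F = eval3 (\<lambda>a. [:[:a:]:]) F
     ([:0, [:0, 1:], 0, [:0, 1:]:], Polynomial.monom [:0, 1:] 4, [:[:0, 1:]:])"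

lemma ring_map_param: "ring_map param"
  unfolding param_def[abs_def] by (rule ring_map_eval3[OF ring_map_const])

lemma ring_map_cone: "ring_map cone"
  unfolding cone_def[abs_def] by (rule ring_map_eval3[OF ring_map_const2])

lemma param_gens:
  "param varX = [:0, 1, 0, 1:]" "param varY = Polynomial.monom 1 4" "param varZ = 1"
  "param [:[:[:a:]:]:] = [:a:]"
  by (simp_all add: param_def eval3_gens[OF ring_map_const] eval3_const[OF ring_map_const])

lemma cone_gens:
  "cone varX = [:[:0, 1:]:] * ([:0, 1:] + [:0, 1:] ^ 3)" "cone varY = [:[:0, 1:]:] * [:0, 1:] ^ 4"
  "cone varZ = [:[:0, 1:]:]" "cone [:[:[:a:]:]:] = [:[:a:]:]"
  by (simp_all add: cone_def eval3_gens[OF ring_map_const2] eval3_const[OF ring_map_const2]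
    monom_altdef eval_nat_numeral)

lemmas param_hom = ring_map_simps[OF ring_map_param]
lemmas cone_hom = ring_map_simps[OF ring_map_cone]

text \<open>The cone point is s times the parametrised point, so a form of degree d picks up s^d.
  Here \<open>map_poly\<close> embeds k[w] into k[s][w].\<close>

lemma param_homog:
  assumes "homog d F" shows "cone F = [:[:0, 1:]:] ^ d * map_poly (\<lambda>a. [:a:]) (param F)"
proof -
  note g = ring_map_map_poly[OF ring_map_const]
  have "map_poly (\<lambda>a. [:a:]) (param F) = eval3 (\<lambda>a. [:[:a:]:]) F
    (map_poly (\<lambda>a. [:a:]) [:0, 1, 0, 1:], map_poly (\<lambda>a. [:a:]) (Polynomial.monom 1 4), 1)"
    unfolding param_def
    by (simp add: ring_map_comp_eval3[OF g ring_map_const] map_poly_pCons)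
  also have "map_poly (\<lambda>a. [:a:]) [:0, 1, 0, 1:] = [:0, 1, 0, (1::'a poly):]"
    by (simp add: map_poly_pCons one_pCons)
  also have "map_poly (\<lambda>a. [:a:]) (Polynomial.monom 1 4) = Polynomial.monom (1::'a poly) 4"
    by (simp add: map_poly_monom one_pCons)
  finally have *: "map_poly (\<lambda>a. [:a:]) (param F) = eval3 (\<lambda>a. [:[:a:]:]) F ([:0, 1, 0, 1:], Polynomial.monom 1 4, 1)" .
  have "cone F = eval3 (\<lambda>a. [:[:a:]:]) F
      ([:[:0, 1:]:] * [:0, 1, 0, 1:], [:[:0, 1:]:] * Polynomial.monom 1 4, [:[:0, 1:]:] * 1)"
    unfolding cone_def by (simp add: smult_monom)
  then show ?thesis unfolding * eval3_homog[OF ring_map_const2 assms] .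
qed

lemma param_eq_0_iff_cone:
  fixes F :: "'k::field form3"
  assumes "homog d F" shows "param F = 0 \<longleftrightarrow> cone F = 0"
  using param_homog[OF assms] by (auto simp: map_poly_eq_0_iff)

text \<open>Z becomes the constant s of k[s][w]. A polynomial in k[Z][Y] can therefore be read as
  one over k[s], and the substitution for Y is composition with s w^4.\<close>

lemma cone_form2: "cone [:A:] = pcompose A (Polynomial.monom [:0, 1:] 4)"
proof -
  have *: "cone [:[:B:]:] = [:B:]" for B
  proof (induction B)
    case 0 show ?case by (simp add: cone_hom)
  next
    case (pCons a B)
    have "[:[:pCons a B:]:] = [:[:[:a:]:]:] + varZ * [:[:B:]:]" by (simp add: varZ_def)
    then have "cone [:[:pCons a B:]:] = cone [:[:[:a:]:]:] + cone varZ * cone [:[:B:]:]"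
      by (simp only: cone_hom)
    then show ?case by (simp add: pCons.IH cone_gens)
  qed
  show ?thesis
  proof (induction A)
    case 0 show ?case by (simp add: cone_hom)
  next
    case (pCons B A)
    have "[:pCons B A:] = [:[:B:]:] + varY * [:A:]" by (simp add: varY_def)
    then have "cone [:pCons B A:] = cone [:[:B:]:] + cone varY * cone [:A:]"
      by (simp only: cone_hom)
    then show ?case by (simp add: pCons.IH * pcompose_pCons cone_gens monom_altdef)
  qed
qed

lemma cone_quartic: "cone (quartic :: 'k::field form3) = 0"
proof -
  have "(s * (w + w ^ 3)) ^ 4 - 4 * s * (s * w ^ 4) * (s * (w + w ^ 3))\<^sup>2 - s * (s * w ^ 4) ^ 3
     + 2 * s\<^sup>2 * (s * w ^ 4)\<^sup>2 - s * w ^ 4 * s ^ 3 = 0" for s w :: "'k poly poly"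
    by (simp add: algebra_simps eval_nat_numeral)
  then show ?thesis unfolding quartic_def cone_hom cone_gens .
qed

lemma quartic_altdef:
  "quartic = [:[:0, - [:0, 0, 0, 1:], [:0, 0, 2:], - [:0, 1:]:], 0, [:0, - [:0, 4:]:], 0, 1:]"
  by (simp add: quartic_def varX_def varY_def varZ_def eval_nat_numeral numeral_poly one_pCons)

lemma degree_quartic: "Polynomial.degree (quartic :: 'k::field form3) = 4"
  and lead_coeff_quartic: "Polynomial.lead_coeff (quartic :: 'k::field form3) = 1"
  by (simp_all add: quartic_altdef)

text \<open>The powers 1, w, w^2, w^3 are independent over k[s][s w^4], and passing from them to the
  powers of X = s (w + w^3) is an invertible change over the fraction field. So no nonzero
  polynomial of degree below 4 in X vanishes on the cone.\<close>

lemma cone_low_degree: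
  fixes r0 r1 r2 r3 :: "'k::field form2"
  assumes "cone [:r0, r1, r2, r3:] = 0"
  shows "r0 = 0 \<and> r1 = 0 \<and> r2 = 0 \<and> r3 = 0"
proof -
  define s :: "'k poly" where "s = [:0, 1:]"
  define y where "y = Polynomial.monom s 4"
  define w :: "'k poly poly" where "w = [:0, 1:]"
  have s: "s \<noteq> 0" by (simp add: s_def)
  have y: "y = [:s:] * w ^ 4" by (simp add: y_def w_def monom_altdef)
  have x: "cone varX = [:s:] * (w + w ^ 3)" unfolding cone_gens s_def w_def ..
  have "[:r0, r1, r2, r3:] = [:r0:] + varX * [:r1:] + varX ^ 2 * [:r2:] + varX ^ 3 * [:r3:]"
    by (simp add: varX_def eval_nat_numeral)
  then have c: "cone [:r0, r1, r2, r3:] = pcompose r0 y + cone varX * pcompose r1 y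
      + (cone varX)\<^sup>2 * pcompose r2 y + cone varX ^ 3 * pcompose r3 y"
    by (simp only: cone_hom cone_form2 y_def s_def)
  \<comment> \<open>With y = s w^4 one has X^2 = 2 s y + (s^2 + s y) w^2 and X^3 = (3 s^2 y + s y^2)
    w + (s^3 + 3 s^2 y) w^3. \<open>A0\<close> to \<open>A3\<close> collect the coefficients of 1,
    w, w^2, w^3; \<open>pCons 0\<close> is multiplication by y.\<close>
  define A0 where "A0 = r0 + smult (2 * s) (pCons 0 r2)"
  define A1 where "A1 = smult s r1 + smult (3 * s\<^sup>2) (pCons 0 r3) + smult s (pCons 0 (pCons 0 r3))"
  define A2 where "A2 = smult (s\<^sup>2) r2 + smult s (pCons 0 r2)"
  define A3 where "A3 = smult s r1 + smult (s ^ 3) r3 + smult (3 * s\<^sup>2) (pCons 0 r3)"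
  have sm: "pcompose (smult a q) y = [:a:] * pcompose q y" for a q by (simp add: pcompose_smult)
  have p0: "pcompose (pCons 0 q) y = y * pcompose q y" for q by (simp add: pcompose_pCons)
  have cs: "[:2 * s:] = 2 * [:s:]" "[:3 * s\<^sup>2:] = 3 * [:s:]\<^sup>2" "[:s\<^sup>2:] = [:s:]\<^sup>2" "[:s ^ 3:] = [:s:] ^ 3"
    by (simp_all add: numeral_poly eval_nat_numeral)
  have ring: "P0 + 2 * S * (y * P2) + w * (S * P1 + 3 * S\<^sup>2 * (y * P3) + S * (y * (y * P3)))
      + w\<^sup>2 * (S\<^sup>2 * P2 + S * (y * P2)) + w ^ 3 * (S * P1 + S ^ 3 * P3 + 3 * S\<^sup>2 * (y * P3))
      = P0 + S * (w + w ^ 3) * P1 + (S * (w + w ^ 3))\<^sup>2 * P2 + (S * (w + w ^ 3)) ^ 3 * P3"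
    if "y = S * w ^ 4" for P0 P1 P2 P3 S y :: "'k poly poly"
    unfolding that by (simp add: algebra_simps eval_nat_numeral)
  have "pcompose A0 y + w * pcompose A1 y + w\<^sup>2 * pcompose A2 y + w ^ 3 * pcompose A3 y
      = cone [:r0, r1, r2, r3:]"
    unfolding c x A0_def A1_def A2_def A3_def pcompose_add sm p0 cs
    by (rule ring[OF y])
  then have sum: "pcompose A0 y + w * pcompose A1 y + w\<^sup>2 * pcompose A2 y + w ^ 3 * pcompose A3 y = 0"
    using assms by simp
  note z = mod4_independent'[OF s sum[unfolded y_def w_def]]
  have "[:s\<^sup>2, s:] * r2 = 0" using z(3) by (simp add: A2_def)
  then have r2: "r2 = 0" unfolding mult_eq_0_iff using s by simp
  \<comment> \<open>Subtracting removes \<open>r1\<close> and leaves (s y^2 - s^3)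
    \<open>r3\<close>.\<close>
  have "[:- (s ^ 3), 0, s:] * r3 = A1 - A3" by (simp add: A1_def A3_def algebra_simps)
  then have "[:- (s ^ 3), 0, s:] * r3 = 0" using z(2,4) by simp
  then have r3: "r3 = 0" unfolding mult_eq_0_iff using s by simp
  show ?thesis using z(1,2) s r2 r3 by (simp add: A0_def A1_def)
qed

text \<open>The quartic is monic in X, so division leaves a remainder of degree at most 3 which
  still vanishes on the cone and hence is zero. As the kernel of a map into a domain, the ideal of
  the quartic is prime.\<close>

lemma quartic_dvd_iff_cone: "(quartic :: 'k::field form3) dvd F \<longleftrightarrow> cone F = 0"
proof
  assume "quartic dvd F"
  then show "cone F = 0" by (auto simp: cone_hom cone_quartic)
next
  assume 0: "cone F = 0"
  obtain q r where qr: "pseudo_divmod F quartic = (q, r)" by (cases "pseudo_divmod F quartic") blast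
  have "(quartic :: 'k form3) \<noteq> 0" by (simp add: quartic_altdef)
  from pseudo_divmod[OF this qr] have F: "F = quartic * q + r"
    and r: "r = 0 \<or> Polynomial.degree r < 4"
    by (simp_all add: lead_coeff_quartic degree_quartic lead_coeff_quartic[unfolded degree_quartic])
  have "cone r = 0" using 0 unfolding F by (simp add: cone_hom cone_quartic)
  have deg: "Polynomial.coeff r n = 0" if "n \<ge> 4" for n using r that by (auto intro: coeff_eq_0)
  have "r = [:Polynomial.coeff r 0, Polynomial.coeff r 1, Polynomial.coeff r 2, Polynomial.coeff r 3:]"
    (is "r = ?r")
  proof (rule poly_eqI)
    fix n :: nat
    consider "n = 0" | "n = 1" | "n = 2" | "n = 3" | "n \<ge> 4" by linarith
    then show "Polynomial.coeff r n = Polynomial.coeff ?r n"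
      by cases (use deg in \<open>auto simp: coeff_pCons eval_nat_numeral split: nat.split\<close>)
  qed
  with cone_low_degree \<open>cone r = 0\<close> have "r = 0" by (metis pCons_0_0)
  then show "quartic dvd F" using F by simp
qed

lemma quartic_dvd_iff:
  fixes F :: "'k::field form3"
  assumes "homog d F" shows "quartic dvd F \<longleftrightarrow> param F = 0"
  using quartic_dvd_iff_cone param_eq_0_iff_cone[OF assms] by simp

lemma homog_quartic: "homog 4 (quartic :: 'k::comm_ring_1 form3)"
proof -
  have h: "homog 4 (varX ^ 4 :: 'k form3)" "homog 4 (varZ * varY ^ 3 :: 'k form3)"
    "homog 4 (varZ * varY * varX\<^sup>2 :: 'k form3)"
    "homog 4 (varZ\<^sup>2 * varY\<^sup>2 :: 'k form3)" "homog 4 (varY * varZ ^ 3 :: 'k form3)"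
    using homog_power[OF homog_vars(1), of 4] homog_mult[OF homog_vars(3) homog_power[OF homog_vars(2), of 3]]
      homog_mult[OF homog_mult[OF homog_vars(3) homog_vars(2)] homog_power[OF homog_vars(1), of 2]]
      homog_mult[OF homog_power[OF homog_vars(3), of 2] homog_power[OF homog_vars(2), of 2]]
      homog_mult[OF homog_vars(2) homog_power[OF homog_vars(3), of 3]]
    by (simp_all add: numeral_eq_Suc)
  have n: "homog 4 (numeral n * F)" if "homog 4 F" for n and F :: "'k form3"
    using homog_const_mult[OF that, of "numeral n"] by (simp add: numeral_poly)
  show ?thesis unfolding quartic_def
    using homog_diff[OF homog_add[OF homog_diff[OF homog_diff[OF h(1) n[OF h(3), of "num.Bit0 (num.Bit0 num.One)"]] h(2)] n[OF h(4), of "num.Bit0 num.One"]] h(5)]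
    by (simp add: mult.assoc)
qed

lemma integral_form_quartic: "integral_form (quartic :: 'k::field form3) 4"
  by standard (auto simp: homog_quartic quartic_dvd_iff_cone cone_hom)

lemma irreducible_quartic: "Factorial_Ring.irreducible (quartic :: 'k::field form3)"
proof (rule prime_elem_imp_irreducible, rule prime_elemI)
  show "(quartic :: 'k form3) \<noteq> 0" by (simp add: quartic_altdef)
  show "\<not> (quartic :: 'k form3) dvd 1" by (simp add: quartic_dvd_iff_cone cone_hom)
qed (simp add: quartic_dvd_iff_cone cone_hom)

section \<open>The extension of \<open>k(w\<^sup>4)\<close> by \<open>w\<close>\<close>

lemma ring_map_Fract: "ring_map (\<lambda>p::'a::idom. Fract p 1)"
  by (simp add: ring_map_def fract_collapse)

lemmas Fract_hom = ring_map_simps[OF ring_map_Fract]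

lemma Fract_1_eq_0_iff: "Fract p 1 = 0 \<longleftrightarrow> (p::'a::idom) = 0"
  by (simp add: Zero_fract_def eq_fract)

abbreviation W :: "'k::field poly fract" where "W \<equiv> Fract [:0, 1:] 1"

abbreviation pw4 :: "'k::field poly \<Rightarrow> 'k poly" where "pw4 a \<equiv> pcompose a (Polynomial.monom 1 4)"

definition Kfield :: "'k::field poly fract set" where
  "Kfield = {Fract (pw4 a) (pw4 b) | a b. b \<noteq> 0}"

lemma pw4_eq_0_iff: "pw4 a = 0 \<longleftrightarrow> a = 0"
  by (metis pcompose_0 pcompose_eq_0 degree_monom_eq one_neq_zero zero_less_numeral)

lemma KfieldE:
  assumes "x \<in> Kfield" obtains a b where "b \<noteq> 0" "pw4 b \<noteq> 0" "x = Fract (pw4 a) (pw4 b)"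
  using assms pw4_eq_0_iff by (auto simp: Kfield_def)

lemma KfieldI: "b \<noteq> 0 \<Longrightarrow> Fract (pw4 a) (pw4 b) \<in> Kfield"
  by (auto simp: Kfield_def)

lemma Kfield_closed:
  assumes "x \<in> Kfield" "y \<in> Kfield"
  shows "x + y \<in> Kfield" "x * y \<in> Kfield"
proof -
  obtain a b c d where x: "b \<noteq> 0" "x = Fract (pw4 a) (pw4 b)" and y: "d \<noteq> 0" "y = Fract (pw4 c) (pw4 d)"
    using assms by (metis KfieldE)
  have "x + y = Fract (pw4 (a * d + c * b)) (pw4 (b * d))"
    using x y by (simp add: pw4_eq_0_iff pcompose_add pcompose_mult)
  then show "x + y \<in> Kfield" using x y KfieldI[of "b * d"] by simp
  have "x * y = Fract (pw4 (a * c)) (pw4 (b * d))" using x y by (simp add: pcompose_mult)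
  then show "x * y \<in> Kfield" using x y KfieldI[of "b * d"] by simp
qed

lemma Kfield_uminus_inverse:
  assumes "x \<in> Kfield"
  shows "- x \<in> Kfield" "inverse x \<in> Kfield"
proof -
  obtain a b where x: "b \<noteq> 0" "x = Fract (pw4 a) (pw4 b)" using assms by (metis KfieldE)
  have "- x = Fract (pw4 (- a)) (pw4 b)" using x by (simp add: pcompose_uminus)
  then show "- x \<in> Kfield" using x KfieldI by simp
  show "inverse x \<in> Kfield"
  proof (cases "a = 0")
    case True
    then have "inverse x = Fract (pw4 0) (pw4 1)" using x by (simp add: fract_collapse)
    then show ?thesis using KfieldI[of 1 0] by simp
  next
    case False
    then show ?thesis using x KfieldI by simp
  qed
qed

lemma Kfield_const: "Fract [:c:] 1 \<in> Kfield"
  using KfieldI[of 1 "[:c:]"] by (simp add: pcompose_1)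

lemma Kfield_01: "0 \<in> Kfield" "1 \<in> Kfield"
  using Kfield_const[of 0] Kfield_const[of 1] by (simp_all add: fract_collapse one_pCons[symmetric])

text \<open>The product B of all denominators is again a polynomial in w^4; clearing it reduces the
  claim to the comparison of exponents for polynomials.\<close>

lemma Kfield_independent:
  assumes k: "\<And>i. i < 4 \<Longrightarrow> k i \<in> Kfield" and sum: "(\<Sum>i<4. k i * W ^ i) = 0" and i: "i < 4"
  shows "k i = 0"
proof -
  have "\<forall>i. \<exists>a b. i < 4 \<longrightarrow> b \<noteq> 0 \<and> k i = Fract (pw4 a) (pw4 b)" using k by (metis KfieldE)
  then obtain a b where ab: "\<And>i. i < 4 \<Longrightarrow> b i \<noteq> 0 \<and> k i = Fract (pw4 (a i)) (pw4 (b i))" by metis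
  define B where "B = (\<Prod>j<4. b j)"
  define A where "A i = a i * (\<Prod>j\<in>{..<4} - {i}. b j)" for i
  have B: "B \<noteq> 0" using ab by (simp add: B_def)
  have A: "k i * Fract (pw4 B) 1 = Fract (pw4 (A i)) 1" if "i < 4" for i
  proof -
    have "B = b i * (\<Prod>j\<in>{..<4} - {i}. b j)" unfolding B_def using that by (simp add: prod.remove)
    then show ?thesis using ab[OF that] pw4_eq_0_iff[of "b i"] by (simp add: A_def pcompose_mult eq_fract)
  qed
  have Wi: "W ^ i = Fract (Polynomial.monom 1 i) 1" for i :: nat
    by (simp add: Fract_hom[symmetric] monom_altdef)
  have "Fract (\<Sum>i<4. Polynomial.monom 1 i * pw4 (A i)) 1 = (\<Sum>i<4. Fract (pw4 (A i)) 1 * W ^ i)"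
    by (simp only: Fract_hom Wi mult.commute)
  also have "\<dots> = (\<Sum>i<4. k i * Fract (pw4 B) 1 * W ^ i)" using A by simp
  also have "\<dots> = (\<Sum>i<4. k i * W ^ i) * Fract (pw4 B) 1" by (subst sum_distrib_right) (simp only: mult_ac)
  finally have "Fract (\<Sum>i<4. Polynomial.monom 1 i * pw4 (A i)) 1 = 0" using sum by (simp only: mult_zero_left)
  then have "(\<Sum>i<4. Polynomial.monom 1 i * pw4 (A i)) = 0" by (simp only: Fract_1_eq_0_iff)
  from mod4_independent[OF _ i this] have "A i = 0" by simp
  then have "k i * Fract (pw4 B) 1 = 0" using A[OF i] by (simp add: fract_collapse)
  then show "k i = 0" using B pw4_eq_0_iff[of B] Fract_1_eq_0_iff[of "pw4 B"] by simp
qed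

section \<open>Decomposition of k(w) over k(w^4)\<close>

lemma poly_mod4_decomposition:
  "\<exists>A0 A1 A2 A3. p = pw4 A0 + [:0, 1:] * pw4 A1 + [:0, 1:] ^ 2 * pw4 A2 + [:0, 1:] ^ 3 * pw4 A3"
proof (induction p)
  case 0
  show ?case by (intro exI[of _ 0]) simp
next
  case (pCons a p)
  then obtain A0 A1 A2 A3 where
    p: "p = pw4 A0 + [:0, 1:] * pw4 A1 + [:0, 1:] ^ 2 * pw4 A2 + [:0, 1:] ^ 3 * pw4 A3" by blast
  have ring: "a + w * (P0 + w * P1 + w\<^sup>2 * P2 + w ^ 3 * P3) = (a + w ^ 4 * P3) + w * P0 + w\<^sup>2 * P1 + w ^ 3 * P2"
    for a w P0 P1 P2 P3 :: "'a poly" by (simp add: algebra_simps eval_nat_numeral)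
  have "pCons a p = [:a:] + [:0, 1:] * p" by simp
  also have "\<dots> = ([:a:] + [:0, 1:] ^ 4 * pw4 A3) + [:0, 1:] * pw4 A0 + [:0, 1:] ^ 2 * pw4 A1 + [:0, 1:] ^ 3 * pw4 A2"
    unfolding p by (rule ring)
  also have "[:a:] + [:0, 1:] ^ 4 * pw4 A3 = pw4 (pCons a A3)"
    by (simp add: pcompose_pCons monom_altdef)
  finally show ?case by blast
qed

text \<open>The norm from k(w) to k(w^2): for q = A(w^2) + w B(w^2), the product of q(w) and q(-w)
  is A(w^2)^2 - w^2 B(w^2)^2.\<close>

lemma norm_quadratic:
  fixes q :: "'k::field poly"
  assumes "q \<noteq> 0"
  obtains r E where "r \<noteq> 0" "E \<noteq> 0" "q * r = pcompose E ([:0, 1:] ^ 2)"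
proof -
  have "\<exists>A B. p = pcompose A ([:0, 1:] ^ 2) + [:0, 1:] * pcompose B ([:0, 1:] ^ 2)" for p :: "'k poly"
  proof (induction p)
    case 0
    show ?case by (intro exI[of _ 0]) simp
  next
    case (pCons a p)
    then obtain A B where p: "p = pcompose A ([:0, 1:] ^ 2) + [:0, 1:] * pcompose B ([:0, 1:] ^ 2)" by blast
    have "pCons a p = [:a:] + [:0, 1:] * p" by simp
    also have "\<dots> = ([:a:] + [:0, 1:] ^ 2 * pcompose B ([:0, 1:] ^ 2)) + [:0, 1:] * pcompose A ([:0, 1:] ^ 2)"
      by (subst p) (simp only: algebra_simps power2_eq_square)
    also have "[:a:] + [:0, 1:] ^ 2 * pcompose B ([:0, 1:] ^ 2) = pcompose (pCons a B) ([:0, 1:] ^ 2)"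
      by (simp add: pcompose_pCons)
    finally show ?case by blast
  qed
  then obtain A B where q: "q = pcompose A ([:0, 1:] ^ 2) + [:0, 1:] * pcompose B ([:0, 1:] ^ 2)" by blast
  define r where "r = pcompose q [:0, -1:]"
  define E where "E = A\<^sup>2 - [:0, 1:] * B\<^sup>2"
  have r0: "r \<noteq> 0" using assms pcompose_eq_0[of q "[:0, -1:]"] by (auto simp: r_def)
  have s: "pcompose ([:0, 1:] ^ 2) [:0, -1:] = [:0, 1 :: 'k:] ^ 2"
    by (simp add: power2_eq_square pcompose_mult pcompose_pCons)
  have "r = pcompose A ([:0, 1:] ^ 2) - [:0, 1:] * pcompose B ([:0, 1:] ^ 2)"
    unfolding r_def by (subst q) (simp add: pcompose_add pcompose_mult pcompose_assoc[symmetric] s pcompose_pCons)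
  moreover have "(P + w * Q) * (P - w * Q) = P\<^sup>2 - w\<^sup>2 * Q\<^sup>2" for P Q w :: "'k poly"
    by (simp add: algebra_simps power2_eq_square)
  ultimately have "q * r = (pcompose A ([:0, 1:] ^ 2))\<^sup>2 - [:0, 1:] ^ 2 * (pcompose B ([:0, 1:] ^ 2))\<^sup>2"
    using q by metis
  also have "\<dots> = pcompose E ([:0, 1:] ^ 2)"
    unfolding E_def ring_map_simps[OF ring_map_pcompose] by (simp add: pcompose_pCons)
  finally have "q * r = pcompose E ([:0, 1:] ^ 2)" .
  moreover from this have "E \<noteq> 0" using assms r0 by auto
  ultimately show thesis using that r0 by blast
qed

text \<open>Two quadratic norms in succession, from w to w^2 and from w^2 to w^4. Only a multiple of
  q that is a polynomial in w^4 is wanted, to rationalise denominators.\<close>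

lemma norm_quartic:
  fixes q :: "'k::field poly"
  assumes "q \<noteq> 0"
  obtains r B where "r \<noteq> 0" "B \<noteq> 0" "q * r = pw4 B"
proof -
  obtain r E where r: "r \<noteq> 0" "E \<noteq> 0" "q * r = pcompose E ([:0, 1:] ^ 2)"
    using norm_quadratic[OF assms] .
  obtain s B where s: "s \<noteq> 0" "B \<noteq> 0" "E * s = pcompose B ([:0, 1:] ^ 2)"
    using norm_quadratic[OF r(2)] .
  have "q * (r * pcompose s ([:0, 1:] ^ 2)) = pcompose (pcompose B ([:0, 1:] ^ 2)) ([:0, 1:] ^ 2)"
    unfolding s(3)[symmetric] by (simp add: pcompose_mult r(3)[symmetric] mult.assoc)
  also have "\<dots> = pw4 B"
    by (simp add: pcompose_assoc[symmetric] power2_eq_square pcompose_mult pcompose_pCons monom_altdef eval_nat_numeral)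
  finally have eq: "q * (r * pcompose s ([:0, 1:] ^ 2)) = pw4 B" .
  moreover from this have "r * pcompose s ([:0, 1:] ^ 2) \<noteq> 0" using s(2) pw4_eq_0_iff by fastforce
  ultimately show thesis using that s by blast
qed

text \<open>Once the denominator is a polynomial in w^4, sorting the exponents of the numerator
  modulo 4 gives the four components.\<close>

lemma Kfield_decomposition: "\<exists>k. (\<forall>i. k i \<in> Kfield) \<and> x = (\<Sum>i<4. k i * W ^ i)"
proof (cases x)
  case (Fract p q)
  obtain r B where r: "r \<noteq> 0" "B \<noteq> 0" "q * r = pw4 B" using norm_quartic[OF Fract(2)] .
  obtain A0 A1 A2 A3 where
    pr: "p * r = pw4 A0 + [:0, 1:] * pw4 A1 + [:0, 1:] ^ 2 * pw4 A2 + [:0, 1:] ^ 3 * pw4 A3"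
    using poly_mod4_decomposition by blast
  define k where "k i = Fract (pw4 (if i = 0 then A0 else if i = 1 then A1 else if i = 2 then A2 else A3)) (pw4 B)" for i :: nat
  have x: "x = Fract (p * r) 1 * Fract 1 (pw4 B)"
    using Fract r by (simp add: mult_fract_cancel r(3)[symmetric] eq_fract)
  have "Fract (pw4 A) (pw4 B) = Fract (pw4 A) 1 * Fract 1 (pw4 B)" for A by simp
  then have "x = (\<Sum>i<4. k i * W ^ i)"
    unfolding x pr Fract_hom k_def sum_lessThan_4
    by (simp only: Fract_hom) (simp add: algebra_simps del: mult_fract)
  moreover have "k i \<in> Kfield" for i using KfieldI[OF r(2)] by (simp add: k_def)
  ultimately show ?thesis by blast
qed

section \<open>Rotations w -> c w and their fixed field\<close>

definition rot :: "'k::field \<Rightarrow> 'k poly fract \<Rightarrow> 'k poly fract" where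
  "rot c x = (THE y. \<forall>a b. b \<noteq> 0 \<and> x = Fract a b \<longrightarrow> y = Fract (pcompose a [:0, c:]) (pcompose b [:0, c:]))"

lemma pcompose_rot_eq_0_iff: "c \<noteq> 0 \<Longrightarrow> pcompose a [:0, c:] = 0 \<longleftrightarrow> a = 0" for c :: "'k::field"
  by (metis pcompose_0 pcompose_eq_0 degree_pCons_eq_if less_Suc_eq_0_disj pCons_eq_0_iff zero_less_Suc)

text \<open>The definite description in \<open>rot\<close> ranges over every fraction that
  represents x. Composition with c w respects cross-multiplication and keeps denominators nonzero,
  so all of them give the same value.\<close>

lemma rot_Fract:
  assumes c: "c \<noteq> 0" and b: "b \<noteq> 0"
  shows "rot c (Fract a b) = Fract (pcompose a [:0, c:]) (pcompose b [:0, c:])"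
  unfolding rot_def
proof (rule the_equality)
  show "\<forall>a' b'. b' \<noteq> 0 \<and> Fract a b = Fract a' b' \<longrightarrow>
    Fract (pcompose a [:0, c:]) (pcompose b [:0, c:]) = Fract (pcompose a' [:0, c:]) (pcompose b' [:0, c:])"
    using b by (auto simp: eq_fract pcompose_rot_eq_0_iff[OF c] pcompose_mult[symmetric])
qed (use b in blast)

lemma ring_map_rot:
  assumes c: "c \<noteq> 0" shows "ring_map (rot c)"
proof -
  have "rot c (x + y) = rot c x + rot c y" "rot c (x * y) = rot c x * rot c y" for x y
    by (cases x; cases y; simp add: rot_Fract[OF c] pcompose_add pcompose_mult pcompose_rot_eq_0_iff[OF c])+
  moreover have "rot c 0 = 0" "rot c 1 = 1"
    using rot_Fract[OF c, of 1 0] rot_Fract[OF c, of 1 1] by (simp_all add: pcompose_1 fract_collapse)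
  ultimately show ?thesis by (simp add: ring_map_def)
qed

lemma rot_rot: "c \<noteq> 0 \<Longrightarrow> d \<noteq> 0 \<Longrightarrow> rot c (rot d x) = rot (c * d) x"
  by (cases x) (simp add: rot_Fract pcompose_rot_eq_0_iff pcompose_assoc[symmetric] pcompose_pCons mult.commute)

lemma rot_1: "rot 1 x = x"
  by (cases x) (simp add: rot_Fract pcompose_idR)

lemma rot_W: "c \<noteq> 0 \<Longrightarrow> rot c W = Fract [:c:] 1 * W"
  by (simp add: rot_Fract pcompose_pCons pcompose_1)

lemma rot_Kfield:
  assumes c: "c ^ 4 = 1" and x: "x \<in> Kfield" shows "rot c x = x"
proof -
  have c0: "c \<noteq> 0" using c by auto
  have "pcompose (Polynomial.monom 1 4) [:0, c:] = Polynomial.monom 1 4"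
    using c by (simp add: monom_altdef pcompose_mult pcompose_pCons eval_nat_numeral ac_simps)
  then have "pcompose (pw4 a) [:0, c:] = pw4 a" for a by (simp add: pcompose_assoc[symmetric])
  then show ?thesis using x c0 by (auto elim!: KfieldE simp: rot_Fract)
qed

lemma rot_decomposition:
  assumes c: "c ^ 4 = 1" and k: "\<And>i. k i \<in> Kfield"
  shows "rot c (\<Sum>i<4. k i * W ^ i) = (\<Sum>i<4. (k i * Fract [:c ^ i:] 1) * W ^ i)"
proof -
  have c0: "c \<noteq> 0" using c by auto
  have "Fract [:c:] 1 ^ i = Fract [:c ^ i:] 1" for i :: nat
    using ring_map_power[OF ring_map_comp[OF ring_map_Fract ring_map_const], of c i] by simp
  then show ?thesis
    by (simp add: ring_map_simps[OF ring_map_rot[OF c0]] rot_Kfield[OF c k] rot_W[OF c0]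
        power_mult_distrib mult.assoc del: mult_fract)
qed

text \<open>The component at w^i is multiplied by c^i, and none of c, c^2, c^3 is 1. A fixed element
  therefore keeps only its component at i = 0.\<close>

lemma rot_fixed:
  fixes c :: "'k::field"
  assumes c: "c\<^sup>2 = - 1" "(1::'k) \<noteq> - 1" and fixed: "rot c x = x"
  shows "x \<in> Kfield"
proof -
  have c4: "c ^ 4 = 1" using c(1) by (metis mult_minus1_right minus_minus numeral_Bit0 power_add power2_eq_square)
  obtain k where k: "\<And>i. k i \<in> Kfield" and x: "x = (\<Sum>i<4. k i * W ^ i)"
    using Kfield_decomposition by blast
  define k' where "k' i = k i * Fract [:c ^ i - 1:] 1" for i
  have *: "Fract [:c ^ i - 1:] 1 = Fract [:c ^ i:] 1 - 1" for i
    using ring_map_diff[OF ring_map_comp[OF ring_map_Fract ring_map_const], of "c ^ i" 1]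
    by (simp add: fract_collapse one_pCons[symmetric])
  have "(\<Sum>i<4. k' i * W ^ i) = rot c x - x"
    unfolding x rot_decomposition[OF c4 k] k'_def * by (simp add: algebra_simps sum_subtractf)
  then have sum: "(\<Sum>i<4. k' i * W ^ i) = 0" using fixed by simp
  have "k' i \<in> Kfield" for i unfolding k'_def by (rule Kfield_closed(2)[OF k Kfield_const])
  from Kfield_independent[OF this sum] have k'0: "k' i = 0" if "i < 4" for i using that by blast
  have "c \<noteq> 1" using c by (metis power_one)
  moreover have "c ^ 3 \<noteq> 1"
  proof
    assume "c ^ 3 = 1"
    moreover have "c ^ 3 = c\<^sup>2 * c" by (simp add: power3_eq_cube power2_eq_square)
    ultimately have "- c = 1" unfolding c(1) by (metis mult_minus1)
    then have "c\<^sup>2 = 1" by (metis power2_minus power_one)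
    then show False using c by metis
  qed
  moreover have "c ^ 2 \<noteq> 1" using c by metis
  ultimately have "k i = 0" if "i \<in> {1, 2, 3}" for i
    using k'0[of i] that Fract_1_eq_0_iff[of "[:c ^ i - 1:]"] by (auto simp: k'_def)
  then have "x = k 0" unfolding x sum_lessThan_4 by simp
  then show ?thesis using k by simp
qed

text \<open>Transfers the field axioms from a type-class field to a carrier-based structure. It is
  used with \<open>val\<close>, so that k(w) makes the function field a field.\<close>

lemma field_of_embedding:
  fixes R (structure) and v :: "'a \<Rightarrow> 'f::field"
  assumes inj: "inj_on v (carrier R)"
    and closed: "\<And>x y. x \<in> carrier R \<Longrightarrow> y \<in> carrier R \<Longrightarrow> x \<oplus> y \<in> carrier R \<and> x \<otimes> y \<in> carrier R"
      "\<zero> \<in> carrier R" "\<one> \<in> carrier R"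
    and hom: "\<And>x y. x \<in> carrier R \<Longrightarrow> y \<in> carrier R \<Longrightarrow> v (x \<oplus> y) = v x + v y \<and> v (x \<otimes> y) = v x * v y"
      "v \<zero> = 0" "v \<one> = 1"
    and neg: "\<And>x. x \<in> carrier R \<Longrightarrow> \<exists>y \<in> carrier R. v y = - v x"
    and inv: "\<And>x. x \<in> carrier R \<Longrightarrow> \<exists>y \<in> carrier R. v y = inverse (v x)"
  shows "Ring.field R"
proof -
  have eq: "x = y \<longleftrightarrow> v x = v y" if "x \<in> carrier R" "y \<in> carrier R" for x y
    using inj that by (auto simp: inj_on_def)
  have "abelian_group R"
  proof (rule abelian_groupI)
    fix x assume x: "x \<in> carrier R"
    obtain y where y: "y \<in> carrier R" "v y = - v x" using neg[OF x] by blast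
    then have "y \<oplus> x = \<zero>" using x by (subst eq) (simp_all add: closed hom)
    then show "\<exists>y\<in>carrier R. y \<oplus> x = \<zero>" using y by blast
  qed (simp_all add: closed, simp_all add: eq closed hom algebra_simps)
  moreover have "comm_monoid R"
    by (rule comm_monoidI) (simp_all add: closed, simp_all add: eq closed hom algebra_simps)
  ultimately have cring: "cring R"
    by (rule cringI) (simp add: eq closed hom algebra_simps)
  show ?thesis
  proof (rule cring.cring_fieldI[OF cring])
    show "Units R = carrier R - {\<zero>}"
    proof (intro equalityI subsetI)
      fix x assume "x \<in> Units R"
      then obtain y where xy: "x \<in> carrier R" "y \<in> carrier R" "x \<otimes> y = \<one>" by (auto simp: Units_def)
      then have "v x * v y = 1" using hom by metis
      then have "x \<noteq> \<zero>" using hom by auto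
      then show "x \<in> carrier R - {\<zero>}" using xy by simp
    next
      fix x assume x: "x \<in> carrier R - {\<zero>}"
      then have x0: "v x \<noteq> 0" using eq[of x \<zero>] closed hom by simp
      obtain y where y: "y \<in> carrier R" "v y = inverse (v x)" using inv x by blast
      have "x \<otimes> y = \<one>" "y \<otimes> x = \<one>" using x x0 y by (simp_all add: eq closed hom)
      then show "x \<in> Units R" using x y by (auto simp: Units_def)
    qed
  qed
qed

section \<open>The function field of the curve\<close>

type_synonym 'k rational = "('k form3 \<times> 'k form3) set"

abbreviation LL :: "'k::field rational ring" where "LL \<equiv> function_field quartic"
abbreviation KK :: "'k::field rational set" where "KK \<equiv> K_P quartic"

text \<open>The value in \<open>k(w)\<close> of a rational function on the curve.\<close>

definition val :: "'k::field rational \<Rightarrow> 'k poly fract" where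
  "val u = (THE x. \<forall>(A, B) \<in> u. x = Fract (param A) (param B))"

lemma fractions_quartic:
  "(A, B) \<in> fractions (quartic :: 'k::field form3) \<longleftrightarrow> (\<exists>d. homog d A \<and> homog d B) \<and> param B \<noteq> 0"
  by (auto simp: fractions_def quartic_dvd_iff)

lemma frac_rel_quartic:
  "((A, B), (A', B')) \<in> frac_rel (quartic :: 'k::field form3) \<longleftrightarrow>
     (A, B) \<in> fractions quartic \<and> (A', B') \<in> fractions quartic \<and>
     Fract (param A) (param B) = Fract (param A') (param B')"
proof -
  have "quartic dvd A * B' - A' * B \<longleftrightarrow> Fract (param A) (param B) = Fract (param A') (param B')"
    if "(A, B) \<in> fractions quartic" "(A', B') \<in> fractions quartic"
  proof -
    from that have "\<exists>d. homog d A \<and> homog d B" "\<exists>d. homog d A' \<and> homog d B'"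
      and nz: "param B \<noteq> 0" "param B' \<noteq> 0" by (simp_all add: fractions_quartic)
    then obtain d d' where d: "homog d A" "homog d B" "homog d' A'" "homog d' B'" by blast
    have "homog (d + d') (A * B' - A' * B)"
      using homog_diff[OF homog_mult[OF d(1,4)]] homog_mult[OF d(3,2)] by (simp add: add.commute)
    from quartic_dvd_iff[OF this] show ?thesis using nz by (simp add: param_hom eq_fract)
  qed
  then show ?thesis unfolding frac_rel_def by auto
qed

text \<open>Every operation of the function field is the image of a set of representatives under
  \<open>frac_rel\<close>. If these share one value in k(w), the image is exactly the class of that
  value, so well-definedness is settled here once for sums, products and pullbacks.\<close>

lemma Image_frac_rel:
  fixes S :: "'k::field rational"
  assumes S: "S \<noteq> {}" "\<And>A B. (A, B) \<in> S \<Longrightarrow> (A, B) \<in> fractions quartic \<and> Fract (param A) (param B) = x"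
  shows "frac_rel quartic `` S \<in> carrier LL" "val (frac_rel quartic `` S) = x"
proof -
  obtain A B where AB: "(A, B) \<in> S" using S(1) by auto
  have eq: "frac_rel quartic `` S = {(A, B). (A, B) \<in> fractions quartic \<and> Fract (param A) (param B) = x}"
  proof (intro equalityI subsetI)
    fix y assume "y \<in> frac_rel quartic `` S"
    then show "y \<in> {(A, B). (A, B) \<in> fractions quartic \<and> Fract (param A) (param B) = x}"
      using S(2) by (cases y) (auto simp: frac_rel_quartic)
  next
    fix y assume "y \<in> {(A, B). (A, B) \<in> fractions quartic \<and> Fract (param A) (param B) = x}"
    then have "((A, B), y) \<in> frac_rel quartic" using S(2)[OF AB] by (cases y) (simp add: frac_rel_quartic)
    then show "y \<in> frac_rel quartic `` S" using AB by blast
  qed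
  also have "\<dots> = frac_rel quartic `` {(A, B)}"
    using S(2)[OF AB] by (auto simp: frac_rel_quartic)
  finally show "frac_rel quartic `` S \<in> carrier LL"
    using S(2)[OF AB] by (auto simp: function_field_def quotient_def)
  show "val (frac_rel quartic `` S) = x"
    unfolding val_def eq using S(2)[OF AB] by (intro the_equality) auto
qed

lemma carrier_LL:
  assumes "u \<in> carrier LL"
  shows "u \<noteq> {}" "\<And>A B. (A, B) \<in> u \<longleftrightarrow> (A, B) \<in> fractions quartic \<and> Fract (param A) (param B) = val u"
proof -
  obtain A B where AB: "(A, B) \<in> fractions quartic" "u = frac_rel quartic `` {(A, B)}"
    using assms by (auto simp: function_field_def quotient_def)
  have v: "val u = Fract (param A) (param B)"
    unfolding AB by (rule Image_frac_rel) (use AB in auto)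
  have "(A, B) \<in> u" using AB by (simp add: frac_rel_quartic)
  then show "u \<noteq> {}" by blast
  show "(A', B') \<in> u \<longleftrightarrow> (A', B') \<in> fractions quartic \<and> Fract (param A') (param B') = val u" for A' B'
    unfolding v using AB by (auto simp: frac_rel_quartic)
qed

lemma inj_val: "inj_on val (carrier LL)"
proof (rule inj_onI)
  fix u v :: "'a rational"
  assume "u \<in> carrier LL" "v \<in> carrier LL" "val u = val v"
  then show "u = v" by (intro equalityI subrelI) (simp_all add: carrier_LL(2))
qed

lemma LL_mult:
  assumes u: "u \<in> carrier LL" and v: "v \<in> carrier LL"
  shows "u \<otimes>\<^bsub>LL\<^esub> v \<in> carrier LL" "val (u \<otimes>\<^bsub>LL\<^esub> v) = val u * val v"
proof -
  let ?S = "{(A * A', B * B') | A B A' B'. (A, B) \<in> u \<and> (A', B') \<in> v}"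
  have ne: "?S \<noteq> {}" using carrier_LL(1)[OF u] carrier_LL(1)[OF v] by fast
  have S: "(P, Q) \<in> fractions quartic \<and> Fract (param P) (param Q) = val u * val v" if "(P, Q) \<in> ?S" for P Q
  proof -
    from that obtain A B A' B' where PQ: "P = A * A'" "Q = B * B'" and "(A, B) \<in> u" "(A', B') \<in> v" by blast
    then have "(A, B) \<in> fractions quartic" "val u = Fract (param A) (param B)"
       "(A', B') \<in> fractions quartic" "val v = Fract (param A') (param B')"
      using carrier_LL(2)[OF u] carrier_LL(2)[OF v] by auto
    then show ?thesis unfolding PQ by (auto simp: fractions_quartic param_hom intro: homog_mult)
  qed
  have "u \<otimes>\<^bsub>LL\<^esub> v = frac_rel quartic `` ?S" by (simp add: function_field_def)
  then show "u \<otimes>\<^bsub>LL\<^esub> v \<in> carrier LL" "val (u \<otimes>\<^bsub>LL\<^esub> v) = val u * val v"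
    using Image_frac_rel[OF ne S] by simp_all
qed

lemma LL_add:
  assumes u: "u \<in> carrier LL" and v: "v \<in> carrier LL"
  shows "u \<oplus>\<^bsub>LL\<^esub> v \<in> carrier LL" "val (u \<oplus>\<^bsub>LL\<^esub> v) = val u + val v"
proof -
  let ?S = "{(A * B' + A' * B, B * B') | A B A' B'. (A, B) \<in> u \<and> (A', B') \<in> v}"
  have ne: "?S \<noteq> {}" using carrier_LL(1)[OF u] carrier_LL(1)[OF v] by fast
  have S: "(P, Q) \<in> fractions quartic \<and> Fract (param P) (param Q) = val u + val v" if "(P, Q) \<in> ?S" for P Q
  proof -
    from that obtain A B A' B' where PQ: "P = A * B' + A' * B" "Q = B * B'" and "(A, B) \<in> u" "(A', B') \<in> v" by blast
    then have AB: "(A, B) \<in> fractions quartic" "val u = Fract (param A) (param B)"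
       "(A', B') \<in> fractions quartic" "val v = Fract (param A') (param B')"
      using carrier_LL(2)[OF u] carrier_LL(2)[OF v] by auto
    then have "\<exists>d. homog d A \<and> homog d B" "\<exists>d. homog d A' \<and> homog d B'"
      and nz: "param B \<noteq> 0" "param B' \<noteq> 0" by (simp_all add: fractions_quartic)
    then obtain d d' where d: "homog d A" "homog d B" "homog d' A'" "homog d' B'" by blast
    have "homog (d + d') P" "homog (d + d') Q"
      using homog_add[OF homog_mult[OF d(1,4)]] homog_mult[OF d(3,2)] homog_mult[OF d(2,4)]
      by (simp_all add: add.commute PQ)
    then show ?thesis using nz AB(2,4) by (auto simp: PQ fractions_quartic param_hom)
  qed
  have "u \<oplus>\<^bsub>LL\<^esub> v = frac_rel quartic `` ?S" by (simp add: function_field_def)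
  then show "u \<oplus>\<^bsub>LL\<^esub> v \<in> carrier LL" "val (u \<oplus>\<^bsub>LL\<^esub> v) = val u + val v"
    using Image_frac_rel[OF ne S] by simp_all
qed

lemma frac_cls:
  assumes "homog d A" "homog d B" "param B \<noteq> 0"
  shows "frac_rel quartic `` {(A, B)} \<in> carrier LL"
    "val (frac_rel quartic `` {(A, B)}) = Fract (param A) (param B)"
  using Image_frac_rel[of "{(A, B)}" "Fract (param A) (param B)"] assms by (auto simp: fractions_quartic)

lemma homog_1: "homog 0 (1 :: 'k::comm_ring_1 form3)"
  using homog_const[of "1::'k"] by (simp add: one_pCons)

lemma LL_zero_one:
  "\<zero>\<^bsub>LL\<^esub> \<in> carrier (LL :: 'a::field rational ring)" "val (\<zero>\<^bsub>LL\<^esub> :: 'a rational) = 0"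
  "\<one>\<^bsub>LL\<^esub> \<in> carrier (LL :: 'a rational ring)" "val (\<one>\<^bsub>LL\<^esub> :: 'a rational) = 1"
proof -
  have "param (1 :: 'a form3) \<noteq> 0" by (simp add: param_hom)
  note * = frac_cls[OF homog_0 homog_1 this] frac_cls[OF homog_1 homog_1 this]
  show "\<zero>\<^bsub>LL\<^esub> \<in> carrier (LL :: 'a rational ring)" "\<one>\<^bsub>LL\<^esub> \<in> carrier (LL :: 'a rational ring)"
    using *(1,3) by (simp_all add: function_field_def)
  show "val (\<zero>\<^bsub>LL\<^esub> :: 'a rational) = 0" "val (\<one>\<^bsub>LL\<^esub> :: 'a rational) = 1"
    using *(2,4) by (simp_all add: function_field_def param_hom fract_collapse)
qed

section \<open>The coordinate w as a quotient of forms\<close>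

definition homogenize :: "nat \<Rightarrow> 'k::field poly \<Rightarrow> 'k form3 \<Rightarrow> 'k form3 \<Rightarrow> 'k form3" where
  "homogenize d p U V = (\<Sum>n\<le>d. [:[:[:Polynomial.coeff p n:]:]:] * (U ^ n * V ^ (d - n)))"

lemma homog_homogenize:
  assumes "homog m U" "homog m V" shows "homog (m * d) (homogenize d p U V)"
  unfolding homogenize_def
proof (intro homog_sum homog_const_mult)
  fix n assume "n \<in> {..d}"
  then have "m * n + m * (d - n) = m * d" by (simp flip: distrib_left)
  then show "homog (m * d) (U ^ n * V ^ (d - n))"
    using homog_mult[OF homog_power[OF assms(1)] homog_power[OF assms(2)], of n "d - n"] by simp
qed

text \<open>If U/V takes the value x on the curve, then \<open>homogenize\<close> realises p(x) by a
  form, up to the factor V^d. It is used with value w to show that \<open>val\<close> is onto, and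
  with Y/Z of value w^4 to describe K_P.\<close>

lemma param_homogenize:
  assumes U: "param U = x * param V" and d: "Polynomial.degree p \<le> d"
  shows "param (homogenize d p U V) = param V ^ d * pcompose p x"
proof -
  have "param (homogenize d p U V) = (\<Sum>n\<le>d. [:Polynomial.coeff p n:] * ((x * param V) ^ n * param V ^ (d - n)))"
    by (simp only: homogenize_def param_hom param_gens U)
  also have "\<dots> = (\<Sum>n\<le>d. param V ^ d * ([:Polynomial.coeff p n:] * x ^ n))"
  proof (rule sum.cong)
    fix n assume "n \<in> {..d}"
    then have "param V ^ n * param V ^ (d - n) = param V ^ d" by (simp flip: power_add)
    then show "[:Polynomial.coeff p n:] * ((x * param V) ^ n * param V ^ (d - n))
      = param V ^ d * ([:Polynomial.coeff p n:] * x ^ n)"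
      by (simp add: power_mult_distrib mult_ac)
  qed simp
  also have "\<dots> = param V ^ d * (\<Sum>n\<le>d. [:Polynomial.coeff p n:] * x ^ n)"
    by (simp only: sum_distrib_left)
  also have "(\<Sum>n\<le>d. [:Polynomial.coeff p n:] * x ^ n) = (\<Sum>n\<le>Polynomial.degree p. [:Polynomial.coeff p n:] * x ^ n)"
    by (rule sum.mono_neutral_right) (use d in \<open>auto simp: coeff_eq_0\<close>)
  also have "\<dots> = pcompose p x"
    by (simp add: pcompose_altdef poly_altdef degree_map_poly coeff_map_poly)
  finally show ?thesis .
qed

text \<open>The numerator of the function w on the curve. It and \<open>unif_den\<close> are conics
  through the three nodes and the first two coordinates of the quadratic involution, which sends the
  point of parameter w to [w:1:w^2].\<close>

definition unif_num :: "'k::field form3" where "unif_num = varX * (varY + varZ)"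
definition unif_den :: "'k::field form3" where "unif_den = varX ^ 2 + varZ ^ 2 - varY * varZ"

lemma homog_unif: "homog 2 (unif_num :: 'a::field form3)" "homog 2 (unif_den :: 'a::field form3)"
proof -
  have "homog 2 (varX * (varY + varZ) :: 'a form3)"
    using homog_mult[OF homog_vars(1) homog_add[OF homog_vars(2,3)]] by (simp add: numeral_2_eq_2)
  then show "homog 2 (unif_num :: 'a form3)" by (simp add: unif_num_def)
  have "homog 2 (varX ^ 2 :: 'a form3)" "homog 2 (varZ ^ 2 :: 'a form3)" "homog 2 (varY * varZ :: 'a form3)"
    using homog_power[OF homog_vars(1), of 2] homog_power[OF homog_vars(3), of 2] homog_mult[OF homog_vars(2,3)]
    by (simp_all add: numeral_2_eq_2)
  then show "homog 2 (unif_den :: 'a form3)" unfolding unif_den_def by (intro homog_diff homog_add)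
qed

lemma param_X: "param varX = [:0, 1:] + [:0, 1:] ^ 3" and param_Y: "param varY = [:0, 1:] ^ 4"
  by (simp_all add: param_gens monom_altdef eval_nat_numeral)

lemma unif_identities:
  fixes w :: "'a::comm_ring_1"
  shows "(w + w ^ 3)\<^sup>2 + 1\<^sup>2 - w ^ 4 * 1 = (w ^ 4 + 1) * (w\<^sup>2 + 1)"
    "(w + w ^ 3) * (w ^ 4 + 1) = w * ((w ^ 4 + 1) * (w\<^sup>2 + 1))"
  by (simp_all add: algebra_simps eval_nat_numeral)

text \<open>In characteristic other than 2 the six roots in an algebraic closure are the parameters
  over the nodes: w^2 = -1 over [0:1:1], and w^4 = -1 over the two nodes on Y + Z = 0.\<close>

lemma param_unif_den: "param (unif_den :: 'k::field form3) = ([:0, 1:] ^ 4 + 1) * ([:0, 1:] ^ 2 + 1)"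
  unfolding unif_den_def param_hom param_X param_Y param_gens(3)
  by (rule unif_identities)

lemma param_unif_num: "param unif_num = [:0, 1:] * param unif_den"
  unfolding unif_num_def param_unif_den param_hom param_X param_Y param_gens(3)
  by (rule unif_identities)

lemma param_unif_den_nz: "param (unif_den :: 'k::field form3) \<noteq> 0"
proof -
  have "poly (param (unif_den :: 'k form3)) 0 = 1" by (simp add: param_unif_den)
  then show ?thesis by auto
qed

text \<open>Numerator and denominator are homogenised with the same d, so the two forms have equal
  degree and the power of \<open>unif_den\<close> cancels.\<close>

lemma val_surj: "\<exists>u \<in> carrier LL. val u = (x :: 'k::field poly fract)"
proof (cases x)
  case (Fract p q)
  define d where "d = max (Polynomial.degree p) (Polynomial.degree q)"
  let ?A = "homogenize d p unif_num unif_den" and ?B = "homogenize d q unif_num unif_den"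
  have A: "param ?A = param unif_den ^ d * p" and B: "param ?B = param unif_den ^ d * q"
    using param_homogenize[OF param_unif_num, of p d] param_homogenize[OF param_unif_num, of q d]
    by (simp_all add: d_def pcompose_idR)
  have nz': "param (unif_den :: 'k form3) ^ d \<noteq> 0" using param_unif_den_nz by auto
  have nz: "param ?B \<noteq> 0" unfolding B using Fract nz' by simp
  have "Fract (param ?A) (param ?B) = x"
    unfolding A B Fract(1) by (rule mult_fract_cancel[OF nz'])
  then show ?thesis using frac_cls[OF homog_homogenize homog_homogenize nz] homog_unif by blast
qed

lemma field_LL: "Ring.field LL"
proof (rule field_of_embedding[where v = val])
  show "inj_on val (carrier LL)" by (rule inj_val)
qed (use LL_mult LL_add LL_zero_one val_surj in auto)

text \<open>Y/Z takes the value w^4 on the curve, which is transcendental over k, so the projection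
  is dominant. This keeps the denominators in K_P nonzero and later identifies the automorphism of
  the base line.\<close>

lemma param_form2_nz:
  fixes B :: "'k::field form2"
  assumes "homog d [:B:]" "B \<noteq> 0" shows "param [:B:] \<noteq> 0"
proof -
  have "cone [:B:] \<noteq> 0"
  proof
    assume "cone [:B:] = 0"
    then show False using assms(2) pcompose_eq_0[of B "Polynomial.monom [:0, 1:] 4"]
      by (simp add: cone_form2 degree_monom_eq)
  qed
  then show ?thesis using param_eq_0_iff_cone[OF assms(1)] by simp
qed

lemma param_form2: "\<exists>a. param [:A:] = pw4 a"
proof -
  have *: "\<exists>a. param [:[:B:]:] = [:a:]" for B
  proof (induction B)
    case 0 show ?case by (intro exI[of _ 0]) (simp add: param_hom)
  next
    case (pCons b B)
    have "[:[:pCons b B:]:] = [:[:[:b:]:]:] + varZ * [:[:B:]:]" by (simp add: varZ_def)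
    then have "param [:[:pCons b B:]:] = [:b:] + param [:[:B:]:]" by (simp only: param_hom param_gens mult_1_left)
    then show ?case using pCons.IH by auto
  qed
  show ?thesis
  proof (induction A)
    case 0 show ?case by (intro exI[of _ 0]) (simp add: param_hom)
  next
    case (pCons B A)
    obtain b a where ba: "param [:[:B:]:] = [:b:]" "param [:A:] = pw4 a" using * pCons by blast
    have "[:pCons B A:] = [:[:B:]:] + varY * [:A:]" by (simp add: varY_def)
    then have "param [:pCons B A:] = param [:[:B:]:] + param varY * param [:A:]" by (simp only: param_hom)
    also have "\<dots> = pw4 (pCons b a)" unfolding ba by (simp add: param_gens pcompose_pCons)
    finally show ?case by blast
  qed
qed

lemma KK_subset: "KK \<subseteq> carrier LL"
  using frac_cls(1) param_form2_nz by (fastforce simp: K_P_def)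

lemma KK_iff:
  assumes u: "u \<in> carrier LL" shows "u \<in> KK \<longleftrightarrow> val u \<in> Kfield"
proof
  assume "u \<in> KK"
  then obtain A B d where AB: "homog d [:A:]" "homog d [:B:]" "B \<noteq> 0" "u = frac_rel quartic `` {([:A:], [:B:])}"
    by (auto simp: K_P_def)
  obtain a b where ab: "param [:A:] = pw4 a" "param [:B:] = pw4 b" using param_form2 by metis
  have "b \<noteq> 0" using param_form2_nz[OF AB(2,3)] unfolding ab by auto
  then show "val u \<in> Kfield"
    using frac_cls(2)[OF AB(1,2) param_form2_nz[OF AB(2,3)]] KfieldI unfolding AB(4) ab by simp
next
  assume "val u \<in> Kfield"
  then obtain a b where ab: "b \<noteq> 0" "val u = Fract (pw4 a) (pw4 b)" by (metis KfieldE)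
  define d where "d = max (Polynomial.degree a) (Polynomial.degree b)"
  \<comment> \<open>\<open>f p\<close> is the binary form obtained by homogenising p in Y and Z; it
    takes the value p(w^4) on the curve.\<close>
  define f :: "'a poly \<Rightarrow> 'a form2" where
    "f p = (\<Sum>n\<le>d. [:[:Polynomial.coeff p n:]:] * ([:0, 1:] ^ n * [:[:0, 1:]:] ^ (d - n)))" for p
  have f: "homogenize d p varY varZ = [:f p:]" for p
    unfolding f_def homogenize_def ring_map_simps[OF ring_map_const] varY_def varZ_def ..
  have h: "homog d [:f p:]" for p
    using homog_homogenize[OF homog_vars(2,3), of d p] unfolding f by simp
  have "param varY = Polynomial.monom 1 4 * param (varZ :: 'a form3)" by (simp add: param_gens)
  note ph = param_homogenize[OF this, where d = d, unfolded f]
  have A: "param [:f a:] = pw4 a" and B: "param [:f b:] = pw4 b"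
    using ph[of a] ph[of b] by (simp_all add: d_def param_gens)
  have nz: "param [:f b:] \<noteq> 0" unfolding B using ab pw4_eq_0_iff by blast
  then have "f b \<noteq> 0" by (auto simp: param_hom)
  then have K: "frac_rel quartic `` {([:f a:], [:f b:])} \<in> KK" using h by (auto simp: K_P_def)
  have "val (frac_rel quartic `` {([:f a:], [:f b:])}) = val u"
    using frac_cls(2)[OF h[of a] h nz] unfolding A B ab(2) .
  then have "u = frac_rel quartic `` {([:f a:], [:f b:])}"
    using inj_onD[OF inj_val _ subsetD[OF KK_subset K] u] by simp
  then show "u \<in> KK" using K by simp
qed

lemma LL_minus:
  assumes "u \<in> carrier LL" shows "val (\<ominus>\<^bsub>LL\<^esub> u) = - val u"
proof -
  interpret Ring.field LL by (rule field_LL)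
  have "val (u \<oplus>\<^bsub>LL\<^esub> \<ominus>\<^bsub>LL\<^esub> u) = 0" using assms by (simp add: r_neg LL_zero_one)
  then show ?thesis using LL_add(2)[of u "\<ominus>\<^bsub>LL\<^esub> u"] assms by (simp add: eq_neg_iff_add_eq_0 add.commute)
qed

lemma LL_inv:
  assumes "u \<in> carrier LL" "u \<noteq> \<zero>\<^bsub>LL\<^esub>" shows "inv\<^bsub>LL\<^esub> u \<in> carrier LL" "val (inv\<^bsub>LL\<^esub> u) = inverse (val u)"
proof -
  interpret Ring.field LL by (rule field_LL)
  have u: "u \<in> Units LL" using assms field_Units by auto
  show "inv\<^bsub>LL\<^esub> u \<in> carrier LL" using u by simp
  have "val (u \<otimes>\<^bsub>LL\<^esub> inv\<^bsub>LL\<^esub> u) = 1" using u by (simp add: LL_zero_one)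
  then have "val u * val (inv\<^bsub>LL\<^esub> u) = 1" using LL_mult(2)[OF assms(1) Units_inv_closed[OF u]] by simp
  then show "val (inv\<^bsub>LL\<^esub> u) = inverse (val u)" by (metis inverse_unique)
qed

lemma subfield_KK: "subfield KK (LL :: 'k::field rational ring)"
proof -
  interpret Ring.field "LL :: 'k rational ring" by (rule field_LL)
  have c: "u \<in> carrier LL" if "u \<in> KK" for u :: "'k rational" using that KK_subset by blast
  show ?thesis
  proof (rule subfieldI')
    have K: "val u \<in> Kfield" if "u \<in> KK" for u :: "'k rational" using that c KK_iff by blast
    show "subring KK (LL :: 'k rational ring)"
    proof (rule subringI)
      show "KK \<subseteq> carrier (LL :: 'k rational ring)" by (rule KK_subset)
      show "\<one>\<^bsub>LL\<^esub> \<in> (KK :: 'k rational set)" by (simp add: KK_iff LL_zero_one Kfield_01)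
      show "\<ominus>\<^bsub>LL\<^esub> u \<in> KK" if "u \<in> KK" for u :: "'k rational"
        using c[OF that] K[OF that] by (simp add: KK_iff LL_minus Kfield_uminus_inverse)
      show "u \<otimes>\<^bsub>LL\<^esub> v \<in> KK" "u \<oplus>\<^bsub>LL\<^esub> v \<in> KK" if "u \<in> KK" "v \<in> KK" for u v :: "'k rational"
        using that[THEN c] that[THEN K] by (simp_all add: KK_iff LL_add LL_mult Kfield_closed)
    qed
    show "inv\<^bsub>LL\<^esub> k \<in> KK" if "k \<in> KK - {\<zero>\<^bsub>LL\<^esub>}" for k :: "'k rational"
    proof -
      have k: "k \<in> KK" "k \<noteq> \<zero>\<^bsub>LL\<^esub>" using that by simp_all
      show ?thesis using LL_inv[OF c[OF k(1)] k(2)] K[OF k(1)] by (simp add: KK_iff Kfield_uminus_inverse)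
    qed
  qed
qed

text \<open>The basis is 1, w, w^2, w^3. \<open>E n\<close> consists of the combinations of the
  first n of them, and each further power is one line extension, being independent of the earlier
  ones.\<close>

lemma dimension_LL: "ring.dimension LL 4 KK (carrier (LL :: 'k::field rational ring))"
proof -
  interpret Ring.field "LL :: 'k rational ring" by (rule field_LL)
  define E where "E n = {u \<in> carrier (LL :: 'k rational ring). \<exists>k. (\<forall>i. k i \<in> Kfield) \<and> val u = (\<Sum>i<n. k i * W ^ i)}" for n :: nat
  have inj: "u = v" if "val u = val v" "u \<in> carrier LL" "v \<in> carrier LL" for u v :: "'k rational"
    using inj_val that by (auto simp: inj_on_def)
  have "dimension n KK (E n)" if "n \<le> 4" for n using that
  proof (induction n)
    case 0
    have "\<zero>\<^bsub>LL\<^esub> \<in> E 0" using LL_zero_one Kfield_01 by (auto simp: E_def)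
    moreover have "u = \<zero>\<^bsub>LL\<^esub>" if "u \<in> E 0" for u
      by (rule inj) (use that LL_zero_one in \<open>simp_all add: E_def\<close>)
    ultimately have "E 0 = {\<zero>\<^bsub>LL\<^esub>}" by blast
    then show ?case by simp
  next
    case (Suc n)
    obtain v :: "'k rational" where v: "v \<in> carrier LL" "val v = W ^ n" using val_surj by blast
    have "v \<notin> E n"
    proof
      assume "v \<in> E n"
      then obtain k :: "nat \<Rightarrow> 'k poly fract" where k: "\<And>i. k i \<in> Kfield" "W ^ n = (\<Sum>i<n. k i * W ^ i)" using v by (auto simp: E_def)
      \<comment> \<open>An expression of w^n in lower powers becomes a relation among all four
        powers, with coefficient -1 at n and zeros beyond.\<close>
      define k' where "k' i = (if i < n then k i else if i = n then - 1 else 0)" for i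
      have "(\<Sum>i<4. k' i * W ^ i) = (\<Sum>i<Suc n. k' i * W ^ i)"
        by (rule sum.mono_neutral_right) (use Suc.prems in \<open>auto simp: k'_def\<close>)
      also have "\<dots> = 0" using k(2) by (simp add: k'_def)
      finally have sum: "(\<Sum>i<4. k' i * W ^ i) = 0" .
      have "k' i \<in> Kfield" for i
        by (simp add: k'_def k(1) Kfield_01 Kfield_uminus_inverse)
      from Kfield_independent[OF this sum, of n] have "k' n = 0" using Suc.prems by simp
      then show False by (simp add: k'_def)
    qed
    moreover have "line_extension KK v (E n) = E (Suc n)"
    proof (intro equalityI subsetI)
      fix u assume "u \<in> line_extension KK v (E n)"
      then obtain c e where ce: "c \<in> KK" "e \<in> E n" "u = c \<otimes>\<^bsub>LL\<^esub> v \<oplus>\<^bsub>LL\<^esub> e" by (auto simp: line_extension_mem_iff)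
      obtain k where k: "\<And>i. k i \<in> Kfield" "val e = (\<Sum>i<n. k i * W ^ i)" using ce by (auto simp: E_def)
      have c: "c \<in> carrier LL" "e \<in> carrier LL" "val c \<in> Kfield" using ce KK_subset KK_iff by (auto simp: E_def)
      have "val u = (\<Sum>i<Suc n. (k(n := val c)) i * W ^ i)"
        using c v k unfolding ce(3) by (simp add: LL_add LL_mult)
      moreover have "u \<in> carrier LL" using c v unfolding ce(3) by simp
      moreover have "\<forall>i. (k(n := val c)) i \<in> Kfield" using k c by simp
      ultimately show "u \<in> E (Suc n)" unfolding E_def by blast
    next
      fix u assume "u \<in> E (Suc n)"
      then obtain k where u: "u \<in> carrier LL" and k: "\<And>i. k i \<in> Kfield" "val u = (\<Sum>i<Suc n. k i * W ^ i)"
        by (auto simp: E_def)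
      obtain c where c: "c \<in> carrier LL" "val c = k n" using val_surj by blast
      obtain e where e: "e \<in> carrier LL" "val e = (\<Sum>i<n. k i * W ^ i)" using val_surj by blast
      have "u = c \<otimes>\<^bsub>LL\<^esub> v \<oplus>\<^bsub>LL\<^esub> e" by (rule inj) (use u k c e v in \<open>simp_all add: LL_add LL_mult\<close>)
      moreover have "c \<in> KK" "e \<in> E n" using c e k by (auto simp: KK_iff E_def)
      ultimately show "u \<in> line_extension KK v (E n)" by (auto simp: line_extension_mem_iff)
    qed
    ultimately show ?case using Suc_dim[OF v(1) _ Suc.IH] Suc.prems by simp
  qed
  moreover have "E 4 = carrier LL" using Kfield_decomposition unfolding E_def by blast
  ultimately show ?thesis by (metis order_refl)
qed

section \<open>Lifting automorphisms to the plane\<close>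

interpretation plane: integral_form "0 :: 'k::field form3" 0 by (rule integral_form_0)
interpretation curve: integral_form "quartic :: 'k::field form3" 4 by (rule integral_form_quartic)

text \<open>\<open>covers c G\<close>: restricted to the curve, \<open>G\<close> is the map \<open>w \<mapsto> cw\<close>.\<close>

definition covers :: "'k::field \<Rightarrow> 'k triple \<Rightarrow> bool" where
  "covers c = (\<lambda>(A, B, C). (\<exists>d. homog d A \<and> homog d B \<and> homog d C) \<and> (\<exists>l. l \<noteq> 0 \<and>
     param A = l * pcompose (param varX) [:0, c:] \<and> param B = l * pcompose (param varY) [:0, c:] \<and> param C = l))"

lemma param_subst3_eval:
  "param (subst3 F (A, B, C)) = eval3 (\<lambda>a. [:a:]) F (param A, param B, param C)"
  unfolding param_def by (rule eval3_subst3[OF ring_map_const])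

lemma param_subst3:
  assumes F: "homog d F" and p: "param A = l * pcompose (param varX) q" "param B = l * pcompose (param varY) q" "param C = l"
  shows "param (subst3 F (A, B, C)) = l ^ d * pcompose (param F) q"
proof -
  have "param (subst3 F (A, B, C)) = eval3 (\<lambda>a. [:a:]) F
      (l * pcompose (param varX) q, l * pcompose (param varY) q, l * 1)"
    unfolding param_subst3_eval p by simp
  also have "\<dots> = l ^ d * eval3 (\<lambda>a. [:a:]) F (pcompose (param varX) q, pcompose (param varY) q, 1)"
    by (rule eval3_homog[OF ring_map_const F])
  also have "eval3 (\<lambda>a. [:a:]) F (pcompose (param varX) q, pcompose (param varY) q, 1) = pcompose (param F) q"
    unfolding param_def[of F] ring_map_comp_eval3[OF ring_map_pcompose ring_map_const]
    by (simp add: param_gens pcompose_1)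
  finally show ?thesis .
qed

lemma coversE:
  assumes "covers c (A, B, C)"
  obtains l d where "homog d A" "homog d B" "homog d C" "l \<noteq> 0" "param A = l * pcompose (param varX) [:0, c:]"
    "param B = l * pcompose (param varY) [:0, c:]" "param C = l"
  using assms by (auto simp: covers_def)

lemma covers_rat_triples: "covers c F \<Longrightarrow> F \<in> rat_triples quartic"
  by (cases F) (auto simp: rat_triples_def quartic_dvd_iff_cone param_eq_0_iff_cone elim!: coversE)

lemma covers_comp:
  assumes c: "c \<noteq> 0" "d \<noteq> 0" and F: "covers c F" and G: "covers d G"
  shows "covers (c * d) (comp3 F G)"
proof -
  obtain A B C A' B' C' where eq: "F = (A, B, C)" "G = (A', B', C')" by (cases F; cases G) blast
  obtain l m where l: "homog m A" "homog m B" "homog m C" "l \<noteq> 0"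
    "param A = l * pcompose (param varX) [:0, c:]" "param B = l * pcompose (param varY) [:0, c:]" "param C = l"
    using F unfolding eq by (rule coversE)
  obtain l' m' where l': "homog m' A'" "homog m' B'" "homog m' C'" "l' \<noteq> 0"
    "param A' = l' * pcompose (param varX) [:0, d:]" "param B' = l' * pcompose (param varY) [:0, d:]" "param C' = l'"
    using G unfolding eq by (rule coversE)
  have s: "param (subst3 E (A', B', C')) = l' ^ m * pcompose (param E) [:0, d:]" if "homog m E" for E
    using param_subst3[OF that l'(5-7)] .
  have q: "pcompose (pcompose p [:0, c:]) [:0, d:] = pcompose p [:0, c * d:]" for p
    by (simp add: pcompose_assoc[symmetric] pcompose_pCons mult.commute)
  let ?L = "l' ^ m * pcompose l [:0, d:]"
  have "?L \<noteq> 0" using l(4) l'(4) pcompose_rot_eq_0_iff[OF c(2)] by simp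
  moreover have "param (subst3 A (A', B', C')) = ?L * pcompose (param varX) [:0, c * d:]"
    "param (subst3 B (A', B', C')) = ?L * pcompose (param varY) [:0, c * d:]"
    "param (subst3 C (A', B', C')) = ?L"
    unfolding s[OF l(1)] s[OF l(2)] s[OF l(3)] l(5-7) pcompose_mult q by (simp_all add: mult.assoc)
  moreover have "\<exists>e. homog e (subst3 A G) \<and> homog e (subst3 B G) \<and> homog e (subst3 C G)"
    unfolding eq using homog_subst3 l(1-3) l'(1-3) by blast
  ultimately show ?thesis unfolding eq comp3_simp covers_def by auto
qed

lemma covers_id: "covers 1 (varX, varY, varZ)"
  using homog_vars by (auto simp: covers_def pcompose_idR param_gens(3))

text \<open>Z has value 1 in the parametrisation, so the third coordinate of a triple equivalent to
  F cannot vanish on the curve and serves as the common factor. Hence \<open>covers c\<close> cuts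
  out exactly one class, described without a representative.\<close>

lemma rat_rel_covers:
  fixes c :: "'k::field"
  assumes F: "covers c F"
  shows "(F, G) \<in> rat_rel quartic \<longleftrightarrow> covers c G"
proof -
  obtain A B C A' B' C' where eq: "F = (A, B, C)" "G = (A', B', C')" by (cases F; cases G) blast
  obtain l m where l: "homog m A" "homog m B" "homog m C" "l \<noteq> 0"
    "param A = l * pcompose (param varX) [:0, c:]" "param B = l * pcompose (param varY) [:0, c:]" "param C = l"
    using F unfolding eq by (rule coversE)
  have dvd: "quartic dvd P * Q' - P' * Q \<longleftrightarrow> param P * param Q' = param P' * param Q"
    if "homog m P" "homog m Q" "homog n P'" "homog n Q'" for P Q P' Q' :: "'k form3" and n
  proof -
    have "homog (m + n) (P * Q' - P' * Q)"
      using homog_diff[OF homog_mult[OF that(1,4)]] homog_mult[OF that(3,2)] by (simp add: add.commute)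
    from quartic_dvd_iff[OF this] show ?thesis by (simp add: param_hom)
  qed
  show ?thesis
  proof
    assume rel: "(F, G) \<in> rat_rel quartic"
    then have G: "(A', B', C') \<in> rat_triples quartic" by (simp add: eq rat_rel_def)
    then obtain n where n: "homog n A'" "homog n B'" "homog n C'" by (auto simp: rat_triples_def)
    have "quartic dvd A * C' - A' * C" "quartic dvd B * C' - B' * C" using rel by (auto simp: eq rat_rel_def)
    then have "param A * param C' = param A' * param C" "param B * param C' = param B' * param C"
      using dvd[OF l(1,3) n(1,3)] dvd[OF l(2,3) n(2,3)] by simp_all
    then have *: "param A' = param C' * pcompose (param varX) [:0, c:]"
      "param B' = param C' * pcompose (param varY) [:0, c:]"
      using l(4-7) by (simp_all add: mult_ac)
    have "param C' \<noteq> 0"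
    proof
      assume "param C' = 0"
      then have "param A' = 0" "param B' = 0" using * by simp_all
      then show False using \<open>param C' = 0\<close> n quartic_dvd_iff G by (auto simp: rat_triples_def)
    qed
    then show "covers c G" unfolding eq covers_def using n * by auto
  next
    assume G: "covers c G"
    obtain l' n where l': "homog n A'" "homog n B'" "homog n C'" "l' \<noteq> 0"
      "param A' = l' * pcompose (param varX) [:0, c:]" "param B' = l' * pcompose (param varY) [:0, c:]" "param C' = l'"
      using G unfolding eq by (rule coversE)
    show "(F, G) \<in> rat_rel quartic"
      using covers_rat_triples[OF F] covers_rat_triples[OF G] dvd[OF l(1,2) l'(1,2)] dvd[OF l(1,3) l'(1,3)]
        dvd[OF l(2,3) l'(2,3)] l(5-7) l'(5-7)
      by (simp add: eq rat_rel_def mult_ac)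
  qed
qed

lemma covers_class: "covers c F \<Longrightarrow> rat_rel quartic `` {F} = Collect (covers c)"
  using rat_rel_covers by blast

text \<open>Standard quadratic involution based at the three nodes of the curve, which it maps to
  the conic \<open>X\<^sup>2 = YZ\<close>, parametrised by \<open>w \<mapsto> [w : 1 : w\<^sup>2]\<close>. Conjugating a diagonal map
  that preserves the conic gives a lift of \<open>w \<mapsto> cw\<close>.\<close>

definition quad :: "'k::field triple" where
  "quad = (unif_num, unif_den, varX ^ 2 + varY ^ 2 - varY * varZ)"

definition diag :: "'k::field \<Rightarrow> 'k triple" where
  "diag c = ([:[:[:c:]:]:] * varX, varY, [:[:[:c\<^sup>2:]:]:] * varZ)"

lemma homog_quad: "homog 2 (varX ^ 2 + varY ^ 2 - varY * varZ :: 'k::field form3)"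
proof -
  have "homog 2 (varX ^ 2 :: 'k form3)" "homog 2 (varY ^ 2 :: 'k form3)" "homog 2 (varY * varZ :: 'k form3)"
    using homog_power[OF homog_vars(1), of 2] homog_power[OF homog_vars(2), of 2] homog_mult[OF homog_vars(2,3)]
    by (simp_all add: numeral_2_eq_2)
  then show ?thesis by (intro homog_diff homog_add)
qed

lemma self_triples_0: "self_triples 0 = rat_triples 0"
  by (auto simp: self_triples_def subst3_hom)

lemma subst3_unif:
  "subst3 unif_num (A, B, C) = A * (B + C)" "subst3 unif_den (A, B, C) = A ^ 2 + C ^ 2 - B * C"
  by (simp_all only: unif_num_def unif_den_def subst3_hom subst3_gens)

text \<open>In characteristic other than 2, L is the product of the three lines joining the nodes: Y
  + Z = 0 and, through [0:1:1], the pair 2 X^2 + (Y - Z)^2 = 0. The involution contracts these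
  lines.\<close>

lemma quad_quad:
  defines "L \<equiv> (varY + varZ) * (2 * varX ^ 2 + (varY - varZ) ^ 2)"
  shows "comp3 quad quad = (L * varX, L * varY, L * (varZ :: 'k::field form3))"
proof -
  have id1: "x * (y + z) * ((x\<^sup>2 + z\<^sup>2 - y * z) + (x\<^sup>2 + y\<^sup>2 - y * z)) = (y + z) * (2 * x\<^sup>2 + (y - z)\<^sup>2) * x"
    for x y z :: "'k form3" by (simp add: algebra_simps eval_nat_numeral)
  have id2: "(x * (y + z))\<^sup>2 + (x\<^sup>2 + y\<^sup>2 - y * z)\<^sup>2 - (x\<^sup>2 + z\<^sup>2 - y * z) * (x\<^sup>2 + y\<^sup>2 - y * z)
      = (y + z) * (2 * x\<^sup>2 + (y - z)\<^sup>2) * y"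
    for x y z :: "'k form3" by (simp add: algebra_simps eval_nat_numeral)
  have id3: "(x * (y + z))\<^sup>2 + (x\<^sup>2 + z\<^sup>2 - y * z)\<^sup>2 - (x\<^sup>2 + z\<^sup>2 - y * z) * (x\<^sup>2 + y\<^sup>2 - y * z)
      = (y + z) * (2 * x\<^sup>2 + (y - z)\<^sup>2) * z"
    for x y z :: "'k form3" by (simp add: algebra_simps eval_nat_numeral)
  show ?thesis
    unfolding quad_def comp3_simp subst3_unif L_def subst3_hom subst3_gens
    unfolding unif_num_def unif_den_def id1 id2 id3 ..
qed

lemma quad_rat_triples: "quad \<in> rat_triples 0"
proof -
  have "param (unif_num :: 'a form3) \<noteq> 0" using param_unif_den_nz by (simp add: param_unif_num)
  then have "unif_num \<noteq> (0 :: 'a form3)" by (auto simp: param_hom)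
  then show ?thesis using homog_unif homog_quad by (auto simp: quad_def rat_triples_def)
qed

lemma quad_quad_id: "(comp3 quad quad, (varX, varY, varZ :: 'k::field form3)) \<in> rat_rel 0"
proof -
  define L :: "'k form3" where "L = (varY + varZ) * (2 * varX ^ 2 + (varY - varZ) ^ 2)"
  have eq: "comp3 quad quad = (L * varX, L * varY, L * varZ)" unfolding L_def by (rule quad_quad)
  have "poly (param L) 0 = 1" by (simp add: L_def param_hom param_X param_Y param_gens)
  then have "L \<noteq> 0" by (auto simp: param_hom)
  moreover have "\<exists>d. homog d (L * varX) \<and> homog d (L * varY) \<and> homog d (L * varZ)"
    using quad_rat_triples[where 'a = 'k] homog_subst3 eq
    unfolding quad_def comp3_simp using homog_unif homog_quad by (metis prod.inject)
  ultimately have rt: "(L * varX, L * varY, L * varZ) \<in> rat_triples 0"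
    by (auto simp: rat_triples_def varX_def)
  show ?thesis unfolding eq
    by (rule plane.rat_relI[OF rt plane.id_rat_triples, of 1 L]) simp_all
qed

lemma quad_bir: "quad \<in> bir_triples 0"
  using quad_rat_triples quad_quad_id by (auto simp: bir_triples_def self_triples_0)

lemma diag_diag: "comp3 (diag c) (diag d) = diag (c * d)"
  unfolding diag_def comp3_simp subst3_hom subst3_gens by (simp add: power_mult_distrib mult.commute)

lemma diag_1: "diag 1 = (varX, varY, varZ)"
  by (simp add: diag_def flip: one_pCons)

lemma diag_bir:
  assumes "c \<noteq> 0" shows "diag c \<in> bir_triples 0"
proof -
  have rt: "diag d \<in> rat_triples 0" for d :: 'a
    using homog_const_mult homog_vars by (auto simp: diag_def rat_triples_def varY_def)
  have "comp3 (diag c) (diag (1 / c)) = (varX, varY, varZ)" "comp3 (diag (1 / c)) (diag c) = (varX, varY, varZ)"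
    using assms by (simp_all add: diag_diag diag_1)
  then show ?thesis using rt plane.rat_rel_refl[OF plane.id_rat_triples]
    unfolding bir_triples_def self_triples_0 by (metis (no_types, lifting) mem_Collect_eq)
qed

definition lift :: "'k::field \<Rightarrow> 'k triple" where
  "lift c = comp3 quad (comp3 (diag c) quad)"

definition Lift :: "'k::field \<Rightarrow> 'k triple set" where
  "Lift c = rat_rel 0 `` {lift c}"

lemma lift_bir: "c \<noteq> 0 \<Longrightarrow> lift c \<in> bir_triples 0"
  unfolding lift_def by (intro plane.comp3_bir_triples quad_bir diag_bir)

lemma covers_lift:
  fixes c :: "'k::field"
  assumes "c \<noteq> 0" shows "covers c (lift c)"
proof -
  define m where "m = param (unif_den :: 'k form3)"
  let ?w = "[:0, 1:] :: 'k poly"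
  have q3: "param (varX ^ 2 + varY ^ 2 - varY * varZ :: 'k form3) = m * ?w ^ 2"
  proof -
    have "(w + w ^ 3)\<^sup>2 + (w ^ 4)\<^sup>2 - w ^ 4 * 1 = ((w ^ 4 + 1) * (w\<^sup>2 + 1)) * w\<^sup>2" for w :: "'k poly"
      by (simp add: algebra_simps eval_nat_numeral)
    then show ?thesis unfolding m_def param_unif_den param_hom param_X param_Y param_gens(3) .
  qed
  have d: "comp3 (diag c) quad = ([:[:[:c:]:]:] * unif_num, unif_den,
      [:[:[:c\<^sup>2:]:]:] * (varX ^ 2 + varY ^ 2 - varY * varZ))" (is "_ = (?U, ?V, ?T)")
    by (simp only: diag_def quad_def comp3_simp subst3_hom subst3_gens)
  have p: "param ?U = m * [:0, c:]" "param ?V = m" "param ?T = m * [:0, c:] ^ 2"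
    unfolding ring_mapD(4)[OF ring_map_param] param_gens(4) q3 param_unif_num m_def[symmetric]
    by (simp_all add: power2_eq_square)
  have h: "homog 2 ?U" "homog 2 ?V" "homog 2 ?T" by (intro homog_const_mult homog_unif homog_quad)+
  have l: "lift c = (subst3 unif_num (?U, ?V, ?T), subst3 unif_den (?U, ?V, ?T),
      subst3 (varX ^ 2 + varY ^ 2 - varY * varZ) (?U, ?V, ?T))"
    unfolding lift_def d by (simp only: quad_def comp3_simp)
  have pc: "pcompose (param varX) [:0, c:] = [:0, c:] + [:0, c:] ^ 3" "pcompose (param varY) [:0, c:] = [:0, c:] ^ 4"
    unfolding param_X param_Y ring_map_simps[OF ring_map_pcompose] by (simp_all add: pcompose_pCons)
  \<comment> \<open>With v = c w these are the coordinates of \<open>quad\<close> at m [v:1:v^2]: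
    they equal m^2 times the curve point [v + v^3 : v^4 : 1].\<close>
  have ids: "m * v * (m + m * v\<^sup>2) = m\<^sup>2 * (v + v ^ 3)"
    "(m * v)\<^sup>2 + (m * v\<^sup>2)\<^sup>2 - m * (m * v\<^sup>2) = m\<^sup>2 * v ^ 4"
    "(m * v)\<^sup>2 + m\<^sup>2 - m * (m * v\<^sup>2) = m\<^sup>2" for v :: "'k poly"
    by (simp_all add: algebra_simps eval_nat_numeral)
  have gp: "param (subst3 unif_num (A, B, C)) = param A * (param B + param C)"
    "param (subst3 unif_den (A, B, C)) = (param A)\<^sup>2 + (param C)\<^sup>2 - param B * param C"
    "param (subst3 (varX ^ 2 + varY ^ 2 - varY * varZ) (A, B, C)) = (param A)\<^sup>2 + (param B)\<^sup>2 - param B * param C"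
    for A B C :: "'k form3"
    unfolding subst3_unif subst3_hom subst3_gens param_hom by simp_all
  have "\<exists>e. homog e (subst3 unif_num (?U, ?V, ?T)) \<and> homog e (subst3 unif_den (?U, ?V, ?T)) \<and>
      homog e (subst3 (varX ^ 2 + varY ^ 2 - varY * varZ) (?U, ?V, ?T))"
    using homog_subst3[OF _ h] homog_unif homog_quad by blast
  moreover have "param (subst3 unif_num (?U, ?V, ?T)) = m\<^sup>2 * pcompose (param varX) [:0, c:]"
    "param (subst3 unif_den (?U, ?V, ?T)) = m\<^sup>2 * pcompose (param varY) [:0, c:]"
    "param (subst3 (varX ^ 2 + varY ^ 2 - varY * varZ) (?U, ?V, ?T)) = m\<^sup>2"
    unfolding gp p pc ids by simp_all
  moreover have "m\<^sup>2 \<noteq> 0" using param_unif_den_nz by (simp add: m_def)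
  ultimately show ?thesis unfolding l covers_def by auto
qed

text \<open>The inverse is supplied by the lift of 1/c: both composites cover w -> w, hence lie in
  the class of the identity.\<close>

lemma covers_bir:
  fixes c :: "'k::field"
  assumes "c \<noteq> 0" "covers c F" shows "F \<in> bir_triples quartic"
proof -
  have self: "G \<in> self_triples quartic" if G: "covers d G" for d :: 'k and G
  proof -
    obtain A B C where eq: "G = (A, B, C)" by (cases G) blast
    obtain l n where l: "homog n A" "homog n B" "homog n C" "l \<noteq> 0"
      "param A = l * pcompose (param varX) [:0, d:]" "param B = l * pcompose (param varY) [:0, d:]" "param C = l"
      using G unfolding eq by (rule coversE)
    have "param (quartic :: 'k form3) = 0" using quartic_dvd_iff[OF homog_quartic] by simp
    then have "param (subst3 quartic G) = 0"
      unfolding eq param_subst3[OF homog_quartic l(5-7)] by simp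
    then have "quartic dvd subst3 quartic G"
      using quartic_dvd_iff[OF homog_subst3[OF homog_quartic l(1-3)]] by (simp add: eq)
    then show ?thesis using covers_rat_triples[OF G] by (simp add: self_triples_def)
  qed
  have c': "1 / c \<noteq> 0" using assms by simp
  note G = covers_lift[OF c']
  have "covers 1 (comp3 F (lift (1 / c)))" "covers 1 (comp3 (lift (1 / c)) F)"
    using covers_comp[OF assms(1) c' assms(2) G] covers_comp[OF c' assms(1) G assms(2)] assms(1) by simp_all
  then have "(comp3 F (lift (1 / c)), (varX, varY, varZ)) \<in> rat_rel quartic"
    "(comp3 (lift (1 / c)) F, (varX, varY, varZ)) \<in> rat_rel quartic"
    using rat_rel_covers covers_id by blast+
  then show ?thesis unfolding bir_triples_def using self[OF assms(2)] self[OF G] by blast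
qed

lemma covers_mult:
  assumes "c \<noteq> 0" "d \<noteq> 0"
  shows "Collect (covers c) \<otimes>\<^bsub>Bir quartic\<^esub> Collect (covers d) = Collect (covers (c * d))"
proof -
  note l = covers_lift[OF assms(1)] covers_lift[OF assms(2)]
  have "rat_rel quartic `` {lift c} \<otimes>\<^bsub>Bir quartic\<^esub> rat_rel quartic `` {lift d}
      = rat_rel quartic `` {comp3 (lift c) (lift d)}"
    by (rule curve.bir_mult) (use assms l covers_bir in blast)+
  then show ?thesis unfolding covers_class[OF l(1)] covers_class[OF l(2)] covers_class[OF covers_comp[OF assms l]] .
qed

lemma covers_carrier:
  assumes "c \<noteq> 0" shows "Collect (covers c) \<in> carrier (Bir quartic)"
  using covers_class[OF covers_lift[OF assms]] covers_bir[OF assms covers_lift[OF assms]]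
  by (auto simp: curve.bir_carrier)

lemma covers_inv:
  fixes c :: "'k::field"
  assumes "c \<noteq> 0" shows "inv\<^bsub>Bir quartic\<^esub> (Collect (covers c)) = Collect (covers (1 / c))"
proof (rule group.inv_equality[OF curve.group_Bir])
  show "Collect (covers (1 / c)) \<otimes>\<^bsub>Bir quartic\<^esub> Collect (covers c) = \<one>\<^bsub>Bir quartic\<^esub>"
    using covers_mult[of "1 / c" c] assms covers_class[OF covers_id[where 'a = 'k]] by (simp add: curve.bir_one)
qed (use assms in \<open>simp_all add: covers_carrier\<close>)

text \<open>Representatives of the plane class that vanish on the curve are related to nothing by
  \<open>rat_rel quartic\<close>. The others have zero minors with \<open>lift c\<close>, and zero
  is divisible by the quartic.\<close>

lemma restr_Lift:
  fixes c :: "'k::field"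
  assumes "c \<noteq> 0" shows "restr quartic (Lift c) = Collect (covers c)"
proof -
  note l = covers_lift[OF assms]
  have "covers c G" if F: "F \<in> Lift c" and FG: "(F, G) \<in> rat_rel quartic" for F G
  proof -
    have "(lift c, F) \<in> rat_rel 0" using F by (simp add: Lift_def)
    then have "(lift c, F) \<in> rat_rel quartic"
      using covers_rat_triples[OF l] FG by (cases "lift c"; cases F) (auto simp: rat_rel_def)
    then show ?thesis using FG curve.rat_rel_trans rat_rel_covers[OF l] by blast
  qed
  moreover have "lift c \<in> Lift c"
    unfolding Lift_def by (rule plane.cls_self[OF plane.bir_rat[OF lift_bir[OF assms]]])
  ultimately show ?thesis unfolding restr_def using rat_rel_covers[OF l] by blast
qed

lemma pullback_covers:
  fixes c :: "'k::field"
  assumes c: "c \<noteq> 0" and u: "u \<in> carrier LL"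
  shows "pullback quartic (Collect (covers c)) u \<in> carrier LL"
    "val (pullback quartic (Collect (covers c)) u) = rot c (val u)"
proof -
  let ?S = "{(subst3 A G, subst3 B G) | A B G. (A, B) \<in> u \<and> G \<in> Collect (covers c)}"
  have ne: "?S \<noteq> {}" using carrier_LL(1)[OF u] covers_lift[OF c] by fast
  have S: "(P, Q) \<in> fractions quartic \<and> Fract (param P) (param Q) = rot c (val u)" if "(P, Q) \<in> ?S" for P Q
  proof -
    from that obtain A B G where PQ: "P = subst3 A G" "Q = subst3 B G" "(A, B) \<in> u" "covers c G" by blast
    obtain G0 G1 G2 where G: "G = (G0, G1, G2)" by (cases G) blast
    obtain l n where l: "homog n G0" "homog n G1" "homog n G2" "l \<noteq> 0"
      "param G0 = l * pcompose (param varX) [:0, c:]" "param G1 = l * pcompose (param varY) [:0, c:]" "param G2 = l"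
      using PQ(4) unfolding G by (rule coversE)
    have AB: "(A, B) \<in> fractions quartic" "val u = Fract (param A) (param B)"
      using PQ(3) carrier_LL(2)[OF u] by auto
    then obtain d where d: "homog d A" "homog d B" and nz: "param B \<noteq> 0" by (auto simp: fractions_quartic)
    have p: "param P = l ^ d * pcompose (param A) [:0, c:]" "param Q = l ^ d * pcompose (param B) [:0, c:]"
      unfolding PQ G using param_subst3[OF d(1) l(5-7)] param_subst3[OF d(2) l(5-7)] by simp_all
    have "param Q \<noteq> 0" unfolding p using l(4) nz pcompose_rot_eq_0_iff[OF c] by simp
    moreover have "homog (n * d) P" "homog (n * d) Q"
      unfolding PQ G using homog_subst3[OF d(1) l(1-3)] homog_subst3[OF d(2) l(1-3)] .
    moreover have "Fract (param P) (param Q) = rot c (val u)"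
      unfolding p AB(2) rot_Fract[OF c nz] by (rule mult_fract_cancel) (use l(4) in simp)
    ultimately show ?thesis by (auto simp: fractions_quartic)
  qed
  have "pullback quartic (Collect (covers c)) u = frac_rel quartic `` ?S" by (simp add: pullback_def)
  then show "pullback quartic (Collect (covers c)) u \<in> carrier LL"
    "val (pullback quartic (Collect (covers c)) u) = rot c (val u)"
    using Image_frac_rel[OF ne S] by simp_all
qed

section \<open>The Galois group and its extension\<close>

text \<open>For nonzero c, the inverse inside \<open>bir_act\<close> makes this the substitution w
  -> w/c on k(w), not w -> c w.\<close>

definition galois :: "'k::field \<Rightarrow> 'k rational \<Rightarrow> 'k rational" where
  "galois c = bir_act quartic (Collect (covers c))"

lemma galois_val:
  assumes "c \<noteq> 0" "u \<in> carrier LL"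
  shows "galois c u \<in> carrier LL" "val (galois c u) = rot (1 / c) (val u)"
  using assms pullback_covers[of "1 / c" u] by (simp_all add: galois_def bir_act_def covers_inv)

lemma LL_eqI: "u \<in> carrier LL \<Longrightarrow> v \<in> carrier LL \<Longrightarrow> val u = val v \<Longrightarrow> u = v"
  using inj_val by (auto dest: inj_onD)

lemma galois_galois:
  assumes "c \<noteq> 0" "d \<noteq> 0" "u \<in> carrier LL"
  shows "galois c (galois d u) = galois (c * d) u"
  by (rule LL_eqI) (use assms in \<open>simp_all add: galois_val rot_rot\<close>)

lemma galois_1: "u \<in> carrier LL \<Longrightarrow> galois 1 u = u"
  by (rule LL_eqI) (simp_all add: galois_val rot_1)

lemma galois_in_Bij:
  assumes "c \<noteq> 0" shows "galois c \<in> Bij (carrier LL)"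
proof -
  have "bij_betw (galois c) (carrier LL) (carrier LL)"
    by (rule bij_betw_byWitness[where f' = "galois (1 / c)"])
      (use assms in \<open>auto simp: galois_galois galois_1 galois_val\<close>)
  moreover have "galois c \<in> extensional (carrier LL)" by (simp add: galois_def bir_act_def)
  ultimately show ?thesis by (simp add: Bij_def)
qed

lemma G_P_carrier:
  "carrier (G_P quartic) = {\<sigma> \<in> Bij (carrier LL). \<sigma> \<in> ring_hom LL LL \<and> (\<forall>x \<in> KK. \<sigma> x = x)}"
  by (simp add: G_P_def gal_group_def)

lemma galois_in_G_P:
  fixes c :: "'k::field"
  assumes "c ^ 4 = 1" shows "galois c \<in> carrier (G_P quartic)"
proof -
  have c: "c \<noteq> 0" "1 / c \<noteq> 0" "(1 / c) ^ 4 = 1" using assms by (auto simp: power_one_over)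
  note r = ring_mapD[OF ring_map_rot[OF c(2)]]
  have "galois c \<in> ring_hom LL LL"
  proof (rule ring_hom_memI)
    show "galois c \<one>\<^bsub>LL\<^esub> = \<one>\<^bsub>LL\<^esub>"
      by (rule LL_eqI) (use c in \<open>simp_all add: galois_val LL_zero_one r\<close>)
    show "galois c (x \<otimes>\<^bsub>LL\<^esub> y) = galois c x \<otimes>\<^bsub>LL\<^esub> galois c y" "galois c (x \<oplus>\<^bsub>LL\<^esub> y) = galois c x \<oplus>\<^bsub>LL\<^esub> galois c y"
      if "x \<in> carrier LL" "y \<in> carrier LL" for x y
      by (rule LL_eqI; use c that in \<open>simp add: galois_val LL_mult LL_add r\<close>)+
  qed (use c in \<open>simp add: galois_val\<close>)
  moreover have "galois c x = x" if "x \<in> KK" for x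
  proof -
    have x: "x \<in> carrier LL" using that KK_subset by blast
    then show ?thesis
      by (rule LL_eqI[rotated]) (use x c that KK_iff[OF x] rot_Kfield[OF c(3)] in \<open>simp_all add: galois_val\<close>)
  qed
  ultimately show ?thesis using galois_in_Bij[OF c(1)] by (simp add: G_P_carrier)
qed

lemma galois_inj:
  fixes c :: "'k::field"
  assumes "c \<noteq> 0" "d \<noteq> 0" "galois c = galois d" shows "c = d"
proof -
  obtain u :: "'k rational" where u: "u \<in> carrier LL" "val u = W" using val_surj by blast
  have "rot (1 / c) W = rot (1 / d) W" using galois_val(2)[OF _ u(1)] assms u(2) by metis
  then have "Fract [:1 / c:] 1 * W = Fract [:1 / d:] 1 * (W :: 'k poly fract)" using assms by (simp only: rot_W divide_eq_0_iff one_neq_zero not_False_eq_True simp_thms)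
  then have "1 / c = 1 / d" by (simp add: eq_fract)
  then show ?thesis using assms by simp
qed

text \<open>An automorphism over \<open>k(w\<^sup>4)\<close> sends \<open>w\<close> to a fourth root of \<open>w\<^sup>4\<close>, hence to \<open>cw\<close>.\<close>

lemma G_P_elements:
  fixes i :: "'k::field"
  assumes i: "i\<^sup>2 = - 1" and \<sigma>: "\<sigma> \<in> carrier (G_P quartic)"
  shows "\<exists>c::'k. c ^ 4 = 1 \<and> \<sigma> = galois c"
proof -
  interpret Ring.field "LL :: 'k rational ring" by (rule field_LL)
  have bij: "\<sigma> \<in> Bij (carrier LL)" and hom: "\<sigma> \<in> ring_hom LL LL" and fix_K: "\<And>x. x \<in> KK \<Longrightarrow> \<sigma> x = x"
    using \<sigma> by (auto simp: G_P_carrier)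
  have cl: "\<sigma> u \<in> carrier LL" if "u \<in> carrier LL" for u using ring_hom_closed[OF hom that] .
  \<comment> \<open>An inverse of \<open>val\<close>; it carries \<sigma> over to a ring map s of
    k(w), where the fourth-root argument takes place.\<close>
  define \<iota> where "\<iota> x = (SOME u. u \<in> carrier LL \<and> val u = x)" for x :: "'k poly fract"
  have \<iota>: "\<iota> x \<in> carrier LL" "val (\<iota> x) = x" for x
    using someI_ex[of "\<lambda>u. u \<in> carrier LL \<and> val u = x"] val_surj[of x] by (auto simp: \<iota>_def)
  have \<iota>_val: "\<iota> (val u) = u" if "u \<in> carrier LL" for u
    by (rule LL_eqI) (use that \<iota> in simp_all)
  define s where "s x = val (\<sigma> (\<iota> x))" for x
  have ring: "ring_map s"
  proof -
    have "\<iota> (x + y) = \<iota> x \<oplus>\<^bsub>LL\<^esub> \<iota> y" "\<iota> (x * y) = \<iota> x \<otimes>\<^bsub>LL\<^esub> \<iota> y" for x y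
      by (rule LL_eqI; simp add: \<iota> LL_add LL_mult)+
    moreover have "\<iota> 0 = \<zero>\<^bsub>LL\<^esub>" "\<iota> 1 = \<one>\<^bsub>LL\<^esub>" by (rule LL_eqI; simp add: \<iota> LL_zero_one)+
    ultimately show ?thesis
      using ring_hom_add[OF hom] ring_hom_mult[OF hom] ring_hom_one[OF hom] ring_hom_zero[OF hom ring_axioms ring_axioms]
      by (simp add: ring_map_def s_def \<iota> cl LL_add LL_mult LL_zero_one)
  qed
  have sK: "s k = k" if "k \<in> Kfield" for k
    using fix_K[of "\<iota> k"] \<iota>[of k] KK_iff[OF \<iota>(1), of k] that by (simp add: s_def)
  define I :: "'k poly fract" where "I = Fract [:i:] 1"
  note const = ring_map_simps[OF ring_map_comp[OF ring_map_Fract ring_map_const]]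
  have "I * I = Fract [:i\<^sup>2:] 1" by (simp add: I_def power2_eq_square)
  also have "\<dots> = - 1" unfolding i const ..
  finally have I: "I * I = - 1" .
  have "W ^ 4 \<in> (Kfield :: 'k poly fract set)"
    using KfieldI[of 1 "[:0, 1:]"] by (simp add: pcompose_pCons pcompose_1 monom_altdef Fract_hom)
  then have s4: "s W ^ 4 = W ^ 4" using sK ring_map_power[OF ring] by metis
  \<comment> \<open>T^4 - W^4 splits into the linear factors T - W, T + W, T - I W, T + I W, taken
    here at T = s W.\<close>
  have "(s W - W) * (s W + W) * ((s W - I * W) * (s W + I * W)) = (s W * s W - W * W) * (s W * s W - (I * I) * (W * W))"
    by (simp only: algebra_simps)
  also have "\<dots> = s W ^ 4 - W ^ 4" unfolding I by (simp add: algebra_simps eval_nat_numeral del: mult_fract)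
  finally have "(s W - W) * (s W + W) * ((s W - I * W) * (s W + I * W)) = 0" using s4 by simp
  then consider "s W - W = 0" | "s W + W = 0" | "s W - I * W = 0" | "s W + I * W = 0"
    unfolding mult_eq_0_iff by blast
  then have "\<exists>c. c ^ 4 = 1 \<and> s W = Fract [:c:] 1 * W"
  proof cases
    case 1
    then have "s W = Fract [:1:] 1 * W" by (simp add: fract_collapse one_pCons[symmetric])
    then show ?thesis by (intro exI[of _ 1]) simp
  next
    case 2
    then have "s W = Fract [:-1:] 1 * W" unfolding const by (simp only: eq_neg_iff_add_eq_0 mult_minus1)
    then show ?thesis by (intro exI[of _ "-1"]) simp
  next
    case 3
    moreover have "i ^ 4 = 1" using i by (simp add: eval_nat_numeral)
    ultimately show ?thesis by (intro exI[of _ i]) (simp add: I_def)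
  next
    case 4
    then have "s W = Fract [:-i:] 1 * W"
      unfolding const I_def[symmetric] by (simp only: eq_neg_iff_add_eq_0 mult_minus_left)
    moreover have "(-i) ^ 4 = 1" using i by (simp add: eval_nat_numeral)
    ultimately show ?thesis by blast
  qed
  then obtain c where c: "c ^ 4 = 1" "s W = Fract [:c:] 1 * W" by blast
  have c0: "c \<noteq> 0" using c by auto
  have s_rot: "s x = rot c x" for x
  proof -
    obtain k where k: "\<And>i. k i \<in> Kfield" "x = (\<Sum>i<4. k i * W ^ i)" using Kfield_decomposition by blast
    show ?thesis
      unfolding k(2) ring_map_simps[OF ring] ring_map_simps[OF ring_map_rot[OF c0]] c(2) rot_W[OF c0]
        sK[OF k(1)] rot_Kfield[OF c(1) k(1)] ..
  qed
  have "\<sigma> u = galois (1 / c) u" if u: "u \<in> carrier LL" for u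
  proof (rule LL_eqI)
    show "val (\<sigma> u) = val (galois (1 / c) u)"
      using s_rot[of "val u"] u c0 by (simp add: s_def \<iota>_val galois_val)
  qed (use u c0 in \<open>simp_all add: cl galois_val\<close>)
  then have "\<sigma> = galois (1 / c)"
    using bij galois_in_Bij[of "1 / c"] c0 by (intro extensionalityI[of _ "carrier LL"]) (auto simp: Bij_def)
  then show ?thesis using c by (intro exI[of _ "1 / c"]) (simp add: power_one_over)
qed

text \<open>Invariance under the single element \<open>galois i\<close> already forces an element
  into K_P, by \<open>rot_fixed\<close>; algebraicity follows from finite dimension.\<close>

lemma galois_point_quartic:
  fixes i :: "'k::field"
  assumes i: "i\<^sup>2 = - 1" and ne: "(1::'k) \<noteq> - 1"
  shows "galois_point_P (quartic :: 'k form3)"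
proof -
  interpret Ring.field "LL :: 'k rational ring" by (rule field_LL)
  have alg: "(ring.algebraic LL over KK) x" if "x \<in> carrier LL" for x :: "'k rational"
    by (rule finite_dimension_imp_algebraic[OF subfield_KK carrier_is_subring finite_dimensionI[OF dimension_LL] that])
  have i4: "i ^ 4 = 1" using i by (simp add: eval_nat_numeral)
  then have i0: "i \<noteq> 0" by auto
  have inv_i: "(1 / i)\<^sup>2 = - 1" using i by (simp add: power_one_over)
  have "x \<in> KK" if x: "x \<in> carrier LL" and "\<forall>\<sigma> \<in> carrier (gal_group LL KK). \<sigma> x = x" for x :: "'k rational"
  proof -
    have "galois i x = x" using that galois_in_G_P[OF i4] by (simp add: G_P_def)
    then have "rot (1 / i) (val x) = val x" using galois_val(2)[OF i0 x] by simp
    from rot_fixed[OF inv_i ne this] show ?thesis by (simp add: KK_iff[OF x])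
  qed
  moreover have "\<sigma> x = x" if "x \<in> KK" "\<sigma> \<in> carrier (gal_group LL KK)" for x :: "'k rational" and \<sigma>
    using that by (simp add: gal_group_def)
  ultimately have "{x \<in> carrier LL. \<forall>\<sigma> \<in> carrier (gal_group LL KK). \<sigma> x = x} = (KK :: 'k rational set)"
    using KK_subset by blast
  then show ?thesis
    unfolding galois_point_P_def galois_extension_def using field_LL subfield_KK alg by blast
qed

lemma outer_quartic: "eval3 id quartic (1, 0, 0) \<noteq> (0 :: 'k::field)"
proof -
  have id: "ring_map (id :: 'k \<Rightarrow> 'k)" by (simp add: ring_map_def)
  show ?thesis unfolding quartic_def ring_map_simps[OF ring_map_eval3[OF id]] eval3_gens[OF id] by simp
qed

section \<open>The lifts as a subgroup of the Cremona group of the plane\<close>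

lemma Lift_carrier: "c \<noteq> 0 \<Longrightarrow> Lift c \<in> carrier Bir_plane"
  using lift_bir by (auto simp: Lift_def plane.bir_carrier)

text \<open>The class Q of \<open>quad\<close> has square one, so the conjugates of
  \<open>E c\<close> and \<open>E d\<close> by Q multiply like c and d. The computation is done on
  classes because the triples agree only up to a common factor.\<close>

lemma Lift_mult:
  fixes c :: "'a::field"
  assumes "c \<noteq> 0" "d \<noteq> 0" shows "Lift c \<otimes>\<^bsub>Bir_plane\<^esub> Lift d = Lift (c * d)"
proof -
  interpret group "Bir_plane :: 'a triple set monoid" by (rule plane.group_Bir)
  define Q :: "'a triple set" where "Q = plane.cls quad"
  define E where "E c = plane.cls (diag c)" for c :: 'a
  have c: "Q \<in> carrier Bir_plane" "E c \<in> carrier Bir_plane" if "c \<noteq> 0" for c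
    using that quad_bir diag_bir by (auto simp: Q_def E_def plane.bir_carrier)
  have L: "Lift c = Q \<otimes>\<^bsub>Bir_plane\<^esub> (E c \<otimes>\<^bsub>Bir_plane\<^esub> Q)" if "c \<noteq> 0" for c
    using that unfolding Q_def E_def Lift_def lift_def
    by (simp add: plane.bir_mult quad_bir diag_bir plane.comp3_bir_triples)
  have QQ: "Q \<otimes>\<^bsub>Bir_plane\<^esub> Q = \<one>\<^bsub>Bir_plane\<^esub>"
    using plane.rat_rel_class_eq[OF quad_quad_id] by (simp add: Q_def plane.bir_mult quad_bir plane.bir_one)
  have EE: "E c \<otimes>\<^bsub>Bir_plane\<^esub> E d = E (c * d)"
    using assms by (simp add: E_def plane.bir_mult diag_bir diag_diag)
  have cd: "c * d \<noteq> 0" using assms by simp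
  note cl = c[OF assms(1)] c(2)[OF assms(2)]
  have "Lift c \<otimes>\<^bsub>Bir_plane\<^esub> Lift d = Q \<otimes>\<^bsub>Bir_plane\<^esub> (E c \<otimes>\<^bsub>Bir_plane\<^esub> ((Q \<otimes>\<^bsub>Bir_plane\<^esub> Q) \<otimes>\<^bsub>Bir_plane\<^esub> (E d \<otimes>\<^bsub>Bir_plane\<^esub> Q)))"
    unfolding L[OF assms(1)] L[OF assms(2)] using cl by (simp add: m_assoc)
  also have "\<dots> = Q \<otimes>\<^bsub>Bir_plane\<^esub> ((E c \<otimes>\<^bsub>Bir_plane\<^esub> E d) \<otimes>\<^bsub>Bir_plane\<^esub> Q)"
    unfolding QQ using cl by (simp add: m_assoc)
  finally show ?thesis unfolding EE L[OF cd] .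
qed

lemma Lift_inv:
  fixes c :: "'a::field"
  assumes "c \<noteq> 0" shows "inv\<^bsub>Bir_plane\<^esub> (Lift c) = Lift (1 / c)"
proof -
  interpret group "Bir_plane :: 'a triple set monoid" by (rule plane.group_Bir)
  have cl: "Lift (1 :: 'a) \<in> carrier Bir_plane" by (rule Lift_carrier) simp
  \<comment> \<open>An idempotent of a group is its identity.\<close>
  have "Lift (1 :: 'a) \<otimes>\<^bsub>Bir_plane\<^esub> Lift 1 = Lift 1" by (simp add: Lift_mult)
  then have "Lift (1 :: 'a) = \<one>\<^bsub>Bir_plane\<^esub>" using cl by (metis r_cancel_one)
  then have "Lift (1 / c) \<otimes>\<^bsub>Bir_plane\<^esub> Lift c = \<one>\<^bsub>Bir_plane\<^esub>" using assms by (simp add: Lift_mult)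
  then show ?thesis using assms by (intro inv_equality) (simp_all add: Lift_carrier)
qed

lemma extends_to_Bir_plane:
  fixes i :: "'k::field"
  assumes i: "i\<^sup>2 = - 1"
  shows "G_P_extends_to (quartic :: 'k form3) (carrier Bir_plane)"
proof -
  define H where "H = Lift ` {c :: 'k. c ^ 4 = 1}"
  let ?h = "\<lambda>\<phi>. bir_act quartic (restr quartic \<phi>)"
  have nz: "c \<noteq> 0" if "c ^ 4 = 1" for c :: 'k using that by auto
  have h: "?h (Lift c) = galois c" if "c ^ 4 = 1" for c :: 'k
    by (simp add: restr_Lift[OF nz[OF that]] galois_def)
  interpret group "Bir_plane :: 'k triple set monoid" by (rule plane.group_Bir)
  have sub: "subgroup H Bir_plane"
  proof (rule subgroupI)
    show "H \<subseteq> carrier Bir_plane" using nz Lift_carrier by (auto simp: H_def)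
    show "H \<noteq> {}" by (auto simp: H_def intro: exI[of _ 1])
    fix a b assume a: "a \<in> H" and b: "b \<in> H"
    then obtain c d where cd: "c ^ 4 = 1" "a = Lift c" "d ^ 4 = 1" "b = Lift d" by (auto simp: H_def)
    have "(1 / c) ^ 4 = 1" "(c * d) ^ 4 = 1" using cd by (simp_all add: power_one_over power_mult_distrib)
    then show "inv\<^bsub>Bir_plane\<^esub> a \<in> H" "a \<otimes>\<^bsub>Bir_plane\<^esub> b \<in> H"
      using cd nz by (auto simp: H_def Lift_inv Lift_mult)
  qed
  have pres: "preserves quartic \<phi>" if "\<phi> \<in> H" for \<phi>
    using that nz by (auto simp: H_def preserves_def restr_Lift covers_carrier)
  have mult: "galois c \<otimes>\<^bsub>G_P quartic\<^esub> galois d = galois (c * d)" if "c ^ 4 = 1" "d ^ 4 = 1" for c d :: 'k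
  proof -
    have B: "galois c \<in> Bij (carrier LL)" "galois d \<in> Bij (carrier LL)" "galois (c * d) \<in> Bij (carrier LL)"
      using that by (simp_all add: galois_in_Bij nz)
    have "galois c \<otimes>\<^bsub>G_P quartic\<^esub> galois d = compose (carrier LL) (galois c) (galois d)"
      using B by (simp add: G_P_def gal_group_def BijGroup_def)
    also have "\<dots> = galois (c * d)"
      by (rule extensionalityI[of _ "carrier LL"])
        (use B nz that in \<open>auto simp: Bij_def compose_def galois_galois\<close>)
    finally show ?thesis .
  qed
  have "?h \<in> hom (Bir_plane\<lparr>carrier := H\<rparr>) (G_P quartic)"
  proof (rule homI)
    fix \<phi> assume "\<phi> \<in> carrier (Bir_plane\<lparr>carrier := H\<rparr>)"
    then show "?h \<phi> \<in> carrier (G_P quartic)" using h galois_in_G_P by (auto simp: H_def)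
  next
    fix \<phi> \<psi> assume "\<phi> \<in> carrier (Bir_plane\<lparr>carrier := H\<rparr>)" "\<psi> \<in> carrier (Bir_plane\<lparr>carrier := H\<rparr>)"
    then obtain c d where cd: "c ^ 4 = 1" "\<phi> = Lift c" "d ^ 4 = 1" "\<psi> = Lift d" by (auto simp: H_def)
    have "(c * d) ^ 4 = 1" using cd by (simp add: power_mult_distrib)
    then show "?h (\<phi> \<otimes>\<^bsub>Bir_plane\<lparr>carrier := H\<rparr>\<^esub> \<psi>) = ?h \<phi> \<otimes>\<^bsub>G_P quartic\<^esub> ?h \<psi>"
      unfolding cd(2,4) h[OF cd(1)] h[OF cd(3)] mult[OF cd(1,3)]
      by (simp add: Lift_mult[OF nz[OF cd(1)] nz[OF cd(3)]] h)
  qed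
  moreover have "bij_betw ?h H (carrier (G_P quartic))"
  proof (rule bij_betw_imageI)
    show "inj_on ?h H"
      using h nz by (auto simp: H_def inj_on_def dest: galois_inj[rotated 2])
    show "?h ` H = carrier (G_P quartic)"
    proof (intro equalityI subsetI)
      fix \<sigma> assume "\<sigma> \<in> ?h ` H"
      then show "\<sigma> \<in> carrier (G_P quartic)" using h galois_in_G_P by (auto simp: H_def)
    next
      fix \<sigma> assume "\<sigma> \<in> carrier (G_P (quartic :: 'k form3))"
      then obtain c :: 'k where c: "c ^ 4 = 1" "\<sigma> = galois c" using G_P_elements[OF i] by blast
      then have "\<sigma> = ?h (Lift c)" "Lift c \<in> H" by (simp_all add: h H_def)
      then show "\<sigma> \<in> ?h ` H" by blast
    qed
  qed
  ultimately have "?h \<in> iso (Bir_plane\<lparr>carrier := H\<rparr>) (G_P quartic)" by (simp add: iso_def)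
  moreover have "H \<subseteq> carrier Bir_plane" by (rule subgroup.subset[OF sub])
  ultimately show ?thesis unfolding G_P_extends_to_def using sub pres by blast
qed

section \<open>Birational maps over the base line\<close>

text \<open>Over a domain, a nonzero element g of least degree in the ideal of f and e divides both
  up to nonzero constants, by pseudo-division. The product of these constants is the m of the Bezout
  identity.\<close>

lemma pseudo_bezout:
  fixes f e :: "'a::idom poly"
  assumes "f \<noteq> 0"
  obtains m g s t u v where "m \<noteq> 0" "g \<noteq> 0" "[:m:] * f = g * s" "[:m:] * e = g * t" "u * s + v * t = [:m:]"
proof -
  define I where "I = {u * f + v * e | u v. True}"
  have I: "f \<in> I" "e \<in> I" "\<And>a b p q. a \<in> I \<Longrightarrow> b \<in> I \<Longrightarrow> p * a - q * b \<in> I"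
  proof -
    have "1 * f + 0 * e \<in> I" "0 * f + 1 * e \<in> I" unfolding I_def by blast+
    then show "f \<in> I" "e \<in> I" by simp_all
    fix a b p q assume "a \<in> I" "b \<in> I"
    then obtain u v u' v' where "a = u * f + v * e" "b = u' * f + v' * e" by (auto simp: I_def)
    then have "p * a - q * b = (p * u - q * u') * f + (p * v - q * v') * e" by (simp add: algebra_simps)
    then show "p * a - q * b \<in> I" unfolding I_def by blast
  qed
  obtain g where g: "g \<in> I" "g \<noteq> 0" and
    min: "\<And>h. h \<in> I \<Longrightarrow> h \<noteq> 0 \<Longrightarrow> Polynomial.degree g \<le> Polynomial.degree h"
    using I(1) assms ex_has_least_nat[of "\<lambda>h. h \<in> I \<and> h \<noteq> 0" f Polynomial.degree] by blast
  have div: "\<exists>m s. m \<noteq> 0 \<and> [:m:] * h = g * s" if h: "h \<in> I" for h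
  proof -
    obtain q r where qr: "pseudo_divmod h g = (q, r)" by (cases "pseudo_divmod h g") blast
    define m where "m = Polynomial.lead_coeff g ^ (Suc (Polynomial.degree h) - Polynomial.degree g)"
    have h_eq: "[:m:] * h = g * q + r" and r: "r = 0 \<or> Polynomial.degree r < Polynomial.degree g"
      using pseudo_divmod[OF g(2) qr] by (simp_all add: m_def)
    have "r = [:m:] * h - q * g" using h_eq by (simp add: algebra_simps)
    then have "r \<in> I" using I(3)[OF h g(1), of "[:m:]" q] by simp
    then have "r = 0" using r min by fastforce
    moreover have "m \<noteq> 0" using g(2) by (simp add: m_def)
    ultimately show ?thesis using h_eq by auto
  qed
  obtain m1 s1 where 1: "m1 \<noteq> 0" "[:m1:] * f = g * s1" using div[OF I(1)] by blast
  obtain m2 s2 where 2: "m2 \<noteq> 0" "[:m2:] * e = g * s2" using div[OF I(2)] by blast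
  obtain u v where uv: "g = u * f + v * e" using g(1) by (auto simp: I_def)
  have m: "[:m1 * m2:] = [:m1:] * [:m2:]" by simp
  have s: "[:m1 * m2:] * f = g * ([:m2:] * s1)" "[:m1 * m2:] * e = g * ([:m1:] * s2)"
    unfolding m using 1(2) 2(2) by (metis mult.assoc mult.left_commute)+
  have "g * [:m1 * m2:] = u * ([:m1 * m2:] * f) + v * ([:m1 * m2:] * e)"
    by (subst (1) uv) (simp add: algebra_simps)
  also have "\<dots> = g * (u * ([:m2:] * s1) + v * ([:m1:] * s2))" unfolding s by (simp add: algebra_simps)
  finally have "u * ([:m2:] * s1) + v * ([:m1:] * s2) = [:m1 * m2:]" using g(2) by (metis mult_left_cancel)
  then show thesis using that[OF _ g(2) s] 1(1) 2(1) by simp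
qed

text \<open>In a vanishing homogeneous expression the denominator divides the leading coefficient.\<close>

lemma degree_denominator_le:
  fixes s t :: "'a::idom poly"
  assumes sum: "(\<Sum>i\<le>D. c i * s ^ i * t ^ (D - i)) = 0" and bez: "u * s + v * t = [:m:]" "m \<noteq> 0"
    and t: "t \<noteq> 0" and c: "\<exists>i\<le>D. c i \<noteq> 0" "\<And>i. Polynomial.degree (c i) \<le> 1"
  shows "Polynomial.degree t \<le> 1"
proof -
  \<comment> \<open>The top index with a nonzero coefficient: every other term carries at least one
    more factor t than the n-th.\<close>
  define n where "n = (GREATEST i. i \<le> D \<and> c i \<noteq> 0)"
  have n: "n \<le> D" "c n \<noteq> 0"
    using GreatestI_ex_nat[of "\<lambda>i. i \<le> D \<and> c i \<noteq> 0" D] c(1) by (auto simp: n_def)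
  have above: "c i = 0" if "i \<le> D" "n < i" for i
    using that Greatest_le_nat[of "\<lambda>i. i \<le> D \<and> c i \<noteq> 0" i D] unfolding n_def by force
  have "t ^ Suc (D - n) dvd (\<Sum>i\<in>{..D} - {n}. c i * s ^ i * t ^ (D - i))"
  proof (rule dvd_sum)
    fix i assume i: "i \<in> {..D} - {n}"
    show "t ^ Suc (D - n) dvd c i * s ^ i * t ^ (D - i)"
    proof (cases "n < i")
      case True
      then show ?thesis using above i by simp
    next
      case False
      then have "Suc (D - n) \<le> D - i" using i n by auto
      then show ?thesis using le_imp_power_dvd dvd_mult by blast
    qed
  qed
  moreover have "(\<Sum>i\<le>D. c i * s ^ i * t ^ (D - i))
      = c n * s ^ n * t ^ (D - n) + (\<Sum>i\<in>{..D} - {n}. c i * s ^ i * t ^ (D - i))"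
    using n(1) by (intro sum.remove) auto
  then have "c n * s ^ n * t ^ (D - n) = - (\<Sum>i\<in>{..D} - {n}. c i * s ^ i * t ^ (D - i))"
    using sum by (simp add: eq_neg_iff_add_eq_0)
  ultimately have "t ^ Suc (D - n) dvd c n * s ^ n * t ^ (D - n)" by (simp only: dvd_minus_iff)
  then have "t ^ (D - n) * t dvd t ^ (D - n) * (c n * s ^ n)" by (simp add: mult_ac)
  then have "t dvd c n * s ^ n" using t by simp
  then have 1: "t dvd u ^ n * (c n * s ^ n)" by simp
  \<comment> \<open>Modulo t the Bezout identity makes u s congruent to m, so the factor s^n can be
    traded for the constant m^n, which does not affect the degree.\<close>
  have "t dvd [:m:] ^ n - (u * s) ^ n"
  proof -
    have "[:m:] - u * s dvd [:m:] ^ n - (u * s) ^ n"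
      unfolding power_diff_sumr2[of "[:m:]"] by (rule dvd_triv_left)
    moreover have "[:m:] - u * s = v * t" using bez by (simp add: algebra_simps)
    ultimately show ?thesis by (metis dvd_mult_right)
  qed
  then have "t dvd c n * ([:m:] ^ n - (u * s) ^ n)" by simp
  then have "t dvd c n * ([:m:] ^ n - (u * s) ^ n) + u ^ n * (c n * s ^ n)" using 1 by (rule dvd_add)
  also have "c n * ([:m:] ^ n - (u * s) ^ n) + u ^ n * (c n * s ^ n) = c n * [:m:] ^ n"
    by (simp add: algebra_simps power_mult_distrib)
  finally have "t dvd [:m ^ n:] * c n" by (simp add: poly_const_pow mult.commute)
  moreover have "[:m ^ n:] * c n \<noteq> 0" using n bez by simp
  ultimately have "Polynomial.degree t \<le> Polynomial.degree ([:m ^ n:] * c n)" by (rule dvd_imp_degree_le)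
  also have "\<dots> \<le> 1" using c(2) bez by simp
  finally show ?thesis .
qed

text \<open>If \<open>(a(S) : b(S)) = x\<close> for \<open>S = f/e\<close>, then \<open>S\<close> is a Moebius transformation.\<close>

lemma rational_inverse_degree_1:
  fixes f e :: "'a::idom poly"
  assumes f: "f \<noteq> 0" "e \<noteq> 0"
    and sum: "(\<Sum>i\<le>D. c i * f ^ i * e ^ (D - i)) = 0"
    and c: "\<exists>i\<le>D. c i \<noteq> 0" "\<And>i. Polynomial.degree (c i) \<le> 1"
  obtains s t where "t \<noteq> 0" "Polynomial.degree s \<le> 1" "Polynomial.degree t \<le> 1" "s * e = t * f"
proof -
  obtain m g s t u v where m: "m \<noteq> 0" and g: "g \<noteq> 0" and sf: "[:m:] * f = g * s" and te: "[:m:] * e = g * t"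
    and bez: "u * s + v * t = [:m:]" using pseudo_bezout[OF f(1)] by blast
  have nz: "s \<noteq> 0" "t \<noteq> 0" using m f sf te by auto
  \<comment> \<open>Cancelling the common part g turns the relation for f and e into one for s and
    t, which satisfy the Bezout identity.\<close>
  have "g ^ D * (\<Sum>i\<le>D. c i * s ^ i * t ^ (D - i)) = (\<Sum>i\<le>D. [:m:] ^ D * (c i * f ^ i * e ^ (D - i)))"
    unfolding sum_distrib_left
  proof (rule sum.cong)
    fix i assume "i \<in> {..D}"
    then have pow: "x ^ D = x ^ i * x ^ (D - i)" for x :: "'a poly" by (simp flip: power_add)
    have "g ^ D * (c i * s ^ i * t ^ (D - i)) = c i * (g * s) ^ i * (g * t) ^ (D - i)"
      by (simp add: pow power_mult_distrib mult_ac)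
    also have "\<dots> = [:m:] ^ D * (c i * f ^ i * e ^ (D - i))"
      unfolding sf[symmetric] te[symmetric] by (simp only: pow power_mult_distrib mult_ac)
    finally show "g ^ D * (c i * s ^ i * t ^ (D - i)) = [:m:] ^ D * (c i * f ^ i * e ^ (D - i))" .
  qed simp
  also have "\<dots> = 0" using sum by (simp only: sum_distrib_left[symmetric]) simp
  finally have 0: "(\<Sum>i\<le>D. c i * s ^ i * t ^ (D - i)) = 0" using g by simp
  \<comment> \<open>Reversing the sum exchanges s and t, so the bound on the denominator also bounds
    the numerator.\<close>
  have "(\<Sum>i\<le>D. c (D - i) * t ^ i * s ^ (D - i)) = (\<Sum>i\<le>D. c i * s ^ i * t ^ (D - i))"
    by (rule sum.reindex_bij_witness[of _ "\<lambda>i. D - i" "\<lambda>i. D - i"]) (auto simp: mult_ac)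
  then have rev: "(\<Sum>i\<le>D. c (D - i) * t ^ i * s ^ (D - i)) = 0" using 0 by simp
  have c': "\<exists>i\<le>D. c (D - i) \<noteq> 0" using c(1) by (metis diff_diff_cancel diff_le_self)
  have bez': "v * t + u * s = [:m:]" using bez by (simp add: add.commute)
  have "g * (s * e) = g * (t * f)"
  proof -
    have "[:m:] * (g * (s * e)) = [:m:] * (g * (t * f))"
      using sf te by (metis mult.assoc mult.left_commute mult.commute)
    then show ?thesis by (subst (asm) mult_left_cancel) (use m in simp_all)
  qed
  then have "s * e = t * f" using g by simp
  then show thesis
    using that[OF nz(2) degree_denominator_le[OF rev bez' m nz(1) c' c(2)] degree_denominator_le[OF 0 bez m nz(2) c]] by blast
qed

section \<open>Forms as polynomials in the fibre coordinate x over k[y]\<close>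

definition dehom :: "'k::comm_ring_1 form3 \<Rightarrow> 'k poly poly" where
  "dehom F = eval3 (\<lambda>a. [:[:a:]:]) F ([:0, 1:], [:[:0, 1:]:], 1)"

lemma ring_map_dehom: "ring_map dehom"
  unfolding dehom_def[abs_def] by (rule ring_map_eval3[OF ring_map_const2])

lemmas dehom_hom = ring_map_simps[OF ring_map_dehom]

lemma dehom_gens: "dehom varX = [:0, 1:]" "dehom varY = [:[:0, 1:]:]" "dehom varZ = 1"
  "dehom [:[:[:a:]:]:] = [:[:a:]:]"
  by (simp_all add: dehom_def eval3_gens[OF ring_map_const2] eval3_const[OF ring_map_const2])

lemma dehom_map_poly: "dehom F = map_poly (map_poly (\<lambda>p. poly p 1)) F"
proof -
  have m: "ring_map (map_poly (map_poly (\<lambda>p::'a poly. poly p 1)))"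
    by (intro ring_map_map_poly ring_map_poly)
  have v: "map_poly (map_poly (\<lambda>p. poly p 1)) varX = [:0, 1 :: 'a poly:]"
    "map_poly (map_poly (\<lambda>p. poly p 1)) varY = [:[:0, 1 :: 'a:]:]"
    "map_poly (map_poly (\<lambda>p. poly p 1)) varZ = (1 :: 'a poly poly)"
    by (simp_all add: varX_def varY_def varZ_def map_poly_pCons one_pCons)
  show ?thesis
    by (rule ring_map_form3_eqI[OF ring_map_dehom m]) (simp_all add: dehom_gens v map_poly_pCons)
qed

definition dehom2 :: "'k::comm_ring_1 form2 \<Rightarrow> 'k poly" where
  "dehom2 A = map_poly (\<lambda>p. poly p 1) A"

lemma coeff_dehom: "Polynomial.coeff (dehom F) i = dehom2 (Polynomial.coeff F i)"
  by (simp add: dehom_map_poly dehom2_def coeff_map_poly)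

lemma dehom_form2: "dehom [:A:] = [:dehom2 A:]"
  by (simp add: dehom_map_poly dehom2_def map_poly_pCons)

text \<open>In a form, X^i Y^j is accompanied by a single power of Z, so setting Z = 1 causes no
  cancellation.\<close>

lemma dehom_eq_0:
  assumes F: "homog d F" and 0: "dehom F = 0" shows "F = 0"
proof (intro poly_eqI)
  fix i j l
  define p where "p = Polynomial.coeff (Polynomial.coeff F i) j"
  have z: "Polynomial.coeff p n = 0" if "n \<noteq> d - i - j \<or> i + j > d" for n
    using F that unfolding homog_def p_def by force
  have "p = Polynomial.monom (Polynomial.coeff p (d - i - j)) (d - i - j)"
    using z by (intro poly_eqI) (auto simp: coeff_monom)
  then have "poly p 1 = Polynomial.coeff p (d - i - j)" by (metis mult.right_neutral poly_monom power_one)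
  moreover have "poly p 1 = 0"
    using arg_cong[OF 0, of "\<lambda>P. Polynomial.coeff (Polynomial.coeff P i) j"]
    by (simp add: dehom_map_poly coeff_map_poly p_def)
  ultimately have "Polynomial.coeff p l = 0" using z by (cases "l = d - i - j") auto
  then show "Polynomial.coeff (Polynomial.coeff (Polynomial.coeff F i) j) l =
      Polynomial.coeff (Polynomial.coeff (Polynomial.coeff 0 i) j) l" by (simp add: p_def)
qed

lemma homog_coeff:
  assumes "homog D F"
  shows "i \<le> D \<Longrightarrow> homog (D - i) [:Polynomial.coeff F i:]" "D < i \<Longrightarrow> Polynomial.coeff F i = 0"
proof -
  have h: "i + j + l = D" if "Polynomial.coeff (Polynomial.coeff (Polynomial.coeff F i) j) l \<noteq> 0" for i j l
    using assms that by (auto simp: homog_def)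
  show "homog (D - i) [:Polynomial.coeff F i:]" if "i \<le> D"
    unfolding homog_def
  proof (intro allI impI)
    fix a j l assume nz: "Polynomial.coeff (Polynomial.coeff (Polynomial.coeff [:Polynomial.coeff F i:] a) j) l \<noteq> 0"
    then have "a = 0" by (cases a) auto
    then show "a + j + l = D - i" using h[of i j l] nz that by auto
  qed
  show "Polynomial.coeff F i = 0" if "D < i"
    by (intro poly_eqI) (use h[of i] that in fastforce)
qed

text \<open>\<open>dehom B = y * dehom C\<close> says that \<open>[A:B:C]\<close> lies over the identity of the base line.\<close>

lemma dehom_subst3:
  assumes G: "homog D G" and f: "dehom A = f" "dehom B = [:[:0, 1:]:] * e" "dehom C = e"
  shows "dehom (subst3 G (A, B, C)) = (\<Sum>i\<le>D. [:dehom2 (Polynomial.coeff G i):] * f ^ i * e ^ (D - i))"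
proof -
  have "dehom (subst3 G (A, B, C)) = eval3 (\<lambda>a. [:[:a:]:]) G (f, [:[:0, 1:]:] * e, e)"
    by (simp only: dehom_def eval3_subst3[OF ring_map_const2] f[unfolded dehom_def])
  also have "\<dots> = (\<Sum>i\<le>D. eval2 (\<lambda>a. [:[:a:]:]) (Polynomial.coeff G i) ([:[:0, 1:]:] * e, e) * f ^ i)"
  proof -
    define h where "h A = eval2 (\<lambda>a. [:[:a:]:]) A ([:[:0, 1:]:] * e, e)" for A :: "'a form2"
    have h0: "h 0 = 0" unfolding h_def using ring_mapD(1)[OF ring_map_eval2[OF ring_map_const2]] .
    have "Polynomial.degree (map_poly h G) \<le> D"
      by (intro degree_le) (simp add: coeff_map_poly h0 homog_coeff(2)[OF G])
    then have "poly (map_poly h G) f = (\<Sum>i\<le>D. Polynomial.coeff (map_poly h G) i * f ^ i)"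
      unfolding poly_altdef by (intro sum.mono_neutral_left) (auto simp: coeff_eq_0)
    then have "poly (map_poly h G) f = (\<Sum>i\<le>D. h (Polynomial.coeff G i) * f ^ i)"
      by (simp only: coeff_map_poly[of h, OF h0])
    then show ?thesis unfolding h_def[abs_def] by (simp only: eval3_def prod.case)
  qed
  also have "\<dots> = (\<Sum>i\<le>D. [:dehom2 (Polynomial.coeff G i):] * f ^ i * e ^ (D - i))"
  proof (rule sum.cong)
    fix i assume "i \<in> {..D}"
    then have hi: "homog (D - i) [:Polynomial.coeff G i:]" using homog_coeff(1)[OF G] by simp
    have "eval2 (\<lambda>a. [:[:a:]:]) (Polynomial.coeff G i) ([:[:0, 1:]:] * e, e)
        = eval3 (\<lambda>a. [:[:a:]:]) [:Polynomial.coeff G i:] (e * [:0, 1:], e * [:[:0, 1:]:], e * 1)"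
      by (simp add: eval3_form2[OF ring_map_const2] mult.commute)
    also have "\<dots> = e ^ (D - i) * dehom [:Polynomial.coeff G i:]"
      unfolding dehom_def by (rule eval3_homog[OF ring_map_const2 hi])
    finally show "eval2 (\<lambda>a. [:[:a:]:]) (Polynomial.coeff G i) ([:[:0, 1:]:] * e, e) * f ^ i
        = [:dehom2 (Polynomial.coeff G i):] * f ^ i * e ^ (D - i)"
      by (simp add: dehom_form2 mult_ac)
  qed simp
  finally show ?thesis .
qed

lemma dehom_zero_coeffs:
  assumes G: "homog D G" and z: "\<And>i. i \<le> D \<Longrightarrow> dehom2 (Polynomial.coeff G i) = 0"
  shows "G = 0"
proof (rule dehom_eq_0[OF G], rule poly_eqI)
  fix i
  show "Polynomial.coeff (dehom G) i = Polynomial.coeff 0 i"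
    using z[of i] homog_coeff(2)[OF G, of i] by (cases "i \<le> D") (simp_all add: coeff_dehom dehom2_def)
qed

text \<open>Restriction to the curve in affine coordinates, y -> w^4 and x -> w + w^3, so that
  \<open>param\<close> factors through \<open>dehom\<close>.\<close>

definition param_dehom :: "'k::field poly poly \<Rightarrow> 'k poly" where
  "param_dehom P = poly (map_poly pw4 P) (param varX)"

lemma ring_map_param_dehom: "ring_map param_dehom"
  unfolding param_dehom_def[abs_def] by (rule ring_map_eval1[OF ring_map_pcompose])

lemma param_dehom: "param_dehom (dehom F) = param F"
  by (rule ring_map_form3_eqI[OF ring_map_comp[OF ring_map_param_dehom ring_map_dehom] ring_map_param])
    (simp_all add: dehom_gens param_gens param_dehom_def map_poly_pCons pcompose_pCons pcompose_1)

lemma degree_le_1_eq: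
  assumes "Polynomial.degree p \<le> 1" shows "p = [:Polynomial.coeff p 0, Polynomial.coeff p 1:]"
proof (rule poly_eqI)
  fix n
  show "Polynomial.coeff p n = Polynomial.coeff [:Polynomial.coeff p 0, Polynomial.coeff p 1:] n"
    using assms coeff_eq_0[of p n] by (auto simp: coeff_pCons split: nat.split)
qed

text \<open>A birational map over the identity of the base acts on the fibres by Moebius
  transformations \<open>s/t\<close>, but \<open>w\<^sup>3 + w \<mapsto> c(w - w\<^sup>3)\<close> is not of this form over \<open>k(w\<^sup>4)\<close>.\<close>

lemma no_fibrewise_lift:
  fixes c :: "'k::field"
  assumes c: "c\<^sup>2 = - 1" "(1::'k) \<noteq> - 1"
    and F: "(F0, F1, F2) \<in> bir_triples 0" and cov: "covers c (F0, F1, F2)"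
    and fib: "dehom F1 = [:[:0, 1:]:] * dehom F2"
  shows False
proof -
  have c0: "c \<noteq> 0" using c by auto
  obtain l d where l: "l \<noteq> 0" "param F0 = l * pcompose (param varX) [:0, c:]" "param F2 = l"
    using cov by (rule coversE)
  have pc: "pcompose (param varX) [:0, c:] = [:0, c, 0, c ^ 3:]"
    by (simp add: param_gens pcompose_pCons eval_nat_numeral)
  \<comment> \<open>Hence w -> c w sends w + w^3 to c (w - w^3).\<close>
  have c3: "c ^ 3 = - c"
  proof -
    have "c ^ 3 = c\<^sup>2 * c" by (simp add: power3_eq_cube power2_eq_square)
    then show ?thesis unfolding c(1) by simp
  qed
  define f where "f = dehom F0"
  define e where "e = dehom F2"
  have pf: "param_dehom f = l * [:0, c, 0, - c:]" and pe: "param_dehom e = l"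
    using l by (simp_all add: f_def e_def param_dehom pc c3)
  have nz: "f \<noteq> 0" "e \<noteq> 0"
  proof -
    have "param_dehom f \<noteq> 0" "param_dehom e \<noteq> 0"
      unfolding pf pe using l(1) c0 by (simp_all only: mult_eq_0_iff) simp_all
    then show "f \<noteq> 0" "e \<noteq> 0" using ring_mapD(1)[OF ring_map_param_dehom] by metis+
  qed
  obtain G where G: "G \<in> self_triples 0" "(comp3 G (F0, F1, F2), (varX, varY, varZ)) \<in> rat_rel 0"
    using F by (auto simp: bir_triples_def)
  obtain G0 G1 G2 where eq: "G = (G0, G1, G2)" by (cases G) blast
  obtain D where D: "homog D G0" "homog D G1" "homog D G2" using plane.self_triples_homog G(1) unfolding eq by blast
  let ?F = "(F0, F1, F2)"
  have rel: "subst3 G0 ?F * varZ = varX * subst3 G2 ?F" "subst3 G1 ?F * varZ = varY * subst3 G2 ?F"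
    "subst3 G0 ?F \<noteq> 0 \<or> subst3 G1 ?F \<noteq> 0 \<or> subst3 G2 ?F \<noteq> 0"
    using G(2) by (auto simp: eq comp3_simp rat_rel_def rat_triples_def)
  define a where "a G i = dehom2 (Polynomial.coeff G i)" for G :: "'k form3" and i
  have sub: "dehom (subst3 G ?F) = (\<Sum>i\<le>D. [:a G i:] * f ^ i * e ^ (D - i))" if "homog D G" for G
    unfolding a_def by (rule dehom_subst3[OF that]) (simp_all add: f_def e_def fib)
  \<comment> \<open>Since G inverts F, the quotient of \<open>G0\<close> and \<open>G2\<close> at F
    is x. Dehomogenised, the sum of (a_i - x b_i) f^i e^(D - i) vanishes, with a_i and b_i in k[y];
    \<open>co i\<close> is this coefficient, linear in x.\<close>
  define co where "co i = [:a G0 i, - a G2 i:]" for i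
  have co: "co i = [:a G0 i:] - [:0, 1:] * [:a G2 i:]" for i by (simp add: co_def)
  have "(\<Sum>i\<le>D. co i * f ^ i * e ^ (D - i)) = dehom (subst3 G0 ?F) - [:0, 1:] * dehom (subst3 G2 ?F)"
    unfolding sub[OF D(1)] sub[OF D(3)] sum_distrib_left sum_subtractf[symmetric]
    by (rule sum.cong) (simp_all only: co left_diff_distrib mult.assoc)
  also have "\<dots> = 0"
    using arg_cong[OF rel(1), of dehom] by (simp only: dehom_hom dehom_gens mult_1_right right_minus_eq)
  finally have sum: "(\<Sum>i\<le>D. co i * f ^ i * e ^ (D - i)) = 0" .
  have ex: "\<exists>i\<le>D. co i \<noteq> 0"
  proof (rule ccontr)
    assume "\<not> ?thesis"
    then have "a G0 i = 0" "a G2 i = 0" if "i \<le> D" for i using that by (auto simp: co_def)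
    then have "G0 = 0" "G2 = 0" using dehom_zero_coeffs[OF D(1)] dehom_zero_coeffs[OF D(3)] unfolding a_def by blast+
    \<comment> \<open>With \<open>G0\<close> and \<open>G2\<close> zero, the relation for
      \<open>G1\<close> makes the whole composite zero, which is not a rational map.\<close>
    then show False using rel(2,3) by (simp add: subst3_hom varZ_def)
  qed
  have deg: "Polynomial.degree (co i) \<le> 1" for i by (simp add: co_def)
  obtain s t where st: "t \<noteq> 0" "Polynomial.degree s \<le> 1" "Polynomial.degree t \<le> 1" "s * e = t * f"
    using rational_inverse_degree_1[OF nz sum ex deg] .
  obtain s0 s1 where s: "s = [:s0, s1:]" using degree_le_1_eq[OF st(2)] by blast
  obtain t0 t1 where t: "t = [:t0, t1:]" using degree_le_1_eq[OF st(3)] by blast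
  have "param_dehom s * l = param_dehom t * (l * [:0, c, 0, - c:])"
    using arg_cong[OF st(4), of param_dehom] by (simp only: ring_mapD(4)[OF ring_map_param_dehom] pf pe)
  then have "l * param_dehom s = l * (param_dehom t * [:0, c, 0, - c:])" by (simp only: mult_ac)
  then have eq1: "param_dehom s = param_dehom t * [:0, c, 0, - c:]" unfolding mult_cancel_left using l(1) by blast
  have "pw4 s0 + param varX * pw4 s1 = (pw4 t0 + param varX * pw4 t1) * [:0, c, 0, - c:]"
    using eq1 by (simp add: param_dehom_def s t map_poly_pCons)
  moreover have "[:0, c, 0, - c:] = [:c:] * ([:0, 1:] - [:0, 1:] ^ 3)" by (simp add: eval_nat_numeral)
  ultimately have E: "pw4 s0 + ([:0, 1:] + [:0, 1:] ^ 3) * pw4 s1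
      = (pw4 t0 + ([:0, 1:] + [:0, 1:] ^ 3) * pw4 t1) * ([:c:] * ([:0, 1:] - [:0, 1:] ^ 3))"
    unfolding param_X by simp
  \<comment> \<open>Because (w + w^3)(w - w^3) = w^2 - w^6, the terms separate by exponent modulo 4.
    Residue 2 yields t1 = 0, and residues 1 and 3 together yield 2 c t0 = 0.\<close>
  have ring: "S0 + w * (S1 - C * T0) + w\<^sup>2 * (w ^ 4 * (C * T1) - C * T1) + w ^ 3 * (S1 + C * T0)
      = S0 + (w + w ^ 3) * S1 - (T0 + (w + w ^ 3) * T1) * (C * (w - w ^ 3))" for w S0 S1 T0 T1 C :: "'k poly"
    by (simp add: algebra_simps eval_nat_numeral)
  have sc: "pw4 (smult c q) = [:c:] * pw4 q" for q by (simp add: pcompose_smult)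
  have pC: "pw4 (pCons 0 q) = [:0, 1:] ^ 4 * pw4 q" for q :: "'k poly" by (simp add: pcompose_pCons monom_altdef)
  have "pw4 s0 + [:0, 1:] * pw4 (s1 - smult c t0) + [:0, 1:]\<^sup>2 * pw4 (pCons 0 (smult c t1) - smult c t1)
      + [:0, 1:] ^ 3 * pw4 (s1 + smult c t0)
    = pw4 s0 + [:0, 1:] * (pw4 s1 - [:c:] * pw4 t0) + [:0, 1:]\<^sup>2 * ([:0, 1:] ^ 4 * ([:c:] * pw4 t1) - [:c:] * pw4 t1)
      + [:0, 1:] ^ 3 * (pw4 s1 + [:c:] * pw4 t0)"
    unfolding pcompose_add pcompose_diff pC sc ..
  also have "\<dots> = 0" unfolding ring E by simp
  finally have *: "pw4 s0 + [:0, 1:] * pw4 (s1 - smult c t0) + [:0, 1:]\<^sup>2 * pw4 (pCons 0 (smult c t1) - smult c t1)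
      + [:0, 1:] ^ 3 * pw4 (s1 + smult c t0) = 0" .
  note z = mod4_independent'[OF one_neq_zero *]
  have "[:- c, c:] * t1 = 0" using z(3) by (simp add: algebra_simps)
  then have "t1 = 0" unfolding mult_eq_0_iff using c0 by simp
  moreover have "smult (2 * c) t0 = 0"
  proof -
    have "smult (2 * c) t0 = (s1 + smult c t0) - (s1 - smult c t0)" by (simp flip: smult_add_left)
    then show ?thesis unfolding z(2,4) by simp
  qed
  moreover have "2 * c \<noteq> 0" using c(2) c0 by (simp add: eq_neg_iff_add_eq_0)
  ultimately show False using st(1) t by simp
qed

text \<open>One element suffices, \<open>galois i\<close>. Because w -> i w fixes w^4 and the curve
  dominates the line, an extension in Jonq_P must induce the identity on the base, and
  \<open>no_fibrewise_lift\<close> excludes this.\<close>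

lemma not_extends_to_Jonq:
  fixes i :: "'k::field"
  assumes i: "i\<^sup>2 = - 1" and ne: "(1::'k) \<noteq> - 1"
  shows "\<not> G_P_extends_to (quartic :: 'k form3) Jonq_P"
proof
  assume "G_P_extends_to (quartic :: 'k form3) Jonq_P"
  then obtain H where H: "subgroup H Bir_plane" "H \<subseteq> Jonq_P" "\<And>\<phi>. \<phi> \<in> H \<Longrightarrow> preserves (quartic :: 'k form3) \<phi>"
    and iso: "(\<lambda>\<phi>. bir_act quartic (restr quartic \<phi>)) \<in> iso (Bir_plane\<lparr>carrier := H\<rparr>) (G_P (quartic :: 'k form3))"
    unfolding G_P_extends_to_def by blast
  have i4: "i ^ 4 = 1" using i by (simp add: eval_nat_numeral)
  have i0: "i \<noteq> 0" using i4 by auto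
  have "galois i \<in> (\<lambda>\<phi>. bir_act quartic (restr quartic \<phi>)) ` H"
    using galois_in_G_P[OF i4] iso by (simp add: iso_def bij_betw_def)
  then obtain \<phi> where \<phi>: "\<phi> \<in> H" "bir_act quartic (restr quartic \<phi>) = galois i" by auto
  define \<gamma> where "\<gamma> = restr (quartic :: 'k form3) \<phi>"
  have \<gamma>: "\<gamma> \<in> carrier (Bir quartic)" using H(3)[OF \<phi>(1)] by (simp add: preserves_def \<gamma>_def)
  interpret Bir: group "Bir (quartic :: 'k form3)" by (rule curve.group_Bir)
  have "inv\<^bsub>Bir quartic\<^esub> \<gamma> \<in> carrier (Bir quartic)" using \<gamma> by simp
  then obtain G where G: "G \<in> bir_triples quartic" "inv\<^bsub>Bir quartic\<^esub> \<gamma> = rat_rel quartic `` {G}"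
    by (auto simp: curve.bir_carrier)
  have Gmem: "G \<in> inv\<^bsub>Bir quartic\<^esub> \<gamma>" unfolding G(2) by (rule curve.cls_self[OF curve.bir_rat[OF G(1)]])
  obtain G0 G1 G2 where eq: "G = (G0, G1, G2)" by (cases G) blast
  obtain n where n: "homog n G0" "homog n G1" "homog n G2"
    using curve.bir_rat[OF G(1)] by (auto simp: eq rat_triples_def)
  have "\<not> quartic dvd (varZ :: 'k form3)" using quartic_dvd_iff[OF homog_vars(3)] by (simp add: param_gens)
  from curve.subst3_nonzero[OF G(1) homog_vars(3) this]
  have nz: "param G2 \<noteq> 0" using quartic_dvd_iff[OF n(3)] by (simp add: eq subst3_gens)
  \<comment> \<open>A map of the curve is recovered from its action on functions: apply the action
    to the coordinate functions V/Z.\<close>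
  have coord: "param (subst3 V G) = param G2 * pcompose (param V) [:0, 1 / i:]"
    if V: "homog 1 V" for V :: "'k form3"
  proof -
    let ?u = "frac_rel quartic `` {(V, varZ)}"
    have u: "?u \<in> carrier LL" "val ?u = Fract (param V) 1"
      using frac_cls[OF V homog_vars(3)] by (simp_all add: param_gens)
    have mem: "(V, varZ) \<in> ?u"
      using V homog_vars(3) by (auto simp: frac_rel_quartic fractions_quartic param_gens)
    have fr: "(subst3 V G, G2) \<in> fractions quartic"
      using homog_subst3[OF V n] n(3) nz by (auto simp: fractions_quartic eq)
    have "galois i ?u = pullback quartic (inv\<^bsub>Bir quartic\<^esub> \<gamma>) ?u"
      using u(1) by (simp add: \<phi>(2)[symmetric] bir_act_def \<gamma>_def)
    moreover have "(subst3 V G, subst3 varZ G) \<in> {(subst3 A G, subst3 B G) | A B G. (A, B) \<in> ?u \<and> G \<in> inv\<^bsub>Bir quartic\<^esub> \<gamma>}"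
      using mem Gmem by blast
    moreover have "((subst3 V G, G2), (subst3 V G, G2)) \<in> frac_rel quartic" using fr by (simp add: frac_rel_quartic)
    ultimately have "(subst3 V G, G2) \<in> galois i ?u"
      unfolding pullback_def by (simp add: eq subst3_gens) blast
    then have "Fract (param (subst3 V G)) (param G2) = rot (1 / i) (Fract (param V) 1)"
      using carrier_LL(2)[OF galois_val(1)[OF i0 u(1)]] galois_val(2)[OF i0 u(1)] u(2) by metis
    then show ?thesis using nz i0 by (simp add: rot_Fract pcompose_1 eq_fract mult.commute)
  qed
  have "covers (1 / i) G"
    using coord[OF homog_vars(1)] coord[OF homog_vars(2)] n nz
    by (auto simp: eq covers_def subst3_gens)
  then have "inv\<^bsub>Bir quartic\<^esub> \<gamma> = Collect (covers (1 / i))" using G(2) covers_class by simp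
  then have "inv\<^bsub>Bir quartic\<^esub> (inv\<^bsub>Bir quartic\<^esub> \<gamma>) = Collect (covers i)" using covers_inv[of "1 / i"] i0 by simp
  then have \<gamma>_eq: "\<gamma> = Collect (covers i)" using \<gamma> by simp
  have "lift i \<in> \<gamma>" using \<gamma>_eq covers_lift[OF i0] by simp
  \<comment> \<open>A representative of \<phi> that does not vanish on the curve; the representative
    witnessing membership in Jonq_P might.\<close>
  then obtain F where F: "F \<in> \<phi>" "(F, lift i) \<in> rat_rel quartic" by (auto simp: \<gamma>_def restr_def)
  have covF: "covers i F" using curve.rat_rel_sym[OF F(2)] rat_rel_covers[OF covers_lift[OF i0]] by simp
  have "\<phi> \<in> Jonq_P" using \<phi>(1) H(2) by blast
  then obtain A B E0 E1 E2 where \<phi>_bir: "\<phi> \<in> carrier Bir_plane" and AB: "(A, B) \<in> Aut_P1"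
    and E: "(E0, E1, E2) \<in> \<phi>" "(E1, E2) \<noteq> (0, 0)" "E1 * [:B:] = E2 * [:A:]"
    unfolding Jonq_P_def by fast
  obtain E' where E': "E' \<in> bir_triples 0" "\<phi> = rat_rel 0 `` {E'}" using \<phi>_bir by (auto simp: plane.bir_carrier)
  have F_bir: "F \<in> bir_triples 0" using plane.bir_triples_cong[OF E'(1)] F(1) E'(2) by blast
  have EF: "((E0, E1, E2), F) \<in> rat_rel 0"
    using plane.rat_rel_trans[OF plane.rat_rel_sym] E(1) F(1) E'(2) by blast
  obtain F0 F1 F2 where F_eq: "F = (F0, F1, F2)" by (cases F) blast
  have cross: "E1 * F2 = F1 * E2" using EF by (simp add: F_eq rat_rel_def)
  \<comment> \<open>Carries the fibration relation from the Jonq_P representative to F, through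
    their proportionality in the plane.\<close>
  have FAB: "F1 * [:B:] = F2 * [:A:]"
  proof (cases "E2 = 0")
    case True
    then have E1: "E1 \<noteq> 0" using E(2) by simp
    then have "[:B:] = 0" "F2 = 0" using True E(3) cross by auto
    then show ?thesis by simp
  next
    case False
    have "E2 * (F1 * [:B:]) = (F1 * E2) * [:B:]" by (simp only: mult_ac)
    also have "\<dots> = F2 * (E1 * [:B:])" unfolding cross[symmetric] by (simp only: mult_ac)
    also have "\<dots> = E2 * (F2 * [:A:])" unfolding E(3) by (simp only: mult_ac)
    finally show ?thesis using False by (metis mult_left_cancel)
  qed
  obtain d where d: "homog d [:A:]" "homog d [:B:]" and cop: "coprime A B"
    using AB by (auto simp: Aut_P1_def P1_morphisms_def)
  obtain l m where l: "l \<noteq> 0" "param F1 = l * pcompose (param varY) [:0, i:]" "param F2 = l"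
    using covF unfolding F_eq by (rule coversE)
  have "pcompose (param varY) [:0, i:] = param varY"
    using i4 by (simp add: param_Y pcompose_mult pcompose_pCons eval_nat_numeral ac_simps)
  then have "l * (param varY * param [:B:]) = l * param [:A:]"
    using arg_cong[OF FAB, of param] l by (simp add: param_hom mult.assoc del: mult_pCons_right)
  then have yB: "param varY * param [:B:] = param [:A:]" using l(1) by simp
  have hom0: "homog (d + 1) (varY * [:B:] - varZ * [:A:])"
    using homog_diff[OF homog_mult[OF homog_vars(2) d(2)] homog_mult[OF homog_vars(3) d(1)]] by (simp add: add.commute)
  have form: "varY * [:B:] - varZ * [:A:] = [:[:0, 1:] * B - [:[:0, 1:]:] * A:]"
    by (simp add: varY_def varZ_def)
  \<comment> \<open>Y B - Z A is a form in Y and Z that vanishes on the curve, hence it is zero: the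
    automorphism [A:B] of the base line is the identity.\<close>
  have "param (varY * [:B:] - varZ * [:A:]) = 0" using yB by (simp only: param_hom param_gens(3) mult_1_left) simp
  then have YZ: "varY * [:B:] = varZ * [:A:]"
    using param_form2_nz[OF hom0[unfolded form]] unfolding form[symmetric] using form by (metis eq_iff_diff_eq_0 pCons_0_0)
  have B0: "[:B:] \<noteq> 0"
  proof
    assume B: "[:B:] = 0"
    then have "A = 0" using YZ by (simp add: varZ_def)
    then show False using B cop by simp
  qed
  have "F1 * varZ * [:B:] = varZ * (F1 * [:B:])" by (simp only: mult_ac)
  also have "\<dots> = F2 * (varZ * [:A:])" unfolding FAB by (simp only: mult_ac)
  also have "\<dots> = varY * F2 * [:B:]" unfolding YZ[symmetric] by (simp only: mult_ac)
  finally have "F1 * varZ = varY * F2" using B0 by (metis mult_right_cancel)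
  then have "dehom F1 = [:[:0, 1:]:] * dehom F2"
    using dehom_hom(4)[of F1 varZ] dehom_hom(4)[of varY F2] by (simp only: dehom_gens mult_1_right)
  then show False using no_fibrewise_lift[OF i ne] F_bir covF unfolding F_eq by blast
qed

theorem theorem2:
  fixes C :: "'k::field form3"
  assumes "CHAR('k) \<noteq> 2"
    and "\<exists>\<zeta>::'k. \<zeta> ^ 4 = 1 \<and> (\<forall>m \<in> {1..3}. \<zeta> ^ m \<noteq> 1)"
    and "C = varX ^ 4 - 4 * varZ * varY * varX ^ 2 - varZ * varY ^ 3
             + 2 * varZ ^ 2 * varY ^ 2 - varY * varZ ^ 3"
  shows "Factorial_Ring.irreducible C \<and>
         outer_galois_point_P C \<and>
         ring.dimension (function_field C) 4 (K_P C) (carrier (function_field C)) \<and>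
         G_P_extends_to C (carrier Bir_plane) \<and>
         \<not> G_P_extends_to C Jonq_P"
proof -
  from assms(2) obtain i :: 'k where i4: "i ^ 4 = 1" and "\<forall>m \<in> {1..3}. i ^ m \<noteq> 1" by blast
  then have i2: "i\<^sup>2 \<noteq> 1" by simp
  have "(i\<^sup>2 - 1) * (i\<^sup>2 + 1) = 0" using i4 by (simp add: algebra_simps eval_nat_numeral)
  then have i: "i\<^sup>2 = - 1" using i2 by (simp add: eq_neg_iff_add_eq_0)
  have ne: "(1::'k) \<noteq> - 1" using i i2 by metis
  have C: "C = quartic" using assms(3) by (simp add: quartic_def)
  show ?thesis unfolding C outer_galois_point_P_def
    using irreducible_quartic galois_point_quartic[OF i ne] outer_quartic dimension_LL
      extends_to_Bir_plane[OF i] not_extends_to_Jonq[OF i ne] by blast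
qed

end
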